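(* Let $\mathcal{A}[\tau]$ be a locally convex quasi $C^*$-algebra over a unital $C^*$-algebra $\mathcal{A}_0$. The following are equivalent: (1) there exists a faithful $(\tau,\tau_{s^*})$-continuous $*$-representation $\pi$ of $\mathcal{A}$; (2) the set $\mathcal{S}(\mathcal{A}_0)$ is sufficient.
   Context: Let $\mathcal{A}_0$ be a unital $C^*$-algebra with norm $\|\cdot\|_0$, unit $\mathit{1}$, positive cone $(\mathcal{A}_0)_+$, $\mathcal{U}(\mathcal{A}_0)_+=\{x\in(\mathcal{A}_0)_+:\|x\|_0\le1\}$. Let $\tau$ be a locally convex topology on $\mathcal{A}_0$ given by seminorms $\{p_\lambda\}_{\lambda\in\Lambda}$, compatible with $\|\cdot\|_0$ (each net Cauchy in both topologies and convergent in one converges in the other); $\widetilde{\mathcal{A}_0}[\tau]$ is the completion, a quasi $*$-algebra over $\mathcal{A}_0$ ($ax=\lim x_\alpha x$, $xa=\lim xx_\alpha$ for $a=\tau$-$\lim x_\alpha$; involution extended by continuity). $\widetilde{\mathcal{A}_0}[\tau]_{q+}$ is the set of $\tau$-limits of nets in $(\mathcal{A}_0)_+$. Conditions: (T1) $\mathcal{A}_0[\tau]$ is a locally convex $*$-algebra with separately continuous multiplication; (T2) $\tau$ coarser than the norm topology; (T3) for each $\lambda$ there is $\lambda'$ with $p_\lambda(xy)\le\|x\|_0p_{\lambda'}(y)$ whenever $xy=yx$; (T4) $\mathcal{U}(\mathcal{A}_0)_+$ is $\tau$-closed and $\widetilde{\mathcal{A}_0}[\tau]_{q+}\cap\mathcal{A}_0=(\mathcal{A}_0)_+$.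 A locally convex quasi $C^*$-algebra $\mathcal{A}[\tau]$ over $\mathcal{A}_0$ is a $*$-invariant subspace $\mathcal{A}\supseteq\mathcal{A}_0$ of $\widetilde{\mathcal{A}_0}[\tau]$ with $ax,xa\in\mathcal{A}$ for $a\in\mathcal{A},x\in\mathcal{A}_0$, where $\tau$ satisfies (T1)–(T4). Operators: for a dense subspace $\mathcal{D}$ of a Hilbert space $\mathcal{H}$, $\mathcal{L}^\dagger(\mathcal{D},\mathcal{H})$ is the set of linear maps $X:\mathcal{D}\to\mathcal{H}$ with $\mathcal{D}(X^* )\supseteq\mathcal{D}$, with involution $X^\dagger=X^*\lceil\mathcal{D}$; $\mathcal{L}^\dagger(\mathcal{D})=\{X\in\mathcal{L}^\dagger(\mathcal{D},\mathcal{H}):X\mathcal{D}\subset\mathcal{D},X^\dagger\mathcal{D}\subset\mathcal{D}\}$; the weak partial multiplication is $X\Box Y=X^{\dagger*}Y$, defined when $Y\mathcal{D}\subset\mathcal{D}(X^{\dagger*})$ and $X^\dagger\mathcal{D}\subset\mathcal{D}(Y^* )$. The topology $\tau_{s^*}$ on $\mathcal{L}^\dagger(\mathcal{D},\mathcal{H})$ is given by the seminorms $X\mapsto\sum_{\xi\in F}(\|X\xi\|+\|X^\dagger\xi\|)$, $F\subset\mathcal{D}$ finite. A $*$-representation of $\mathcal{A}[\tau]$ is a linear map $\pi:\mathcal{A}\to\mathcal{L}^\dagger(\mathcal{D},\mathcal{H})$ such that $\pi\lceil\mathcal{A}_0$ is a $*$-representation of $\mathcal{A}_0$ (into $\mathcal{L}^\dagger(\mathcal{D})$),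 $\pi(a)^\dagger=\pi(a^* )$ for $a\in\mathcal{A}$, and $\pi(ax)=\pi(a)\Box\pi(x)$, $\pi(xa)=\pi(x)\Box\pi(a)$ for $a\in\mathcal{A},x\in\mathcal{A}_0$; it is $(\tau,\tau_{s^*})$-continuous if continuous from $\mathcal{A}[\tau]$ to $\mathcal{L}^\dagger(\mathcal{D},\mathcal{H})[\tau_{s^*}]$, faithful if injective. $\mathcal{S}(\mathcal{A}_0)$ is the set of sesquilinear forms $\varphi$ on $\mathcal{A}_0\times\mathcal{A}_0$ that are positive ($\varphi(x,x)\ge0$), invariant ($\varphi(zx,y)=\varphi(x,z^*y)$) and $\tau$-continuous ($|\varphi(x,y)|\le p(x)p(y)$ for some $\tau$-continuous seminorm $p$); each extends by continuity to a positive sesquilinear form $\tilde\varphi$ on $\mathcal{A}\times\mathcal{A}$. $\mathcal{S}(\mathcal{A}_0)$ is sufficient if $a\in\mathcal{A}$ and $\tilde\varphi(a,a)=0$ for all $\varphi\in\mathcal{S}(\mathcal{A}_0)$ imply $a=0$. *)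

theory Defs
  imports Complex_Main "HOL-Library.Function_Algebras"
begin

text \<open>
  The completion of A0[tau] is modelled as a whole type 'a (an abelian group with a complex
  scalar multiplication sc); A0 is a subset of it.  The locally convex topology tau is given
  by a family of seminorms p :: 'i => 'a => real (index set Lambda = UNIV :: 'i set), already
  extended to the completion.  Nets are represented by (proper) filters.
\<close>

definition seminorm_on :: "(complex \<Rightarrow> 'a \<Rightarrow> 'a) \<Rightarrow> 'a::ab_group_add set \<Rightarrow> ('a \<Rightarrow> real) \<Rightarrow> bool" where
  "seminorm_on sc S q \<longleftrightarrow>
     (\<forall>x\<in>S. \<forall>y\<in>S. q (x + y) \<le> q x + q y) \<and> (\<forall>c. \<forall>x\<in>S. q (sc c x) = cmod c * q x)"

definition tau_nhds :: "('i \<Rightarrow> 'a::ab_group_add \<Rightarrow> real) \<Rightarrow> 'a \<Rightarrow> 'a filter" where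
  "tau_nhds p a = (INF Le\<in>{(L, e). finite L \<and> e > (0::real)}.
                      principal {b. \<forall>l\<in>fst Le. p l (b - a) < snd Le})"

definition tau_cauchy :: "('i \<Rightarrow> 'a::ab_group_add \<Rightarrow> real) \<Rightarrow> 'a filter \<Rightarrow> bool" where
  "tau_cauchy p F \<longleftrightarrow> (\<forall>l. \<forall>e>0. eventually (\<lambda>(x, y). p l (x - y) < e) (F \<times>\<^sub>F F))"

definition norm_nhds :: "('a::ab_group_add \<Rightarrow> real) \<Rightarrow> 'a \<Rightarrow> 'a filter" where
  "norm_nhds n0 a = (INF e\<in>{0<..}. principal {b. n0 (b - a) < e})"

definition norm_cauchy :: "('a::ab_group_add \<Rightarrow> real) \<Rightarrow> 'a filter \<Rightarrow> bool" where
  "norm_cauchy n0 F \<longleftrightarrow> (\<forall>e>0. eventually (\<lambda>(x, y). n0 (x - y) < e) (F \<times>\<^sub>F F))"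

definition tau_cont_on :: "('i \<Rightarrow> 'a::ab_group_add \<Rightarrow> real) \<Rightarrow> ('j \<Rightarrow> 'b::ab_group_add \<Rightarrow> real)
                           \<Rightarrow> 'a set \<Rightarrow> ('a \<Rightarrow> 'b) \<Rightarrow> bool" where
  "tau_cont_on p q S f \<longleftrightarrow>
     (\<forall>a\<in>S. \<forall>j. \<forall>e>0. \<exists>L \<delta>. finite L \<and> \<delta> > 0 \<and>
        (\<forall>b\<in>S. (\<forall>l\<in>L. p l (b - a) < \<delta>) \<longrightarrow> q j (f b - f a) < e))"

definition invertible_in :: "'a set \<Rightarrow> ('a \<Rightarrow> 'a \<Rightarrow> 'a) \<Rightarrow> 'a \<Rightarrow> 'a \<Rightarrow> bool" where
  "invertible_in A0 mul one x \<longleftrightarrow> (\<exists>y\<in>A0. mul x y = one \<and> mul y x = one)"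

definition cstar_positive :: "'a::ab_group_add set \<Rightarrow> (complex \<Rightarrow> 'a \<Rightarrow> 'a) \<Rightarrow> ('a \<Rightarrow> 'a \<Rightarrow> 'a)
                               \<Rightarrow> ('a \<Rightarrow> 'a) \<Rightarrow> 'a \<Rightarrow> 'a \<Rightarrow> bool" where
  "cstar_positive A0 sc mul star one x \<longleftrightarrow>
     x \<in> A0 \<and> star x = x \<and>
     (\<forall>z::complex. \<not> invertible_in A0 mul one (x - sc z one) \<longrightarrow> Im z = 0 \<and> Re z \<ge> 0)"

definition pos_cone :: "'a::ab_group_add set \<Rightarrow> (complex \<Rightarrow> 'a \<Rightarrow> 'a) \<Rightarrow> ('a \<Rightarrow> 'a \<Rightarrow> 'a)
                          \<Rightarrow> ('a \<Rightarrow> 'a) \<Rightarrow> 'a \<Rightarrow> 'a set" where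
  "pos_cone A0 sc mul star one = {x. cstar_positive A0 sc mul star one x}"

definition unital_cstar_algebra :: "'a::ab_group_add set \<Rightarrow> (complex \<Rightarrow> 'a \<Rightarrow> 'a) \<Rightarrow> ('a \<Rightarrow> 'a \<Rightarrow> 'a)
                                     \<Rightarrow> ('a \<Rightarrow> 'a) \<Rightarrow> ('a \<Rightarrow> real) \<Rightarrow> 'a \<Rightarrow> bool" where
  "unital_cstar_algebra A0 sc mul star n0 one \<longleftrightarrow>
     \<comment> \<open>complex subspace, closed under product and involution, containing the unit\<close>
     0 \<in> A0 \<and> (\<forall>x\<in>A0. \<forall>y\<in>A0. x + y \<in> A0) \<and> (\<forall>c. \<forall>x\<in>A0. sc c x \<in> A0) \<and>
     one \<in> A0 \<and> (\<forall>x\<in>A0. \<forall>y\<in>A0. mul x y \<in> A0) \<and> (\<forall>x\<in>A0. star x \<in> A0) \<and>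
     \<comment> \<open>associative complex algebra with unit\<close>
     (\<forall>x\<in>A0. \<forall>y\<in>A0. \<forall>z\<in>A0. mul (mul x y) z = mul x (mul y z)) \<and>
     (\<forall>x\<in>A0. \<forall>y\<in>A0. \<forall>z\<in>A0. mul x (y + z) = mul x y + mul x z \<and> mul (x + y) z = mul x z + mul y z) \<and>
     (\<forall>c. \<forall>x\<in>A0. \<forall>y\<in>A0. mul (sc c x) y = sc c (mul x y) \<and> mul x (sc c y) = sc c (mul x y)) \<and>
     (\<forall>x\<in>A0. mul one x = x \<and> mul x one = x) \<and>
     \<comment> \<open>involution\<close>
     (\<forall>x\<in>A0. star (star x) = x) \<and>
     (\<forall>x\<in>A0. \<forall>y\<in>A0. star (x + y) = star x + star y) \<and>
     (\<forall>c. \<forall>x\<in>A0. star (sc c x) = sc (cnj c) (star x)) \<and>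
     (\<forall>x\<in>A0. \<forall>y\<in>A0. star (mul x y) = mul (star y) (star x)) \<and>
     \<comment> \<open>C*-norm\<close>
     (\<forall>x\<in>A0. n0 x \<ge> 0 \<and> (n0 x = 0 \<longleftrightarrow> x = 0)) \<and>
     (\<forall>x\<in>A0. \<forall>y\<in>A0. n0 (x + y) \<le> n0 x + n0 y) \<and>
     (\<forall>c. \<forall>x\<in>A0. n0 (sc c x) = cmod c * n0 x) \<and>
     (\<forall>x\<in>A0. \<forall>y\<in>A0. n0 (mul x y) \<le> n0 x * n0 y) \<and>
     (\<forall>x\<in>A0. n0 (mul (star x) x) = (n0 x)\<^sup>2) \<and>
     \<comment> \<open>completeness (Banach)\<close>
     (\<forall>f::nat \<Rightarrow> 'a. (\<forall>n. f n \<in> A0) \<and> (\<forall>e>0. \<exists>N. \<forall>m\<ge>N. \<forall>n\<ge>N. n0 (f m - f n) < e) \<longrightarrow>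
        (\<exists>x\<in>A0. \<forall>e>0. \<exists>N. \<forall>n\<ge>N. n0 (f n - x) < e))"

definition tau_completion :: "'a::ab_group_add set \<Rightarrow> (complex \<Rightarrow> 'a \<Rightarrow> 'a) \<Rightarrow> ('i \<Rightarrow> 'a \<Rightarrow> real) \<Rightarrow> bool" where
  "tau_completion A0 sc p \<longleftrightarrow>
     module sc \<and>
     (\<forall>l. seminorm_on sc UNIV (p l)) \<and>
     (\<forall>a. (\<forall>l. p l a = 0) \<longrightarrow> a = 0) \<and>
     (\<forall>F. F \<noteq> bot \<and> tau_cauchy p F \<longrightarrow> (\<exists>a. F \<le> tau_nhds p a)) \<and>
     (\<forall>a. inf (tau_nhds p a) (principal A0) \<noteq> bot)"

definition quasi_star_extension :: "'a::ab_group_add set \<Rightarrow> ('i \<Rightarrow> 'a \<Rightarrow> real) \<Rightarrow> ('a \<Rightarrow> 'a \<Rightarrow> 'a)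
                                      \<Rightarrow> ('a \<Rightarrow> 'a) \<Rightarrow> bool" where
  "quasi_star_extension A0 p mul star \<longleftrightarrow>
     (\<forall>a F. F \<noteq> bot \<and> F \<le> principal A0 \<and> F \<le> tau_nhds p a \<longrightarrow>
        (\<forall>x\<in>A0. filterlim (\<lambda>y. mul y x) (tau_nhds p (mul a x)) F \<and>
                 filterlim (\<lambda>y. mul x y) (tau_nhds p (mul x a)) F) \<and>
        filterlim star (tau_nhds p (star a)) F)"

definition tau_compatible :: "'a::ab_group_add set \<Rightarrow> ('a \<Rightarrow> real) \<Rightarrow> ('i \<Rightarrow> 'a \<Rightarrow> real) \<Rightarrow> bool" where
  "tau_compatible A0 n0 p \<longleftrightarrow>
     (\<forall>F. F \<noteq> bot \<and> F \<le> principal A0 \<and> tau_cauchy p F \<and> norm_cauchy n0 F \<longrightarrow>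
        ((\<exists>x\<in>A0. F \<le> norm_nhds n0 x) \<longleftrightarrow> (\<exists>x\<in>A0. F \<le> tau_nhds p x)))"

definition cond_T1 :: "'a::ab_group_add set \<Rightarrow> ('i \<Rightarrow> 'a \<Rightarrow> real) \<Rightarrow> ('a \<Rightarrow> 'a \<Rightarrow> 'a) \<Rightarrow> ('a \<Rightarrow> 'a) \<Rightarrow> bool" where
  "cond_T1 A0 p mul star \<longleftrightarrow>
     tau_cont_on p p A0 star \<and>
     (\<forall>x\<in>A0. tau_cont_on p p A0 (\<lambda>y. mul x y) \<and> tau_cont_on p p A0 (\<lambda>y. mul y x))"

definition cond_T2 :: "'a::ab_group_add set \<Rightarrow> ('a \<Rightarrow> real) \<Rightarrow> ('i \<Rightarrow> 'a \<Rightarrow> real) \<Rightarrow> bool" where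
  "cond_T2 A0 n0 p \<longleftrightarrow>
     (\<forall>a\<in>A0. \<forall>l. \<forall>e>0. \<exists>\<delta>>0. \<forall>b\<in>A0. n0 (b - a) < \<delta> \<longrightarrow> p l (b - a) < e)"

definition cond_T3 :: "'a::ab_group_add set \<Rightarrow> ('a \<Rightarrow> 'a \<Rightarrow> 'a) \<Rightarrow> ('a \<Rightarrow> real) \<Rightarrow> ('i \<Rightarrow> 'a \<Rightarrow> real) \<Rightarrow> bool" where
  "cond_T3 A0 mul n0 p \<longleftrightarrow>
     (\<forall>l. \<exists>l'. \<forall>x\<in>A0. \<forall>y\<in>A0. mul x y = mul y x \<longrightarrow> p l (mul x y) \<le> n0 x * p l' y)"

definition unit_pos_ball :: "'a::ab_group_add set \<Rightarrow> (complex \<Rightarrow> 'a \<Rightarrow> 'a) \<Rightarrow> ('a \<Rightarrow> 'a \<Rightarrow> 'a)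
                               \<Rightarrow> ('a \<Rightarrow> 'a) \<Rightarrow> ('a \<Rightarrow> real) \<Rightarrow> 'a \<Rightarrow> 'a set" where
  "unit_pos_ball A0 sc mul star n0 one = {x \<in> pos_cone A0 sc mul star one. n0 x \<le> 1}"

definition qpos :: "'a::ab_group_add set \<Rightarrow> (complex \<Rightarrow> 'a \<Rightarrow> 'a) \<Rightarrow> ('a \<Rightarrow> 'a \<Rightarrow> 'a)
                      \<Rightarrow> ('a \<Rightarrow> 'a) \<Rightarrow> 'a \<Rightarrow> ('i \<Rightarrow> 'a \<Rightarrow> real) \<Rightarrow> 'a set" where
  "qpos A0 sc mul star one p =
     {a. \<exists>F. F \<noteq> bot \<and> F \<le> principal (pos_cone A0 sc mul star one) \<and> F \<le> tau_nhds p a}"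

definition cond_T4 :: "'a::ab_group_add set \<Rightarrow> (complex \<Rightarrow> 'a \<Rightarrow> 'a) \<Rightarrow> ('a \<Rightarrow> 'a \<Rightarrow> 'a)
                         \<Rightarrow> ('a \<Rightarrow> 'a) \<Rightarrow> ('a \<Rightarrow> real) \<Rightarrow> 'a \<Rightarrow> ('i \<Rightarrow> 'a \<Rightarrow> real) \<Rightarrow> bool" where
  "cond_T4 A0 sc mul star n0 one p \<longleftrightarrow>
     \<comment> \<open>U(A0)_+ is tau-closed (in A0[tau])\<close>
     (\<forall>x\<in>A0. \<forall>F. F \<noteq> bot \<and> F \<le> principal (unit_pos_ball A0 sc mul star n0 one) \<and> F \<le> tau_nhds p x
               \<longrightarrow> x \<in> unit_pos_ball A0 sc mul star n0 one) \<and>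
     qpos A0 sc mul star one p \<inter> A0 = pos_cone A0 sc mul star one"

definition lc_quasi_cstar_algebra ::
  "'a::ab_group_add set \<Rightarrow> (complex \<Rightarrow> 'a \<Rightarrow> 'a) \<Rightarrow> ('a \<Rightarrow> 'a \<Rightarrow> 'a) \<Rightarrow> ('a \<Rightarrow> 'a) \<Rightarrow> ('a \<Rightarrow> real) \<Rightarrow> 'a
   \<Rightarrow> ('i \<Rightarrow> 'a \<Rightarrow> real) \<Rightarrow> 'a set \<Rightarrow> bool" where
  "lc_quasi_cstar_algebra A0 sc mul star n0 one p A \<longleftrightarrow>
     unital_cstar_algebra A0 sc mul star n0 one \<and>
     tau_completion A0 sc p \<and>
     quasi_star_extension A0 p mul star \<and>
     tau_compatible A0 n0 p \<and>
     cond_T1 A0 p mul star \<and> cond_T2 A0 n0 p \<and> cond_T3 A0 mul n0 p \<and>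
     cond_T4 A0 sc mul star n0 one p \<and>
     \<comment> \<open>A: *-invariant subspace of the completion containing A0, A0-bimodule\<close>
     A0 \<subseteq> A \<and> 0 \<in> A \<and> (\<forall>a\<in>A. \<forall>b\<in>A. a + b \<in> A) \<and> (\<forall>c. \<forall>a\<in>A. sc c a \<in> A) \<and>
     (\<forall>a\<in>A. star a \<in> A) \<and>
     (\<forall>a\<in>A. \<forall>x\<in>A0. mul a x \<in> A \<and> mul x a \<in> A)"

definition hnorm :: "('h \<Rightarrow> 'h \<Rightarrow> complex) \<Rightarrow> 'h \<Rightarrow> real" where
  "hnorm ip x = sqrt (Re (ip x x))"

definition hilbert_space :: "'h::ab_group_add set \<Rightarrow> (complex \<Rightarrow> 'h \<Rightarrow> 'h) \<Rightarrow> ('h \<Rightarrow> 'h \<Rightarrow> complex) \<Rightarrow> bool" where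
  "hilbert_space H sch ip \<longleftrightarrow>
     0 \<in> H \<and> (\<forall>x\<in>H. \<forall>y\<in>H. x + y \<in> H) \<and> (\<forall>x\<in>H. - x \<in> H) \<and> (\<forall>c. \<forall>x\<in>H. sch c x \<in> H) \<and>
     (\<forall>c. \<forall>x\<in>H. \<forall>y\<in>H. sch c (x + y) = sch c x + sch c y) \<and>
     (\<forall>c d. \<forall>x\<in>H. sch (c + d) x = sch c x + sch d x) \<and>
     (\<forall>c d. \<forall>x\<in>H. sch c (sch d x) = sch (c * d) x) \<and>
     (\<forall>x\<in>H. sch 1 x = x) \<and>
     (\<forall>x\<in>H. \<forall>y\<in>H. \<forall>z\<in>H. ip (x + y) z = ip x z + ip y z) \<and>
     (\<forall>c. \<forall>x\<in>H. \<forall>y\<in>H. ip (sch c x) y = c * ip x y) \<and>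
     (\<forall>x\<in>H. \<forall>y\<in>H. ip y x = cnj (ip x y)) \<and>
     (\<forall>x\<in>H. Re (ip x x) \<ge> 0 \<and> (ip x x = 0 \<longrightarrow> x = 0)) \<and>
     (\<forall>f::nat \<Rightarrow> 'h. (\<forall>n. f n \<in> H) \<and> (\<forall>e>0. \<exists>N. \<forall>m\<ge>N. \<forall>n\<ge>N. hnorm ip (f m - f n) < e) \<longrightarrow>
        (\<exists>x\<in>H. \<forall>e>0. \<exists>N. \<forall>n\<ge>N. hnorm ip (f n - x) < e))"

definition dense_subspace :: "'h::ab_group_add set \<Rightarrow> (complex \<Rightarrow> 'h \<Rightarrow> 'h) \<Rightarrow> ('h \<Rightarrow> 'h \<Rightarrow> complex)
                                \<Rightarrow> 'h set \<Rightarrow> bool" where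
  "dense_subspace H sch ip D \<longleftrightarrow>
     D \<subseteq> H \<and> 0 \<in> D \<and> (\<forall>x\<in>D. \<forall>y\<in>D. x + y \<in> D) \<and> (\<forall>c. \<forall>x\<in>D. sch c x \<in> D) \<and>
     (\<forall>x\<in>H. \<forall>e>0. \<exists>y\<in>D. hnorm ip (x - y) < e)"

definition adj_dom :: "'h set \<Rightarrow> ('h \<Rightarrow> 'h \<Rightarrow> complex) \<Rightarrow> 'h set \<Rightarrow> ('h \<Rightarrow> 'h) \<Rightarrow> 'h set" where
  "adj_dom H ip D X = {\<eta>\<in>H. \<exists>\<zeta>\<in>H. \<forall>\<xi>\<in>D. ip (X \<xi>) \<eta> = ip \<xi> \<zeta>}"

definition adj :: "'h set \<Rightarrow> ('h \<Rightarrow> 'h \<Rightarrow> complex) \<Rightarrow> 'h set \<Rightarrow> ('h \<Rightarrow> 'h) \<Rightarrow> 'h \<Rightarrow> 'h" where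
  "adj H ip D X \<eta> = (THE \<zeta>. \<zeta> \<in> H \<and> (\<forall>\<xi>\<in>D. ip (X \<xi>) \<eta> = ip \<xi> \<zeta>))"

text \<open>X in L^dagger(D,H) (values of X outside D are irrelevant); X^dagger = adj H ip D X on D.\<close>
definition Ldagger :: "'h::ab_group_add set \<Rightarrow> (complex \<Rightarrow> 'h \<Rightarrow> 'h) \<Rightarrow> ('h \<Rightarrow> 'h \<Rightarrow> complex)
                         \<Rightarrow> 'h set \<Rightarrow> ('h \<Rightarrow> 'h) \<Rightarrow> bool" where
  "Ldagger H sch ip D X \<longleftrightarrow>
     (\<forall>\<xi>\<in>D. X \<xi> \<in> H) \<and>
     (\<forall>\<xi>\<in>D. \<forall>\<eta>\<in>D. X (\<xi> + \<eta>) = X \<xi> + X \<eta>) \<and> (\<forall>c. \<forall>\<xi>\<in>D. X (sch c \<xi>) = sch c (X \<xi>)) \<and>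
     D \<subseteq> adj_dom H ip D X"

definition Ldagger_alg :: "'h::ab_group_add set \<Rightarrow> (complex \<Rightarrow> 'h \<Rightarrow> 'h) \<Rightarrow> ('h \<Rightarrow> 'h \<Rightarrow> complex)
                             \<Rightarrow> 'h set \<Rightarrow> ('h \<Rightarrow> 'h) \<Rightarrow> bool" where
  "Ldagger_alg H sch ip D X \<longleftrightarrow>
     Ldagger H sch ip D X \<and> X ` D \<subseteq> D \<and> adj H ip D X ` D \<subseteq> D"

definition weak_mult_defined :: "'h set \<Rightarrow> ('h \<Rightarrow> 'h \<Rightarrow> complex) \<Rightarrow> 'h set \<Rightarrow> ('h \<Rightarrow> 'h) \<Rightarrow> ('h \<Rightarrow> 'h) \<Rightarrow> bool" where
  "weak_mult_defined H ip D X Y \<longleftrightarrow>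
     Y ` D \<subseteq> adj_dom H ip D (adj H ip D X) \<and> adj H ip D X ` D \<subseteq> adj_dom H ip D Y"

definition weak_mult :: "'h set \<Rightarrow> ('h \<Rightarrow> 'h \<Rightarrow> complex) \<Rightarrow> 'h set \<Rightarrow> ('h \<Rightarrow> 'h) \<Rightarrow> ('h \<Rightarrow> 'h) \<Rightarrow> 'h \<Rightarrow> 'h" where
  "weak_mult H ip D X Y \<xi> = adj H ip D (adj H ip D X) (Y \<xi>)"

definition star_rep ::
  "'a::ab_group_add set \<Rightarrow> (complex \<Rightarrow> 'a \<Rightarrow> 'a) \<Rightarrow> ('a \<Rightarrow> 'a \<Rightarrow> 'a) \<Rightarrow> ('a \<Rightarrow> 'a) \<Rightarrow> 'a set
   \<Rightarrow> 'h::ab_group_add set \<Rightarrow> (complex \<Rightarrow> 'h \<Rightarrow> 'h) \<Rightarrow> ('h \<Rightarrow> 'h \<Rightarrow> complex) \<Rightarrow> 'h set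
   \<Rightarrow> ('a \<Rightarrow> 'h \<Rightarrow> 'h) \<Rightarrow> bool" where
  "star_rep A0 sc mul star A H sch ip D \<pi> \<longleftrightarrow>
     hilbert_space H sch ip \<and> dense_subspace H sch ip D \<and>
     \<comment> \<open>linear map A -> L^dagger(D,H)\<close>
     (\<forall>a\<in>A. Ldagger H sch ip D (\<pi> a)) \<and>
     (\<forall>a\<in>A. \<forall>b\<in>A. \<forall>\<xi>\<in>D. \<pi> (a + b) \<xi> = \<pi> a \<xi> + \<pi> b \<xi>) \<and>
     (\<forall>c. \<forall>a\<in>A. \<forall>\<xi>\<in>D. \<pi> (sc c a) \<xi> = sch c (\<pi> a \<xi>)) \<and>
     \<comment> \<open>restriction to A0 is a *-representation of A0 into L^dagger(D)\<close>
     (\<forall>x\<in>A0. Ldagger_alg H sch ip D (\<pi> x)) \<and>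
     (\<forall>x\<in>A0. \<forall>y\<in>A0. \<forall>\<xi>\<in>D. \<pi> (mul x y) \<xi> = \<pi> x (\<pi> y \<xi>)) \<and>
     \<comment> \<open>pi(a)^dagger = pi(a*)\<close>
     (\<forall>a\<in>A. \<forall>\<xi>\<in>D. adj H ip D (\<pi> a) \<xi> = \<pi> (star a) \<xi>) \<and>
     \<comment> \<open>pi(a x) = pi(a) \<box> pi(x), pi(x a) = pi(x) \<box> pi(a)\<close>
     (\<forall>a\<in>A. \<forall>x\<in>A0.
        weak_mult_defined H ip D (\<pi> a) (\<pi> x) \<and> (\<forall>\<xi>\<in>D. \<pi> (mul a x) \<xi> = weak_mult H ip D (\<pi> a) (\<pi> x) \<xi>) \<and>
        weak_mult_defined H ip D (\<pi> x) (\<pi> a) \<and> (\<forall>\<xi>\<in>D. \<pi> (mul x a) \<xi> = weak_mult H ip D (\<pi> x) (\<pi> a) \<xi>))"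

definition rep_continuous :: "('i \<Rightarrow> 'a::ab_group_add \<Rightarrow> real) \<Rightarrow> 'a set \<Rightarrow> 'h::ab_group_add set
                                \<Rightarrow> ('h \<Rightarrow> 'h \<Rightarrow> complex) \<Rightarrow> 'h set \<Rightarrow> ('a \<Rightarrow> 'h \<Rightarrow> 'h) \<Rightarrow> bool" where
  "rep_continuous p A H ip D \<pi> \<longleftrightarrow>
     (\<forall>a\<in>A. \<forall>F. finite F \<and> F \<subseteq> D \<longrightarrow> (\<forall>e>0. \<exists>L \<delta>. finite L \<and> \<delta> > 0 \<and>
        (\<forall>b\<in>A. (\<forall>l\<in>L. p l (b - a) < \<delta>) \<longrightarrow>
           (\<Sum>\<xi>\<in>F. hnorm ip (\<pi> b \<xi> - \<pi> a \<xi>) + hnorm ip (adj H ip D (\<pi> b) \<xi> - adj H ip D (\<pi> a) \<xi>)) < e)))"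

definition rep_faithful :: "'a set \<Rightarrow> 'h set \<Rightarrow> ('a \<Rightarrow> 'h \<Rightarrow> 'h) \<Rightarrow> bool" where
  "rep_faithful A D \<pi> \<longleftrightarrow> (\<forall>a\<in>A. \<forall>b\<in>A. (\<forall>\<xi>\<in>D. \<pi> a \<xi> = \<pi> b \<xi>) \<longrightarrow> a = b)"

definition faithful_cont_star_rep ::
  "'a::ab_group_add set \<Rightarrow> (complex \<Rightarrow> 'a \<Rightarrow> 'a) \<Rightarrow> ('a \<Rightarrow> 'a \<Rightarrow> 'a) \<Rightarrow> ('a \<Rightarrow> 'a) \<Rightarrow> ('i \<Rightarrow> 'a \<Rightarrow> real)
   \<Rightarrow> 'a set \<Rightarrow> 'h::ab_group_add set \<Rightarrow> (complex \<Rightarrow> 'h \<Rightarrow> 'h) \<Rightarrow> ('h \<Rightarrow> 'h \<Rightarrow> complex) \<Rightarrow> 'h set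
   \<Rightarrow> ('a \<Rightarrow> 'h \<Rightarrow> 'h) \<Rightarrow> bool" where
  "faithful_cont_star_rep A0 sc mul star p A H sch ip D \<pi> \<longleftrightarrow>
     star_rep A0 sc mul star A H sch ip D \<pi> \<and> rep_continuous p A H ip D \<pi> \<and> rep_faithful A D \<pi>"

text \<open>Concrete big Hilbert-space ambient type used on the existence side (l^2-type spaces over
  the index type (forms on 'a) x 'a are large enough to host every Hilbert space needed).\<close>
type_synonym 'a rep_space = "(('a \<Rightarrow> 'a \<Rightarrow> complex) \<times> 'a) \<Rightarrow> complex"

definition tau_cont_seminorm :: "'a::ab_group_add set \<Rightarrow> (complex \<Rightarrow> 'a \<Rightarrow> 'a) \<Rightarrow> ('i \<Rightarrow> 'a \<Rightarrow> real)
                                   \<Rightarrow> ('a \<Rightarrow> real) \<Rightarrow> bool" where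
  "tau_cont_seminorm A0 sc p q \<longleftrightarrow>
     seminorm_on sc A0 q \<and> (\<exists>L C. finite L \<and> (\<forall>x\<in>A0. q x \<le> C * (\<Sum>l\<in>L. p l x)))"

definition S_forms :: "'a::ab_group_add set \<Rightarrow> (complex \<Rightarrow> 'a \<Rightarrow> 'a) \<Rightarrow> ('a \<Rightarrow> 'a \<Rightarrow> 'a) \<Rightarrow> ('a \<Rightarrow> 'a)
                         \<Rightarrow> ('i \<Rightarrow> 'a \<Rightarrow> real) \<Rightarrow> ('a \<Rightarrow> 'a \<Rightarrow> complex) set" where
  "S_forms A0 sc mul star p = {\<phi>.
     \<comment> \<open>sesquilinear on A0 (linear in the first, conjugate linear in the second variable)\<close>
     (\<forall>x\<in>A0. \<forall>x'\<in>A0. \<forall>y\<in>A0. \<phi> (x + x') y = \<phi> x y + \<phi> x' y \<and> \<phi> y (x + x') = \<phi> y x + \<phi> y x') \<and>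
     (\<forall>c. \<forall>x\<in>A0. \<forall>y\<in>A0. \<phi> (sc c x) y = c * \<phi> x y \<and> \<phi> x (sc c y) = cnj c * \<phi> x y) \<and>
     \<comment> \<open>positive\<close>
     (\<forall>x\<in>A0. Im (\<phi> x x) = 0 \<and> Re (\<phi> x x) \<ge> 0) \<and>
     \<comment> \<open>invariant\<close>
     (\<forall>x\<in>A0. \<forall>y\<in>A0. \<forall>z\<in>A0. \<phi> (mul z x) y = \<phi> x (mul (star z) y)) \<and>
     \<comment> \<open>tau-continuous\<close>
     (\<exists>q. tau_cont_seminorm A0 sc p q \<and> (\<forall>x\<in>A0. \<forall>y\<in>A0. cmod (\<phi> x y) \<le> q x * q y))}"

definition form_ext :: "'a::ab_group_add set \<Rightarrow> ('i \<Rightarrow> 'a \<Rightarrow> real) \<Rightarrow> ('a \<Rightarrow> 'a \<Rightarrow> complex) \<Rightarrow> 'a \<Rightarrow> 'a \<Rightarrow> complex" where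
  "form_ext A0 p \<phi> a b = (THE c. filterlim (\<lambda>(x, y). \<phi> x y) (nhds c)
                          (inf (tau_nhds p a \<times>\<^sub>F tau_nhds p b) (principal (A0 \<times> A0))))"

definition S_sufficient :: "'a::ab_group_add set \<Rightarrow> (complex \<Rightarrow> 'a \<Rightarrow> 'a) \<Rightarrow> ('a \<Rightarrow> 'a \<Rightarrow> 'a) \<Rightarrow> ('a \<Rightarrow> 'a)
                              \<Rightarrow> ('i \<Rightarrow> 'a \<Rightarrow> real) \<Rightarrow> 'a set \<Rightarrow> bool" where
  "S_sufficient A0 sc mul star p A \<longleftrightarrow>
     (\<forall>a\<in>A. (\<forall>\<phi>\<in>S_forms A0 sc mul star p. form_ext A0 p \<phi> a a = 0) \<longrightarrow> a = 0)"

end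

theory Submission
  imports Defs
begin

text \<open>
  If \<pi> is a faithful continuous representation, every vector \<xi> gives the form
  (x, y) \<mapsto> \<langle>\<pi>(x)\<xi>, \<pi>(y)\<xi>\<rangle> in S(A0), whose extension at (a, a) is the square of the norm
  of \<pi>(a)\<xi>; hence S(A0) is sufficient.  Conversely, the GNS construction is carried out for all
  forms at once.  Finitely supported families v = (v(\<phi>)) of elements of the completion carry the
  semi-inner product \<Sum> \<phi>~(v(\<phi>), w(\<phi>)); the families with values in A0 are dense and form the
  domain, on which a acts by left multiplication.  The vector at \<phi> with value 1 is sent by a to a
  vector of squared norm \<phi>~(a, a), so sufficiency gives faithfulness.
\<close>

section \<open>Semi-inner product spaces and their completions\<close>

text \<open>The carrier type of the Hilbert space is prescribed: complex functions on pairs of a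
  form and an element. So no quotient is formed. A family is sent to its pairings with the
  one-component families; null vectors become the zero function, and density of the A0-valued
  families makes this faithful on the completion. Values in the whole completion of A0 are allowed
  because multiplication by \<open>a\<close> takes A0-valued families out of A0; keeping both levels
  gives pi(a) by a formula instead of a limit. The obstacle is that pi(a) is unbounded, so no norm
  estimate makes it well defined modulo null vectors. The identity phi~(a x, y) = phi~(x, a* y) for
  x, y in A0 does this and at the same time yields the adjoint. For the weak product of pi(x) and
  pi(a), where pi(a) leaves the domain, the same identity is proved with the multiplier in A0 and
  both vectors in the completion.\<close>

lemma tendsto_norm_le_0:
  fixes f :: "'b \<Rightarrow> 'c::real_normed_vector"
  assumes "eventually (\<lambda>n. norm (f n) \<le> g n) F" "(g \<longlongrightarrow> 0) F"
  shows "(f \<longlongrightarrow> 0) F"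
proof (rule tendsto_norm_zero_cancel)
  show "((\<lambda>n. norm (f n)) \<longlongrightarrow> 0) F"
    by (rule tendsto_sandwich[OF _ assms(1) tendsto_const assms(2)]) simp
qed

text \<open>Four spaces instantiate this locale: the completion under one extended form, the direct
  sum, the Hilbert space built from it, and the Hilbert space of a given representation.
  \<open>sm_minus_one\<close> ties the scalars to the negation of the ambient group.\<close>

locale semi_inner_space =
  fixes W :: "'w::ab_group_add set" and sm :: "complex \<Rightarrow> 'w \<Rightarrow> 'w" and s :: "'w \<Rightarrow> 'w \<Rightarrow> complex"
  assumes zero_in: "0 \<in> W"
    and add_in: "x \<in> W \<Longrightarrow> y \<in> W \<Longrightarrow> x + y \<in> W"
    and sm_in: "x \<in> W \<Longrightarrow> sm c x \<in> W"
    and sm_minus_one: "x \<in> W \<Longrightarrow> sm (-1) x = - x"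
    and sm_add: "x \<in> W \<Longrightarrow> y \<in> W \<Longrightarrow> sm c (x + y) = sm c x + sm c y"
    and s_add_left: "x \<in> W \<Longrightarrow> y \<in> W \<Longrightarrow> z \<in> W \<Longrightarrow> s (x + y) z = s x z + s y z"
    and s_sm_left: "x \<in> W \<Longrightarrow> y \<in> W \<Longrightarrow> s (sm c x) y = c * s x y"
    and s_cnj: "x \<in> W \<Longrightarrow> y \<in> W \<Longrightarrow> s y x = cnj (s x y)"
    and s_nonneg: "x \<in> W \<Longrightarrow> 0 \<le> Re (s x x)"
begin

lemma minus_in: "x \<in> W \<Longrightarrow> - x \<in> W"
  using sm_in[of x "-1"] sm_minus_one[of x] by simp

lemma diff_in: "x \<in> W \<Longrightarrow> y \<in> W \<Longrightarrow> x - y \<in> W"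
  using add_in[of x "- y"] minus_in[of y] by simp

lemma sm_diff: "x \<in> W \<Longrightarrow> y \<in> W \<Longrightarrow> sm c (x - y) = sm c x - sm c y"
  using sm_add[of "x - y" y c] by (simp add: diff_in)

lemma s_minus_left: "x \<in> W \<Longrightarrow> y \<in> W \<Longrightarrow> s (- x) y = - s x y"
  using s_sm_left[of x y "-1"] sm_minus_one[of x] by simp

lemma s_diff_left: "x \<in> W \<Longrightarrow> y \<in> W \<Longrightarrow> z \<in> W \<Longrightarrow> s (x - y) z = s x z - s y z"
  using s_add_left[of x "- y" z] minus_in[of y] s_minus_left[of y z] by simp

lemma s_add_right: "x \<in> W \<Longrightarrow> y \<in> W \<Longrightarrow> z \<in> W \<Longrightarrow> s x (y + z) = s x y + s x z"
  by (metis s_cnj s_add_left add_in complex_cnj_add)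

lemma s_sm_right: "x \<in> W \<Longrightarrow> y \<in> W \<Longrightarrow> s x (sm c y) = cnj c * s x y"
  by (metis s_cnj s_sm_left sm_in complex_cnj_mult)

lemma s_diff_right: "x \<in> W \<Longrightarrow> y \<in> W \<Longrightarrow> z \<in> W \<Longrightarrow> s x (y - z) = s x y - s x z"
  by (metis s_cnj s_diff_left diff_in complex_cnj_diff)

lemma s_zero_left: "x \<in> W \<Longrightarrow> s 0 x = 0"
  using s_diff_left[of x x x] by simp

lemma s_zero_right: "x \<in> W \<Longrightarrow> s x 0 = 0"
  using s_diff_right[of x x x] by simp

lemma s_self: "x \<in> W \<Longrightarrow> s x x = complex_of_real ((hnorm s x)\<^sup>2)"
  using s_cnj[of x x] s_nonneg[of x] by (simp add: hnorm_def complex_eq_iff)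

lemma hnorm_nonneg: "x \<in> W \<Longrightarrow> 0 \<le> hnorm s x"
  by (simp add: hnorm_def s_nonneg)

lemma hnorm_zero: "hnorm s 0 = 0"
  by (simp add: hnorm_def s_zero_left zero_in)

lemma cauchy_schwarz:
  assumes x: "x \<in> W" and y: "y \<in> W"
  shows "cmod (s x y) \<le> hnorm s x * hnorm s y"
proof -
  define a b c where "a = Re (s x x)" and "b = Re (s y y)" and "c = s x y"
  have ab: "0 \<le> a" "0 \<le> b"
    using s_nonneg x y by (auto simp: a_def b_def)
  \<comment> \<open>The multiplier \<open>z = - t * c\<close> makes both cross terms real, so
    positivity becomes a quadratic inequality in the real number \<open>t\<close>.\<close>
  have key: "0 \<le> a - 2 * t * (cmod c)\<^sup>2 + t\<^sup>2 * (cmod c)\<^sup>2 * b" for t :: real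
  proof -
    define z where "z = - complex_of_real t * c"
    have "s (x + sm z y) (x + sm z y) = s x x + cnj z * c + z * cnj c + z * cnj z * s y y"
      using x y sm_in[OF y, of z] s_cnj[OF x y]
      by (simp add: s_add_left s_add_right add_in s_sm_left s_sm_right c_def algebra_simps)
    moreover have "s x x = of_real a" "s y y = of_real b"
      using s_self[OF x] s_self[OF y] by (simp_all add: a_def b_def)
    moreover have "cnj z * c = - of_real (t * (cmod c)\<^sup>2)" "z * cnj c = - of_real (t * (cmod c)\<^sup>2)"
      "z * cnj z = of_real (t\<^sup>2 * (cmod c)\<^sup>2)"
      using complex_norm_square[of c] by (simp_all add: z_def power2_eq_square algebra_simps)
    ultimately have "s (x + sm z y) (x + sm z y)
        = of_real (a - 2 * t * (cmod c)\<^sup>2 + t\<^sup>2 * (cmod c)\<^sup>2 * b)"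
      by simp
    then show ?thesis
      using s_nonneg[OF add_in[OF x sm_in[OF y, of z]]] by simp
  qed
  have "(cmod c)\<^sup>2 \<le> a * b"
  proof (cases "b = 0")
    case True
    have "c = 0"
    proof (rule ccontr)
      assume "c \<noteq> 0"
      then have "0 < (cmod c)\<^sup>2" by simp
      \<comment> \<open>With \<open>b = 0\<close> the inequality is linear in \<open>t\<close>, and
        this \<open>t\<close> turns its right side into \<open>a - (a + 1)\<close>.\<close>
      then show False
        using key[of "(a + 1) / (2 * (cmod c)\<^sup>2)"] True by simp
    qed
    then show ?thesis using True by simp
  next
    case False
    then have "0 < b" using ab by simp
    \<comment> \<open>\<open>t = 1 / b\<close> is the minimum of the quadratic.\<close>
    then show ?thesis
      using key[of "1 / b"] by (simp add: field_simps power2_eq_square)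
  qed
  then have "cmod c \<le> sqrt (a * b)"
    by (rule real_le_rsqrt)
  then show ?thesis
    by (simp add: hnorm_def a_def b_def c_def real_sqrt_mult)
qed

lemma hnorm_triangle:
  assumes x: "x \<in> W" and y: "y \<in> W"
  shows "hnorm s (x + y) \<le> hnorm s x + hnorm s y"
proof (rule power2_le_imp_le)
  have "(hnorm s (x + y))\<^sup>2 = Re (s (x + y) (x + y))"
    using s_self[OF add_in[OF x y]] by simp
  also have "\<dots> = (hnorm s x)\<^sup>2 + (hnorm s y)\<^sup>2 + 2 * Re (s x y)"
    using x y s_self[OF x] s_self[OF y] s_cnj[OF x y]
    by (simp add: s_add_left s_add_right add_in)
  also have "\<dots> \<le> (hnorm s x)\<^sup>2 + (hnorm s y)\<^sup>2 + 2 * (hnorm s x * hnorm s y)"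
    using cauchy_schwarz[OF x y] complex_Re_le_cmod[of "s x y"] by simp
  finally show "(hnorm s (x + y))\<^sup>2 \<le> (hnorm s x + hnorm s y)\<^sup>2"
    by (simp add: power2_sum algebra_simps)
qed (simp add: hnorm_nonneg x y)

lemma hnorm_sm: "x \<in> W \<Longrightarrow> hnorm s (sm c x) = cmod c * hnorm s x"
proof -
  assume x: "x \<in> W"
  have "s (sm c x) (sm c x) = of_real ((cmod c)\<^sup>2) * s x x"
    using x complex_norm_square[of c] by (simp add: s_sm_left s_sm_right sm_in)
  then show ?thesis
    by (simp add: hnorm_def real_sqrt_mult)
qed

lemma hnorm_uminus: "x \<in> W \<Longrightarrow> hnorm s (- x) = hnorm s x"
  using hnorm_sm[of x "-1"] sm_minus_one by simp

lemma hnorm_minus_commute: "x \<in> W \<Longrightarrow> y \<in> W \<Longrightarrow> hnorm s (x - y) = hnorm s (y - x)"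
  using hnorm_uminus[of "x - y"] diff_in[of x y] by simp

lemma hnorm_triangle_diff:
  "x \<in> W \<Longrightarrow> y \<in> W \<Longrightarrow> z \<in> W \<Longrightarrow> hnorm s (x - z) \<le> hnorm s (x - y) + hnorm s (y - z)"
  using hnorm_triangle[of "x - y" "y - z"] by (simp add: diff_in)

lemma hnorm_diff_abs: "x \<in> W \<Longrightarrow> y \<in> W \<Longrightarrow> \<bar>hnorm s x - hnorm s y\<bar> \<le> hnorm s (x - y)"
  using hnorm_triangle[of "x - y" y] hnorm_triangle[of "y - x" x]
    hnorm_minus_commute[of x y] diff_in[of x y] diff_in[of y x] by simp

text \<open>The difference is expanded around (x, y) into three terms, each bounded by
  Cauchy-Schwarz. The filter is arbitrary because \<open>vector_form_ext\<close> uses a product of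
  neighbourhood filters.\<close>

lemma s_tendsto:
  assumes "eventually (\<lambda>n. v n \<in> W) F" "eventually (\<lambda>n. w n \<in> W) F" "x \<in> W" "y \<in> W"
    and "((\<lambda>n. hnorm s (v n - x)) \<longlongrightarrow> 0) F" "((\<lambda>n. hnorm s (w n - y)) \<longlongrightarrow> 0) F"
  shows "((\<lambda>n. s (v n) (w n)) \<longlongrightarrow> s x y) F"
proof -
  have "((\<lambda>n. hnorm s (v n - x) * hnorm s (w n - y) + hnorm s (v n - x) * hnorm s y
      + hnorm s x * hnorm s (w n - y)) \<longlongrightarrow> 0 * 0 + 0 * hnorm s y + hnorm s x * 0) F"
    by (intro tendsto_intros assms)
  then have *: "((\<lambda>n. hnorm s (v n - x) * hnorm s (w n - y) + hnorm s (v n - x) * hnorm s y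
      + hnorm s x * hnorm s (w n - y)) \<longlongrightarrow> 0) F"
    by simp
  have "((\<lambda>n. s (v n) (w n) - s x y) \<longlongrightarrow> 0) F"
  proof (rule tendsto_norm_le_0[OF _ *])
    show "\<forall>\<^sub>F n in F. cmod (s (v n) (w n) - s x y)
        \<le> hnorm s (v n - x) * hnorm s (w n - y) + hnorm s (v n - x) * hnorm s y
          + hnorm s x * hnorm s (w n - y)"
      using assms(1,2)
    proof eventually_elim
      case (elim n)
      have "s (v n) (w n) - s x y = s (v n - x) (w n - y) + s (v n - x) y + s x (w n - y)"
        using elim assms(3,4) by (simp add: s_diff_left s_diff_right diff_in algebra_simps)
      then have "cmod (s (v n) (w n) - s x y)
          \<le> cmod (s (v n - x) (w n - y)) + cmod (s (v n - x) y) + cmod (s x (w n - y))"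
        by (metis add_right_mono norm_triangle_ineq order_trans)
      then show ?case
        using cauchy_schwarz[of "v n - x" "w n - y"] cauchy_schwarz[of "v n - x" y]
          cauchy_schwarz[of x "w n - y"] elim assms(3,4)
        by (simp add: diff_in)
    qed
  qed
  then show ?thesis
    by (simp add: LIM_zero_iff)
qed

section \<open>Cauchy sequences in a semi-inner product space\<close>

definition cauchy_seq :: "(nat \<Rightarrow> 'w) \<Rightarrow> bool" where
  "cauchy_seq v \<longleftrightarrow> (\<forall>n. v n \<in> W) \<and> (\<forall>e>0. \<exists>N. \<forall>m\<ge>N. \<forall>n\<ge>N. hnorm s (v m - v n) < e)"

lemma cauchy_seq_in: "cauchy_seq v \<Longrightarrow> v n \<in> W"
  by (simp add: cauchy_seq_def)

lemma cauchy_seq_const: "x \<in> W \<Longrightarrow> cauchy_seq (\<lambda>n. x)"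
  by (simp add: cauchy_seq_def hnorm_zero)

lemma cauchy_seq_add:
  assumes v: "cauchy_seq v" and w: "cauchy_seq w"
  shows "cauchy_seq (\<lambda>n. v n + w n)"
  unfolding cauchy_seq_def
proof (intro conjI allI impI)
  fix e :: real
  assume "0 < e"
  then have "0 < e / 2" by simp
  then obtain M N where M: "\<And>m n. m \<ge> M \<Longrightarrow> n \<ge> M \<Longrightarrow> hnorm s (v m - v n) < e / 2"
    and N: "\<And>m n. m \<ge> N \<Longrightarrow> n \<ge> N \<Longrightarrow> hnorm s (w m - w n) < e / 2"
    using v w unfolding cauchy_seq_def by meson
  have "hnorm s (v m + w m - (v n + w n)) < e" if "m \<ge> max M N" "n \<ge> max M N" for m n
    using hnorm_triangle[of "v m - v n" "w m - w n"] M[of m n] N[of m n] that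
      cauchy_seq_in[OF v] cauchy_seq_in[OF w]
    by (simp add: diff_in algebra_simps)
  then show "\<exists>N. \<forall>m\<ge>N. \<forall>n\<ge>N. hnorm s (v m + w m - (v n + w n)) < e"
    by blast
qed (simp add: cauchy_seq_in[OF v] cauchy_seq_in[OF w] add_in)

lemma cauchy_seq_sm:
  assumes v: "cauchy_seq v"
  shows "cauchy_seq (\<lambda>n. sm c (v n))"
  unfolding cauchy_seq_def
proof (intro conjI allI impI)
  fix e :: real
  assume "0 < e"
  \<comment> \<open>The summand 1 keeps the divisor positive when \<open>c = 0\<close>.\<close>
  then have "0 < e / (cmod c + 1)" by (simp add: add_nonneg_pos)
  then obtain N where N: "\<And>m n. m \<ge> N \<Longrightarrow> n \<ge> N \<Longrightarrow> hnorm s (v m - v n) < e / (cmod c + 1)"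
    using v unfolding cauchy_seq_def by meson
  have "hnorm s (sm c (v m) - sm c (v n)) < e" if mn: "m \<ge> N" "n \<ge> N" for m n
  proof -
    have in': "v m - v n \<in> W" using cauchy_seq_in[OF v] by (simp add: diff_in)
    have "hnorm s (sm c (v m) - sm c (v n)) = cmod c * hnorm s (v m - v n)"
      using hnorm_sm[OF in', of c] cauchy_seq_in[OF v] by (simp add: sm_diff)
    also have "\<dots> \<le> (cmod c + 1) * hnorm s (v m - v n)"
      using hnorm_nonneg[OF in'] by (simp add: distrib_right)
    also have "\<dots> < e"
      using N[OF mn] by (simp add: pos_less_divide_eq add_nonneg_pos mult.commute)
    finally show ?thesis .
  qed
  then show "\<exists>N. \<forall>m\<ge>N. \<forall>n\<ge>N. hnorm s (sm c (v m) - sm c (v n)) < e"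
    by blast
qed (simp add: cauchy_seq_in[OF v] sm_in)

lemma cauchy_seq_hnorm:
  assumes v: "cauchy_seq v"
  shows "convergent (\<lambda>n. hnorm s (v n))"
  unfolding Cauchy_convergent_iff[symmetric]
proof (rule CauchyI)
  fix e :: real
  assume "0 < e"
  then obtain N where "\<forall>m\<ge>N. \<forall>n\<ge>N. hnorm s (v m - v n) < e"
    using v unfolding cauchy_seq_def by blast
  then show "\<exists>M. \<forall>m\<ge>M. \<forall>n\<ge>M. norm (hnorm s (v m) - hnorm s (v n)) < e"
    using hnorm_diff_abs cauchy_seq_in[OF v] by (metis order_le_less_trans real_norm_def)
qed

text \<open>The norms of a Cauchy sequence converge, so the Cauchy-Schwarz bound is a null sequence
  times a convergent one.\<close>

lemma null_seq_inner:
  assumes "cauchy_seq v" "cauchy_seq w" "(\<lambda>n. hnorm s (v n)) \<longlonglongrightarrow> 0"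
  shows "(\<lambda>n. s (v n) (w n)) \<longlonglongrightarrow> 0"
proof (rule tendsto_norm_le_0)
  show "\<forall>\<^sub>F n in sequentially. norm (s (v n) (w n)) \<le> hnorm s (v n) * hnorm s (w n)"
    using cauchy_schwarz cauchy_seq_in assms by simp
  obtain l where "(\<lambda>n. hnorm s (w n)) \<longlonglongrightarrow> l"
    using cauchy_seq_hnorm[OF assms(2)] by (auto simp: convergent_def)
  from tendsto_mult[OF assms(3) this] show "(\<lambda>n. hnorm s (v n) * hnorm s (w n)) \<longlonglongrightarrow> 0"
    by simp
qed

end

lemma hilbert_space_imp_semi_inner:
  assumes "hilbert_space H sch ip"
  shows "semi_inner_space H sch ip"
proof -
  have H: "0 \<in> H" "\<forall>x\<in>H. \<forall>y\<in>H. x + y \<in> H" "\<forall>c. \<forall>x\<in>H. sch c x \<in> H"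
    "\<forall>c. \<forall>x\<in>H. \<forall>y\<in>H. sch c (x + y) = sch c x + sch c y"
    "\<forall>x\<in>H. \<forall>y\<in>H. \<forall>z\<in>H. ip (x + y) z = ip x z + ip y z"
    "\<forall>c. \<forall>x\<in>H. \<forall>y\<in>H. ip (sch c x) y = c * ip x y"
    "\<forall>x\<in>H. \<forall>y\<in>H. ip y x = cnj (ip x y)"
    "\<forall>x\<in>H. Re (ip x x) \<ge> 0 \<and> (ip x x = 0 \<longrightarrow> x = 0)"
    using assms unfolding hilbert_space_def by - (elim conjE, assumption)+
  have neg: "sch (-1) x = - x" if x: "x \<in> H" for x
  proof -
    have add: "sch (c + d) x = sch c x + sch d x" for c d
      using assms x unfolding hilbert_space_def by blast
    have one: "sch 1 x = x"
      using assms x unfolding hilbert_space_def by blast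
    have "sch 0 x = 0"
      using add[of 0 0] by simp
    then show ?thesis
      using add[of 1 "-1"] one by (simp add: add_eq_0_iff)
  qed
  show ?thesis
  proof
    show "ip y x = cnj (ip x y)" if "x \<in> H" "y \<in> H" for x y
      using H(7) that by blast
  qed (use H(1-6,8) neg in simp_all)
qed

text \<open>
  The completion of a semi-inner product space is realised on functions: a vector v is replaced
  by its pairings with the vectors K k, whose finite sums form a dense subspace V, and the
  completion consists of the pointwise limits of Cauchy sequences.
\<close>

locale kernel_space = semi_inner_space W sm s
  for W :: "'w::ab_group_add set" and sm s +
  fixes V :: "'w set" and K :: "'k \<Rightarrow> 'w"
  assumes V_sub: "V \<subseteq> W"
    and V_zero: "0 \<in> V"
    and V_add: "x \<in> V \<Longrightarrow> y \<in> V \<Longrightarrow> x + y \<in> V"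
    and V_sm: "x \<in> V \<Longrightarrow> sm c x \<in> V"
    and V_dense: "x \<in> W \<Longrightarrow> 0 < e \<Longrightarrow> \<exists>y\<in>V. hnorm s (x - y) < e"
    and K_in: "K k \<in> W"
    and K_span: "x \<in> V \<Longrightarrow> \<exists>I. finite I \<and> (\<forall>w\<in>W. s w x = (\<Sum>k\<in>I. s w (K k)))"
begin

text \<open>A vector of norm zero pairs to zero with every \<open>K k\<close>, so this map also
  performs the passage to the quotient.\<close>

definition embed :: "'w \<Rightarrow> 'k \<Rightarrow> complex" where
  "embed w = (\<lambda>k. s w (K k))"

definition represents :: "(nat \<Rightarrow> 'w) \<Rightarrow> ('k \<Rightarrow> complex) \<Rightarrow> bool" where
  "represents v f \<longleftrightarrow> cauchy_seq v \<and> (\<forall>k. (\<lambda>n. s (v n) (K k)) \<longlonglongrightarrow> f k)"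

definition completion :: "('k \<Rightarrow> complex) set" where
  "completion = {f. \<exists>v. represents v f}"

definition comp_scale :: "complex \<Rightarrow> ('k \<Rightarrow> complex) \<Rightarrow> 'k \<Rightarrow> complex" where
  "comp_scale c f = (\<lambda>k. c * f k)"

text \<open>The representing sequences are picked by choice; \<open>represents_ip\<close> shows that
  every other pair gives the same limit.\<close>

definition comp_ip :: "('k \<Rightarrow> complex) \<Rightarrow> ('k \<Rightarrow> complex) \<Rightarrow> complex" where
  "comp_ip f g = lim (\<lambda>n. s ((SOME v. represents v f) n) ((SOME w. represents w g) n))"

lemma comp_scale_minus_one: "comp_scale (-1) f = - f"
  by (simp add: comp_scale_def fun_eq_iff)

lemma represents_cauchy: "represents v f \<Longrightarrow> cauchy_seq v"
  by (simp add: represents_def)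

lemma represents_in: "represents v f \<Longrightarrow> v n \<in> W"
  by (simp add: represents_def cauchy_seq_in)

lemma represents_add: "represents v f \<Longrightarrow> represents w g \<Longrightarrow> represents (\<lambda>n. v n + w n) (f + g)"
  unfolding represents_def
  by (auto simp: cauchy_seq_add s_add_left[OF cauchy_seq_in cauchy_seq_in K_in] intro!: tendsto_add)

lemma represents_scale: "represents v f \<Longrightarrow> represents (\<lambda>n. sm c (v n)) (comp_scale c f)"
  unfolding represents_def comp_scale_def
  by (auto simp: cauchy_seq_sm s_sm_left[OF cauchy_seq_in K_in] intro!: tendsto_mult)

lemma represents_diff: "represents v f \<Longrightarrow> represents w g \<Longrightarrow> represents (\<lambda>n. v n - w n) (f - g)"
  using represents_add[of v f "\<lambda>n. sm (-1) (w n)" "comp_scale (-1) g"] represents_scale[of w g "-1"]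
  by (simp add: sm_minus_one represents_in comp_scale_minus_one)

lemma represents_const: "w \<in> W \<Longrightarrow> represents (\<lambda>n. w) (embed w)"
  by (simp add: represents_def embed_def cauchy_seq_const)

text \<open>This makes the realisation by functions faithful: Cauchy sequences with the same
  pointwise limit differ by a norm-null sequence. A Cauchy sequence is bounded and eventually almost
  constant, so its self-pairing is controlled by the pairing with one fixed \<open>v\<close> in
  \<open>V\<close> near some \<open>u N\<close>, and that pairing is a finite sum of pairings with
  vectors \<open>K k\<close>.\<close>

lemma null_seq_if_weakly_null:
  assumes u: "cauchy_seq u" and weak: "\<And>k. (\<lambda>n. s (u n) (K k)) \<longlonglongrightarrow> 0"
  shows "(\<lambda>n. hnorm s (u n)) \<longlonglongrightarrow> 0"
proof -
  have uW: "u n \<in> W" for n by (rule cauchy_seq_in[OF u])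
  have weakV: "(\<lambda>n. s (u n) v) \<longlonglongrightarrow> 0" if v: "v \<in> V" for v
  proof -
    obtain I where I: "finite I" "\<forall>w\<in>W. s w v = (\<Sum>k\<in>I. s w (K k))"
      using K_span[OF v] by blast
    have "(\<lambda>n. \<Sum>k\<in>I. s (u n) (K k)) \<longlonglongrightarrow> (\<Sum>k\<in>I. 0)"
      by (intro tendsto_sum weak)
    then show ?thesis using I uW by simp
  qed
  obtain B where B: "\<And>n. hnorm s (u n) \<le> B" "0 < B"
    using convergent_imp_Bseq[OF cauchy_seq_hnorm[OF u]] uW hnorm_nonneg
    by (metis BseqE abs_of_nonneg real_norm_def)
  have "(\<lambda>n. (hnorm s (u n))\<^sup>2) \<longlonglongrightarrow> 0"
  proof (rule LIMSEQ_I)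
    fix r :: real
    assume "0 < r"
    \<comment> \<open>The self-pairing is split into three summands, each bounded by
      \<open>B * e\<close>; hence the factor 3.\<close>
    define e where "e = r / (3 * B)"
    have e: "0 < e" "r = 3 * (B * e)" using \<open>0 < r\<close> B(2) by (auto simp: e_def)
    obtain N where N: "\<And>m n. m \<ge> N \<Longrightarrow> n \<ge> N \<Longrightarrow> hnorm s (u m - u n) < e"
      using u e unfolding cauchy_seq_def by meson
    obtain v where v: "v \<in> V" "hnorm s (u N - v) < e"
      using V_dense[OF uW e(1)] by blast
    have vW: "v \<in> W" using v V_sub by blast
    obtain M where M: "\<And>n. n \<ge> M \<Longrightarrow> cmod (s (u n) v) < B * e"
      using LIMSEQ_D[OF weakV[OF v(1)], of "B * e"] e B by auto
    have "norm ((hnorm s (u n))\<^sup>2 - 0) < r" if n: "n \<ge> max M N" for n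
    proof -
      have "s (u n) (u n) = s (u n) (u n - u N) + s (u n) (u N - v) + s (u n) v"
        using uW vW by (simp add: s_diff_right)
      then have "cmod (s (u n) (u n))
          \<le> cmod (s (u n) (u n - u N)) + cmod (s (u n) (u N - v)) + cmod (s (u n) v)"
        by (metis add_right_mono norm_triangle_ineq order_trans)
      moreover have "cmod (s (u n) (u n - u N)) \<le> B * e"
        using cauchy_schwarz[OF uW diff_in[OF uW uW], of n n N] N[of n N] n B(1)[of n]
        by (meson order_trans mult_mono less_imp_le B(2) hnorm_nonneg diff_in uW max.boundedE order_refl)
      moreover have "cmod (s (u n) (u N - v)) \<le> B * e"
        using cauchy_schwarz[OF uW diff_in[OF uW vW], of n N] v B(1)[of n]
        by (meson order_trans mult_mono less_imp_le B(2) hnorm_nonneg diff_in uW vW)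
      moreover have "cmod (s (u n) v) < B * e"
        using M n by simp
      ultimately have "cmod (s (u n) (u n)) < r"
        using e(2) by linarith
      then show ?thesis using s_self[OF uW, of n] by (simp add: norm_power)
    qed
    then show "\<exists>no. \<forall>n\<ge>no. norm ((hnorm s (u n))\<^sup>2 - 0) < r" by blast
  qed
  from tendsto_real_sqrt[OF this] show ?thesis
    using hnorm_nonneg uW by simp
qed

lemma represents_null:
  assumes "represents v f" "represents w f"
  shows "(\<lambda>n. hnorm s (v n - w n)) \<longlonglongrightarrow> 0"
proof (rule null_seq_if_weakly_null)
  have "represents (\<lambda>n. v n - w n) 0"
    using represents_diff[OF assms] by simp
  then show "cauchy_seq (\<lambda>n. v n - w n)" "(\<lambda>n. s (v n - w n) (K k)) \<longlonglongrightarrow> 0" for k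
    by (simp_all add: represents_def)
qed

text \<open>Polarisation: the inner product is a linear combination of four squared norms of Cauchy
  sequences, and those norms converge.\<close>

lemma represents_inner_convergent:
  assumes v: "cauchy_seq v" and w: "cauchy_seq w"
  shows "convergent (\<lambda>n. s (v n) (w n))"
proof -
  have vW: "v n \<in> W" and wW: "w n \<in> W" for n
    using cauchy_seq_in v w by auto
  define nq where "nq c = (\<lambda>n. complex_of_real ((hnorm s (v n + sm c (w n)))\<^sup>2))" for c
  have conv: "convergent (nq c)" for c
  proof -
    obtain l where "(\<lambda>n. hnorm s (v n + sm c (w n))) \<longlonglongrightarrow> l"
      using cauchy_seq_hnorm[OF cauchy_seq_add[OF v cauchy_seq_sm[OF w]]] by (auto simp: convergent_def)
    then have "nq c \<longlonglongrightarrow> complex_of_real (l\<^sup>2)"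
      unfolding nq_def by (intro tendsto_intros)
    then show ?thesis by (auto simp: convergent_def)
  qed
  have nq: "nq c n = s (v n) (v n) + cnj c * s (v n) (w n) + c * s (w n) (v n) + c * cnj c * s (w n) (w n)"
    for c n
    unfolding nq_def using s_self[of "v n + sm c (w n)"] vW[of n] wW[of n]
    by (simp add: s_add_left s_add_right add_in sm_in s_sm_left s_sm_right algebra_simps)
  have "s (v n) (w n) = (nq 1 n - nq (-1) n + \<i> * nq \<i> n - \<i> * nq (-\<i>) n) * (1/4)" for n
    unfolding nq by (simp add: algebra_simps)
  then have "(\<lambda>n. s (v n) (w n)) = (\<lambda>n. (nq 1 n - nq (-1) n + \<i> * nq \<i> n - \<i> * nq (-\<i>) n) * (1/4))"
    by (rule ext)
  then show ?thesis
    using conv by (simp only: convergent_add convergent_diff convergent_mult convergent_const)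
qed

text \<open>The representatives are exchanged one slot at a time; each exchange costs the pairing of
  a null sequence with a Cauchy sequence.\<close>

lemma represents_ip:
  assumes v: "represents v f" and w: "represents w g"
  shows "(\<lambda>n. s (v n) (w n)) \<longlonglongrightarrow> comp_ip f g"
proof -
  define v0 w0 where "v0 = (SOME v. represents v f)" and "w0 = (SOME w. represents w g)"
  have v0: "represents v0 f" and w0: "represents w0 g"
    using v w unfolding v0_def w0_def by (metis someI)+
  note c = represents_cauchy[OF v] represents_cauchy[OF w] represents_cauchy[OF v0] represents_cauchy[OF w0]
  have L: "(\<lambda>n. s (v0 n) (w0 n)) \<longlonglongrightarrow> comp_ip f g"
    using represents_inner_convergent[OF c(3,4)]
    by (simp add: comp_ip_def v0_def w0_def convergent_LIMSEQ_iff)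
  have "(\<lambda>n. s (v n - v0 n) (w n)) \<longlonglongrightarrow> 0"
    using represents_cauchy[OF represents_diff[OF v v0]] c(2) represents_null[OF v v0]
    by (rule null_seq_inner)
  moreover have "(\<lambda>n. s (w n - w0 n) (v0 n)) \<longlonglongrightarrow> 0"
    using represents_cauchy[OF represents_diff[OF w w0]] c(3) represents_null[OF w w0]
    by (rule null_seq_inner)
  then have "(\<lambda>n. cnj (s (w n - w0 n) (v0 n))) \<longlonglongrightarrow> cnj 0"
    by (rule tendsto_cnj)
  then have "(\<lambda>n. s (v0 n) (w n - w0 n)) \<longlonglongrightarrow> 0"
    using s_cnj[of "w n - w0 n" "v0 n" for n] by (simp add: cauchy_seq_in c diff_in)
  ultimately have "(\<lambda>n. s (v n - v0 n) (w n) + s (v0 n) (w n - w0 n) + s (v0 n) (w0 n))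
      \<longlonglongrightarrow> 0 + 0 + comp_ip f g"
    using L by (intro tendsto_add)
  then show ?thesis
    by (simp add: s_diff_left s_diff_right cauchy_seq_in c)
qed

lemma embed_in: "w \<in> W \<Longrightarrow> embed w \<in> completion"
  using represents_const unfolding completion_def by blast

lemma embed_ip: "v \<in> W \<Longrightarrow> w \<in> W \<Longrightarrow> comp_ip (embed v) (embed w) = s v w"
  using represents_ip[OF represents_const represents_const] by (simp add: LIMSEQ_const_iff)

lemma embed_add: "v \<in> W \<Longrightarrow> w \<in> W \<Longrightarrow> embed (v + w) = embed v + embed w"
  by (simp add: embed_def fun_eq_iff s_add_left K_in)

lemma embed_sm: "w \<in> W \<Longrightarrow> embed (sm c w) = comp_scale c (embed w)"
  by (simp add: embed_def comp_scale_def fun_eq_iff s_sm_left K_in)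

lemma embed_diff: "v \<in> W \<Longrightarrow> w \<in> W \<Longrightarrow> embed (v - w) = embed v - embed w"
  by (simp add: embed_def fun_eq_iff s_diff_left K_in)

lemma embed_zero: "embed 0 = 0"
  by (simp add: embed_def fun_eq_iff s_zero_left K_in)

lemma comp_semi_inner: "semi_inner_space completion comp_scale comp_ip"
proof
  show "0 \<in> completion" using embed_in[OF zero_in] by (simp add: embed_zero)
  fix f g h :: "'k \<Rightarrow> complex" and c
  assume f: "f \<in> completion"
  obtain u where u: "represents u f" using f by (auto simp: completion_def)
  show "comp_scale c f \<in> completion" using represents_scale[OF u] by (auto simp: completion_def)
  show "comp_scale (-1) f = - f" by (rule comp_scale_minus_one)
  have "(\<lambda>n. Re (s (u n) (u n))) \<longlonglongrightarrow> Re (comp_ip f f)"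
    by (intro tendsto_intros represents_ip u)
  then show "0 \<le> Re (comp_ip f f)"
    by (rule LIMSEQ_le_const) (auto simp: s_nonneg represents_in[OF u])
  assume g: "g \<in> completion"
  obtain v where v: "represents v g" using g by (auto simp: completion_def)
  show "f + g \<in> completion" using represents_add[OF u v] by (auto simp: completion_def)
  show "comp_scale c (f + g) = comp_scale c f + comp_scale c g"
    by (simp add: comp_scale_def fun_eq_iff algebra_simps)
  show "comp_ip (comp_scale c f) g = c * comp_ip f g"
    using represents_ip[OF represents_scale[OF u] v, of c] tendsto_mult[OF tendsto_const represents_ip[OF u v], of c]
    by (simp add: s_sm_left represents_in[OF u] represents_in[OF v] LIMSEQ_unique)
  show "comp_ip g f = cnj (comp_ip f g)"
    using represents_ip[OF v u] tendsto_cnj[OF represents_ip[OF u v]]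
      s_cnj[OF represents_in[OF u] represents_in[OF v]]
    by (metis (no_types, lifting) LIMSEQ_unique ext)
  assume h: "h \<in> completion"
  obtain w where w: "represents w h" using h by (auto simp: completion_def)
  show "comp_ip (f + g) h = comp_ip f h + comp_ip g h"
    using represents_ip[OF represents_add[OF u v] w] tendsto_add[OF represents_ip[OF u w] represents_ip[OF v w]]
    by (simp add: s_add_left represents_in[OF u] represents_in[OF v] represents_in[OF w] LIMSEQ_unique)
qed

text \<open>For fixed \<open>n\<close> the function \<open>f - embed (v n)\<close> is represented by
  \<open>v m - v n\<close> as m grows, and the norms of these vectors are small by the Cauchy
  property.\<close>

lemma represents_hnorm_diff:
  assumes v: "represents v f"
  shows "(\<lambda>n. hnorm comp_ip (f - embed (v n))) \<longlonglongrightarrow> 0"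
proof (rule LIMSEQ_I)
  fix r :: real
  assume "0 < r"
  then obtain N where N: "\<And>m n. m \<ge> N \<Longrightarrow> n \<ge> N \<Longrightarrow> hnorm s (v m - v n) < r / 2"
    using represents_cauchy[OF v] unfolding cauchy_seq_def by (meson half_gt_zero)
  have "norm (hnorm comp_ip (f - embed (v n)) - 0) < r" if n: "n \<ge> N" for n
  proof -
    have rep: "represents (\<lambda>m. v m - v n) (f - embed (v n))"
      by (intro represents_diff v represents_const represents_in[OF v])
    have "(\<lambda>m. Re (s (v m - v n) (v m - v n))) \<longlonglongrightarrow> Re (comp_ip (f - embed (v n)) (f - embed (v n)))"
      by (intro tendsto_intros represents_ip rep)
    then have "(\<lambda>m. hnorm s (v m - v n)) \<longlonglongrightarrow> hnorm comp_ip (f - embed (v n))"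
      unfolding hnorm_def by (rule tendsto_real_sqrt)
    then have "hnorm comp_ip (f - embed (v n)) \<le> r / 2"
      by (rule LIMSEQ_le_const2) (use N n in \<open>meson less_imp_le\<close>)
    moreover have "0 \<le> hnorm comp_ip (f - embed (v n))"
      using semi_inner_space.hnorm_nonneg[OF comp_semi_inner] rep by (auto simp: completion_def)
    ultimately show ?thesis using \<open>0 < r\<close> by simp
  qed
  then show "\<exists>no. \<forall>n\<ge>no. norm (hnorm comp_ip (f - embed (v n)) - 0) < r" by blast
qed

lemma embed_dense:
  assumes f: "f \<in> completion" and e: "0 < e"
  shows "\<exists>w\<in>V. hnorm comp_ip (f - embed w) < e"
proof -
  interpret C: semi_inner_space completion comp_scale comp_ip by (rule comp_semi_inner)
  obtain v where v: "represents v f" using f by (auto simp: completion_def)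
  obtain n where n: "hnorm comp_ip (f - embed (v n)) < e / 2"
    using LIMSEQ_D[OF represents_hnorm_diff[OF v], of "e / 2"] e
    by (metis abs_ge_self diff_zero half_gt_zero order_refl order_le_less_trans real_norm_def)
  have vn: "v n \<in> W" by (rule represents_in[OF v])
  obtain w where w: "w \<in> V" "hnorm s (v n - w) < e / 2"
    using V_dense[OF vn, of "e / 2"] e by auto
  have wW: "w \<in> W" using w V_sub by blast
  have "hnorm comp_ip (embed (v n) - embed w) = hnorm s (v n - w)"
    using vn wW by (simp add: embed_diff[symmetric] hnorm_def embed_ip diff_in)
  then have "hnorm comp_ip (f - embed w) < e"
    using C.hnorm_triangle_diff[OF f embed_in[OF vn] embed_in[OF wW]] n w by simp
  then show ?thesis using w by blast
qed

text \<open>Each \<open>f n\<close> is replaced by an embedded vector within distance 1/(n+1). These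
  vectors are again Cauchy and themselves represent the limit, so no diagonal sequence has to be
  extracted from representatives.\<close>

lemma comp_complete:
  fixes f :: "nat \<Rightarrow> 'k \<Rightarrow> complex"
  assumes fin: "\<And>n. f n \<in> completion"
    and cau: "\<And>e. 0 < e \<Longrightarrow> \<exists>N. \<forall>m\<ge>N. \<forall>n\<ge>N. hnorm comp_ip (f m - f n) < e"
  shows "\<exists>g\<in>completion. \<forall>e>0. \<exists>N. \<forall>n\<ge>N. hnorm comp_ip (f n - g) < e"
proof -
  interpret C: semi_inner_space completion comp_scale comp_ip by (rule comp_semi_inner)
  have "\<exists>w\<in>V. hnorm comp_ip (f n - embed w) < inverse (real (Suc n))" for n
    by (intro embed_dense fin) simp
  then obtain w where wV: "\<And>n. w n \<in> V"
    and w: "\<And>n. hnorm comp_ip (f n - embed (w n)) < inverse (real (Suc n))"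
    by metis
  have wW: "w n \<in> W" for n using wV V_sub by blast
  note ein = embed_in[OF wW]
  have small: "\<exists>N. \<forall>n\<ge>N. hnorm comp_ip (f n - embed (w n)) < e" if e: "0 < e" for e :: real
  proof -
    obtain N where N: "inverse (real (Suc N)) < e" using reals_Archimedean[OF e] by blast
    have "hnorm comp_ip (f n - embed (w n)) < e" if "n \<ge> N" for n
    proof -
      have "inverse (real (Suc n)) \<le> inverse (real (Suc N))"
        using that by (intro le_imp_inverse_le) auto
      then show ?thesis using w[of n] N by linarith
    qed
    then show ?thesis by blast
  qed
  have "cauchy_seq w"
    unfolding cauchy_seq_def
  proof (intro conjI allI impI wW)
    fix e :: real
    assume "0 < e"
    then have e3: "0 < e / 3" by simp
    obtain M where M: "\<And>n. n \<ge> M \<Longrightarrow> hnorm comp_ip (f n - embed (w n)) < e / 3"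
      using small[OF e3] by blast
    obtain N where N: "\<And>m n. m \<ge> N \<Longrightarrow> n \<ge> N \<Longrightarrow> hnorm comp_ip (f m - f n) < e / 3"
      using cau[OF e3] by blast
    have "hnorm s (w m - w n) < e" if mn: "m \<ge> max M N" "n \<ge> max M N" for m n
    proof -
      have "hnorm s (w m - w n) = hnorm comp_ip (embed (w m) - embed (w n))"
        using wW by (simp add: embed_diff[symmetric] hnorm_def embed_ip diff_in)
      also have "\<dots> \<le> hnorm comp_ip (embed (w m) - f m) + (hnorm comp_ip (f m - f n)
          + hnorm comp_ip (f n - embed (w n)))"
        using C.hnorm_triangle_diff[OF ein[of m] fin[of m] ein[of n]]
          C.hnorm_triangle_diff[OF fin[of m] fin[of n] ein[of n]] by simp
      also have "\<dots> < e"
        using M[of m] M[of n] N[of m n] mn C.hnorm_minus_commute[OF ein[of m] fin[of m]] by simp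
      finally show ?thesis .
    qed
    then show "\<exists>N. \<forall>m\<ge>N. \<forall>n\<ge>N. hnorm s (w m - w n) < e" by blast
  qed
  moreover have "\<exists>l. (\<lambda>n. s (w n) (K k)) \<longlonglongrightarrow> l" for k
    using represents_inner_convergent[OF \<open>cauchy_seq w\<close> cauchy_seq_const[OF K_in]]
    by (simp add: convergent_def)
  ultimately obtain g where g: "represents w g"
    unfolding represents_def by metis
  have gin: "g \<in> completion" using g by (auto simp: completion_def)
  have "\<exists>N. \<forall>n\<ge>N. hnorm comp_ip (f n - g) < e" if e: "0 < e" for e
  proof -
    have e2: "0 < e / 2" using e by simp
    obtain M where M: "\<And>n. n \<ge> M \<Longrightarrow> hnorm comp_ip (f n - embed (w n)) < e / 2"
      using small[OF e2] by blast
    obtain N where N: "\<And>n. n \<ge> N \<Longrightarrow> hnorm comp_ip (g - embed (w n)) < e / 2"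
      using LIMSEQ_D[OF represents_hnorm_diff[OF g] e2] by (metis abs_less_iff diff_zero real_norm_def)
    have "hnorm comp_ip (f n - g) < e" if "n \<ge> max M N" for n
      using C.hnorm_triangle_diff[OF fin[of n] ein[of n] gin] M[of n] N[of n] that
        C.hnorm_minus_commute[OF gin ein[of n]] by simp
    then show ?thesis by blast
  qed
  then show ?thesis using gin by blast
qed

text \<open>A representing sequence is norm-null, hence pairs to zero with every \<open>K k\<close>,
  and these pairings converge to the values of the function.\<close>

lemma comp_definite:
  assumes f: "f \<in> completion" and "comp_ip f f = 0"
  shows "f = 0"
proof -
  obtain v where v: "represents v f" using f by (auto simp: completion_def)
  have "(\<lambda>n. Re (s (v n) (v n))) \<longlonglongrightarrow> Re (comp_ip f f)"
    by (intro tendsto_intros represents_ip v)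
  from tendsto_real_sqrt[OF this] have null: "(\<lambda>n. hnorm s (v n)) \<longlonglongrightarrow> 0"
    using assms(2) by (simp add: hnorm_def)
  have "f k = 0" for k
    using null_seq_inner[OF represents_cauchy[OF v] cauchy_seq_const[OF K_in] null, of k] v
    unfolding represents_def by (metis LIMSEQ_unique)
  then show ?thesis by (simp add: fun_eq_iff)
qed

lemma comp_hilbert: "hilbert_space completion comp_scale comp_ip"
proof -
  interpret C: semi_inner_space completion comp_scale comp_ip by (rule comp_semi_inner)
  show ?thesis
    unfolding hilbert_space_def
  proof (intro conjI)
    show "\<forall>f::nat \<Rightarrow> 'k \<Rightarrow> complex. (\<forall>n. f n \<in> completion)
        \<and> (\<forall>e>0. \<exists>N. \<forall>m\<ge>N. \<forall>n\<ge>N. hnorm comp_ip (f m - f n) < e) \<longrightarrow>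
        (\<exists>x\<in>completion. \<forall>e>0. \<exists>N. \<forall>n\<ge>N. hnorm comp_ip (f n - x) < e)"
      using comp_complete by blast
    show "\<forall>x\<in>completion. \<forall>y\<in>completion. comp_ip y x = cnj (comp_ip x y)"
      using C.s_cnj by blast
    show "\<forall>c. \<forall>x\<in>completion. \<forall>y\<in>completion. comp_scale c (x + y) = comp_scale c x + comp_scale c y"
      using C.sm_add by blast
    show "\<forall>c d. \<forall>x\<in>completion. comp_scale (c + d) x = comp_scale c x + comp_scale d x"
      by (simp add: comp_scale_def fun_eq_iff algebra_simps)
    show "\<forall>c d. \<forall>x\<in>completion. comp_scale c (comp_scale d x) = comp_scale (c * d) x"
      "\<forall>x\<in>completion. comp_scale 1 x = x"
      by (simp_all add: comp_scale_def fun_eq_iff)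
  qed (simp_all add: C.zero_in C.add_in C.minus_in C.sm_in C.s_add_left C.s_sm_left C.s_nonneg comp_definite)
qed

lemma embed_dense_subspace: "dense_subspace completion comp_scale comp_ip (embed ` V)"
proof -
  have "embed ` V \<subseteq> completion" using embed_in V_sub by blast
  moreover have "0 \<in> embed ` V" using imageI[OF V_zero, of embed] by (simp add: embed_zero)
  moreover have "embed x + embed y \<in> embed ` V" if "x \<in> V" "y \<in> V" for x y
    using that imageI[OF V_add, of x y embed] by (simp add: embed_add subsetD[OF V_sub])
  moreover have "comp_scale c (embed x) \<in> embed ` V" if "x \<in> V" for c x
    using that imageI[OF V_sm, of x embed c] by (simp add: embed_sm subsetD[OF V_sub])
  moreover have "\<forall>x\<in>completion. \<forall>e>0. \<exists>y\<in>embed ` V. hnorm comp_ip (x - y) < e"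
    using embed_dense by blast
  ultimately show ?thesis
    unfolding dense_subspace_def by blast
qed

end

section \<open>The completion and the extension of continuous forms\<close>

lemma eventually_tau_nhds:
  "eventually P (tau_nhds p a) \<longleftrightarrow>
     (\<exists>L e. finite L \<and> 0 < e \<and> (\<forall>b. (\<forall>l\<in>L. p l (b - a) < e) \<longrightarrow> P b))"
proof -
  let ?B = "{(L, e). finite L \<and> e > (0::real)}"
  let ?F = "\<lambda>Le. principal {b. \<forall>l\<in>fst Le. p l (b - a) < snd Le}"
  have "\<exists>z\<in>?B. ?F z \<le> inf (?F x) (?F y)" if "x \<in> ?B" "y \<in> ?B" for x y
    using that by (intro bexI[of _ "(fst x \<union> fst y, min (snd x) (snd y))"]) auto
  moreover have "?B \<noteq> {}" using zero_less_one by blast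
  ultimately have "eventually P (tau_nhds p a) \<longleftrightarrow> (\<exists>z\<in>?B. eventually P (?F z))"
    unfolding tau_nhds_def by (rule eventually_INF_base[rotated])
  then show ?thesis by (auto simp: eventually_principal)
qed

lemma filterlim_fst: "filterlim fst F (F \<times>\<^sub>F G)"
  by (simp add: filterlim_def filtermap_fst_prod_filter)

lemma filterlim_snd: "filterlim snd G (F \<times>\<^sub>F G)"
  by (simp add: filterlim_def filtermap_snd_prod_filter)

locale tau_space =
  fixes A0 :: "'a::ab_group_add set" and sc :: "complex \<Rightarrow> 'a \<Rightarrow> 'a" and p :: "'i \<Rightarrow> 'a \<Rightarrow> real"
  assumes tau_completion: "tau_completion A0 sc p"
    and A0_zero: "0 \<in> A0"
    and A0_add: "x \<in> A0 \<Longrightarrow> y \<in> A0 \<Longrightarrow> x + y \<in> A0"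
    and A0_sc: "x \<in> A0 \<Longrightarrow> sc c x \<in> A0"
begin

sublocale module sc
  using tau_completion by (simp add: tau_completion_def)

lemma A0_minus: "x \<in> A0 \<Longrightarrow> - x \<in> A0"
  using A0_sc[of x "-1"] by simp

lemma A0_diff: "x \<in> A0 \<Longrightarrow> y \<in> A0 \<Longrightarrow> x - y \<in> A0"
  using A0_add[of x "- y"] A0_minus by simp

lemma p_add: "p l (x + y) \<le> p l x + p l y"
  using tau_completion by (simp add: tau_completion_def seminorm_on_def)

lemma p_sc: "p l (sc c x) = cmod c * p l x"
  using tau_completion by (simp add: tau_completion_def seminorm_on_def)

lemma p_zero: "p l 0 = 0"
  using p_sc[of l 0 0] by simp

lemma p_minus: "p l (- x) = p l x"
  using p_sc[of l "-1" x] by simp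

lemma p_nonneg: "0 \<le> p l x"
  using p_add[of l x "- x"] by (simp add: p_zero p_minus)

lemma p_separating: "(\<And>l. p l x = 0) \<Longrightarrow> x = 0"
  using tau_completion by (simp add: tau_completion_def)

lemma tau_lim_iff:
  "filterlim f (tau_nhds p a) F \<longleftrightarrow> (\<forall>l. ((\<lambda>n. p l (f n - a)) \<longlongrightarrow> 0) F)"
proof
  assume f: "filterlim f (tau_nhds p a) F"
  show "\<forall>l. ((\<lambda>n. p l (f n - a)) \<longlongrightarrow> 0) F"
  proof (intro allI tendstoI)
    fix l and e :: real
    assume "0 < e"
    then have "eventually (\<lambda>b. p l (b - a) < e) (tau_nhds p a)"
      unfolding eventually_tau_nhds by (intro exI[of _ "{l}"] exI[of _ e]) auto
    from eventually_compose_filterlim[OF this f]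
    show "eventually (\<lambda>n. dist (p l (f n - a)) 0 < e) F"
      by (simp add: p_nonneg)
  qed
next
  assume f: "\<forall>l. ((\<lambda>n. p l (f n - a)) \<longlongrightarrow> 0) F"
  show "filterlim f (tau_nhds p a) F"
    unfolding filterlim_iff
  proof (intro allI impI)
    fix P
    assume "eventually P (tau_nhds p a)"
    then obtain L e where L: "finite L" "0 < e" "\<forall>b. (\<forall>l\<in>L. p l (b - a) < e) \<longrightarrow> P b"
      unfolding eventually_tau_nhds by blast
    have "eventually (\<lambda>n. \<forall>l\<in>L. p l (f n - a) < e) F"
      using L(1,2) f by (intro eventually_ball_finite ballI order_tendstoD) auto
    then show "eventually (\<lambda>n. P (f n)) F"
      by eventually_elim (use L(3) in blast)
  qed
qed

lemma tau_lim_const: "filterlim (\<lambda>n. a) (tau_nhds p a) F"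
  by (simp add: tau_lim_iff p_zero)

lemma tau_lim_add:
  assumes "filterlim f (tau_nhds p a) F" "filterlim g (tau_nhds p b) F"
  shows "filterlim (\<lambda>n. f n + g n) (tau_nhds p (a + b)) F"
  unfolding tau_lim_iff
proof
  fix l
  have "((\<lambda>n. p l (f n - a) + p l (g n - b)) \<longlongrightarrow> 0 + 0) F"
    using assms unfolding tau_lim_iff by (intro tendsto_add) auto
  then have lim: "((\<lambda>n. p l (f n - a) + p l (g n - b)) \<longlongrightarrow> 0) F"
    by simp
  show "((\<lambda>n. p l (f n + g n - (a + b))) \<longlongrightarrow> 0) F"
  proof (rule tendsto_norm_le_0[OF _ lim])
    show "\<forall>\<^sub>F n in F. norm (p l (f n + g n - (a + b))) \<le> p l (f n - a) + p l (g n - b)"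
      using p_add[of l "f n - a" "g n - b" for n] by (simp add: p_nonneg algebra_simps)
  qed
qed

lemma tau_lim_sc:
  assumes "filterlim f (tau_nhds p a) F"
  shows "filterlim (\<lambda>n. sc c (f n)) (tau_nhds p (sc c a)) F"
  unfolding tau_lim_iff
proof
  fix l
  have "((\<lambda>n. cmod c * p l (f n - a)) \<longlongrightarrow> cmod c * 0) F"
    using assms unfolding tau_lim_iff by (intro tendsto_mult tendsto_const) auto
  then show "((\<lambda>n. p l (sc c (f n) - sc c a)) \<longlongrightarrow> 0) F"
    by (simp add: p_sc flip: scale_right_diff_distrib)
qed

lemma tau_lim_diff_const:
  "filterlim f (tau_nhds p a) F \<Longrightarrow> filterlim (\<lambda>n. f n - a) (tau_nhds p 0) F"
  by (simp add: tau_lim_iff)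

lemma tau_lim_unique:
  assumes "F \<noteq> bot" "filterlim f (tau_nhds p a) F" "filterlim f (tau_nhds p b) F"
  shows "a = b"
proof -
  have "p l (a - b) = 0" for l
  proof -
    have "((\<lambda>n. p l (f n - a) + p l (f n - b)) \<longlongrightarrow> 0 + 0) F"
      using assms unfolding tau_lim_iff by (intro tendsto_add) auto
    then have "p l (a - b) \<le> 0 + 0"
    proof (rule tendsto_lowerbound)
      have "p l (a - b) \<le> p l (f n - a) + p l (f n - b)" for n
        using p_add[of l "- (f n - a)" "f n - b"] by (simp only: p_minus) simp
      then show "\<forall>\<^sub>F n in F. p l (a - b) \<le> p l (f n - a) + p l (f n - b)" by simp
    qed (rule assms(1))
    then show ?thesis using p_nonneg[of l "a - b"] by simp
  qed
  then have "a - b = 0" by (rule p_separating)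
  then show ?thesis by simp
qed

text \<open>This filter plays the role of the generic net in A0 converging to \<open>a\<close>; it
  is proper because A0 is dense. Extended products, the extended involution and the extended forms
  are all limits along it.\<close>

definition A0_at :: "'a \<Rightarrow> 'a filter" where
  "A0_at a = inf (tau_nhds p a) (principal A0)"

lemma A0_at_nonbot: "A0_at a \<noteq> bot"
  using tau_completion by (simp add: tau_completion_def A0_at_def)

lemma A0_at_in: "filterlim f (A0_at a) F \<Longrightarrow> eventually (\<lambda>n. f n \<in> A0) F"
  by (simp add: A0_at_def filterlim_inf filterlim_principal)

lemma A0_at_lim: "filterlim f (A0_at a) F \<Longrightarrow> filterlim f (tau_nhds p a) F"
  by (simp add: A0_at_def filterlim_inf)

lemma A0_at_iff:
  "filterlim f (A0_at a) F \<longleftrightarrow> filterlim f (tau_nhds p a) F \<and> eventually (\<lambda>n. f n \<in> A0) F"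
  by (simp add: A0_at_def filterlim_inf filterlim_principal)

lemma A0_at_const: "x \<in> A0 \<Longrightarrow> filterlim (\<lambda>n. x) (A0_at x) F"
  by (simp add: A0_at_iff tau_lim_const)

lemma A0_at_add:
  assumes "filterlim f (A0_at a) F" "filterlim g (A0_at b) F"
  shows "filterlim (\<lambda>n. f n + g n) (A0_at (a + b)) F"
proof -
  have "eventually (\<lambda>n. f n + g n \<in> A0) F"
    using A0_at_in[OF assms(1)] A0_at_in[OF assms(2)] by eventually_elim (rule A0_add)
  then show ?thesis using assms by (simp add: A0_at_iff tau_lim_add)
qed

lemma A0_at_sc:
  assumes "filterlim f (A0_at a) F"
  shows "filterlim (\<lambda>n. sc c (f n)) (A0_at (sc c a)) F"
proof -
  have "eventually (\<lambda>n. sc c (f n) \<in> A0) F"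
    using A0_at_in[OF assms] by eventually_elim (rule A0_sc)
  then show ?thesis using assms by (simp add: A0_at_iff tau_lim_sc)
qed

text \<open>\<open>form_ext\<close> takes its limit along the left-hand filter. Written as a
  product, it allows both arguments to be approximated independently.\<close>

lemma tau_nhds_prod_A0:
  "inf (tau_nhds p a \<times>\<^sub>F tau_nhds p b) (principal (A0 \<times> A0)) = A0_at a \<times>\<^sub>F A0_at b"
proof -
  let ?T = "tau_nhds p a \<times>\<^sub>F tau_nhds p b"
  show ?thesis
  proof (rule antisym)
    have "filterlim fst (A0_at a) (inf ?T (principal (A0 \<times> A0)))"
      unfolding A0_at_iff
      by (intro conjI filterlim_mono[OF filterlim_fst order_refl inf_le1])
        (auto simp: eventually_inf_principal intro!: always_eventually)
    moreover have "filterlim snd (A0_at b) (inf ?T (principal (A0 \<times> A0)))"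
      unfolding A0_at_iff
      by (intro conjI filterlim_mono[OF filterlim_snd order_refl inf_le1])
        (auto simp: eventually_inf_principal intro!: always_eventually)
    ultimately show "inf ?T (principal (A0 \<times> A0)) \<le> A0_at a \<times>\<^sub>F A0_at b"
      unfolding filterlim_def by (rule le_prod_filterI)
    have "A0_at a \<times>\<^sub>F A0_at b \<le> ?T" "A0_at a \<times>\<^sub>F A0_at b \<le> principal A0 \<times>\<^sub>F principal A0"
      unfolding A0_at_def by (intro prod_filter_mono inf_le1 inf_le2)+
    then show "A0_at a \<times>\<^sub>F A0_at b \<le> inf ?T (principal (A0 \<times> A0))"
      by (simp add: principal_prod_principal)
  qed
qed

lemma form_ext_eqI:
  assumes "filterlim (\<lambda>(x, y). \<phi> x y) (nhds c) (A0_at a \<times>\<^sub>F A0_at b)"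
  shows "form_ext A0 p \<phi> a b = c"
  unfolding form_ext_def tau_nhds_prod_A0
proof (rule the_equality)
  show "filterlim (\<lambda>(x, y). \<phi> x y) (nhds c) (A0_at a \<times>\<^sub>F A0_at b)" by (rule assms)
  fix d
  assume "filterlim (\<lambda>(x, y). \<phi> x y) (nhds d) (A0_at a \<times>\<^sub>F A0_at b)"
  then show "d = c"
    using tendsto_unique[OF _ _ assms] by (simp add: prod_filter_eq_bot A0_at_nonbot)
qed

end

text \<open>A form in \<open>S_forms\<close> is bounded by a seminorm that is controlled on A0 only.
  Here the bound \<open>Q\<close> lives on the whole completion, so it can measure the distance from
  points of A0 to the limit points \<open>a\<close> and \<open>b\<close>.\<close>

locale cont_form = tau_space A0 sc p
  for A0 :: "'a::ab_group_add set" and sc and p :: "'i \<Rightarrow> 'a \<Rightarrow> real" +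
  fixes \<phi> :: "'a \<Rightarrow> 'a \<Rightarrow> complex" and Q :: "'a \<Rightarrow> real"
  assumes form_add_left: "x \<in> A0 \<Longrightarrow> y \<in> A0 \<Longrightarrow> z \<in> A0 \<Longrightarrow> \<phi> (x + y) z = \<phi> x z + \<phi> y z"
    and form_add_right: "x \<in> A0 \<Longrightarrow> y \<in> A0 \<Longrightarrow> z \<in> A0 \<Longrightarrow> \<phi> x (y + z) = \<phi> x y + \<phi> x z"
    and form_sc_left: "x \<in> A0 \<Longrightarrow> y \<in> A0 \<Longrightarrow> \<phi> (sc c x) y = c * \<phi> x y"
    and form_sc_right: "x \<in> A0 \<Longrightarrow> y \<in> A0 \<Longrightarrow> \<phi> x (sc c y) = cnj c * \<phi> x y"
    and form_self_real: "x \<in> A0 \<Longrightarrow> Im (\<phi> x x) = 0"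
    and form_nonneg: "x \<in> A0 \<Longrightarrow> 0 \<le> Re (\<phi> x x)"
    and Q_nonneg: "0 \<le> Q a"
    and Q_add: "Q (a + b) \<le> Q a + Q b"
    and Q_minus: "Q (- a) = Q a"
    and Q_cont: "(Q \<longlongrightarrow> 0) (tau_nhds p 0)"
    and form_le: "x \<in> A0 \<Longrightarrow> y \<in> A0 \<Longrightarrow> cmod (\<phi> x y) \<le> Q x * Q y"
begin

abbreviation ext :: "'a \<Rightarrow> 'a \<Rightarrow> complex" where
  "ext \<equiv> form_ext A0 p \<phi>"

text \<open>Positivity forces hermitian symmetry: the form is real at \<open>x + sc c y\<close>,
  which gives equality of the imaginary parts (up to sign) for \<open>c = 1\<close> and of the real
  parts for \<open>c = \<i>\<close>.\<close>

lemma form_cnj: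
  assumes x: "x \<in> A0" and y: "y \<in> A0"
  shows "\<phi> y x = cnj (\<phi> x y)"
proof -
  have *: "Im (cnj c * \<phi> x y + c * \<phi> y x) = 0" for c
  proof -
    have cy: "sc c y \<in> A0" using y by (rule A0_sc)
    have "\<phi> (x + sc c y) (x + sc c y)
        = \<phi> x x + cnj c * \<phi> x y + c * \<phi> y x + c * cnj c * \<phi> y y"
      using x y cy by (simp add: form_add_left form_add_right form_sc_left form_sc_right A0_add algebra_simps)
    moreover have "Im (c * cnj c * \<phi> y y) = 0"
      using form_self_real[OF y] complex_norm_square[of c] by simp
    ultimately show ?thesis
      using form_self_real[OF A0_add[OF x cy]] form_self_real[OF x] by (simp only: plus_complex.sel)
  qed
  show ?thesis
    using *[of 1] *[of \<i>] by (simp add: complex_eq_iff)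
qed

lemma form_diff:
  assumes "x \<in> A0" "y \<in> A0" "x' \<in> A0" "y' \<in> A0"
  shows "cmod (\<phi> x y - \<phi> x' y') \<le> Q (x - x') * Q y + Q x' * Q (y - y')"
proof -
  have "\<phi> x y = \<phi> (x - x') y + \<phi> x' y" "\<phi> x' y = \<phi> x' (y - y') + \<phi> x' y'"
    using assms by (simp_all add: A0_diff flip: form_add_left form_add_right)
  then have "\<phi> x y - \<phi> x' y' = \<phi> (x - x') y + \<phi> x' (y - y')"
    by simp
  then have "cmod (\<phi> x y - \<phi> x' y') \<le> cmod (\<phi> (x - x') y) + cmod (\<phi> x' (y - y'))"
    by (simp add: norm_triangle_ineq)
  also have "\<dots> \<le> Q (x - x') * Q y + Q x' * Q (y - y')"
    using assms by (intro add_mono form_le A0_diff)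
  finally show ?thesis .
qed

lemma Q_minus_commute: "Q (a - b) = Q (b - a)"
  using Q_minus[of "a - b"] by simp

lemma Q_triangle: "Q (a - c) \<le> Q (a - b) + Q (b - c)"
  using Q_add[of "a - b" "b - c"] by simp

lemma Q_lim:
  assumes "filterlim f (tau_nhds p a) F"
  shows "((\<lambda>n. Q (f n - a)) \<longlongrightarrow> 0) F"
  using filterlim_compose[OF Q_cont tau_lim_diff_const[OF assms]] .

lemma Q_tendsto:
  assumes "filterlim f (tau_nhds p a) F"
  shows "((\<lambda>n. Q (f n)) \<longlongrightarrow> Q a) F"
proof -
  have "((\<lambda>n. Q (f n) - Q a) \<longlongrightarrow> 0) F"
  proof (rule tendsto_norm_le_0[OF _ Q_lim[OF assms]])
    have "norm (Q (f n) - Q a) \<le> Q (f n - a)" for n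
      using Q_add[of "f n - a" a] Q_add[of "a - f n" "f n"] Q_minus_commute[of a "f n"] by auto
    then show "\<forall>\<^sub>F n in F. norm (Q (f n) - Q a) \<le> Q (f n - a)" by simp
  qed
  then show ?thesis by (simp add: LIM_zero_iff)
qed

lemma A0_approx: "0 < e \<Longrightarrow> \<exists>x\<in>A0. Q (x - a) < e"
proof -
  assume "0 < e"
  have id: "filterlim (\<lambda>x. x) (A0_at a) (A0_at a)" by (rule filterlim_ident)
  have "eventually (\<lambda>x. x \<in> A0 \<and> Q (x - a) < e) (A0_at a)"
    using A0_at_in[OF id] order_tendstoD(2)[OF Q_lim[OF A0_at_lim[OF id]] \<open>0 < e\<close>]
    by (rule eventually_conj)
  then show ?thesis
    using eventually_happens'[OF A0_at_nonbot] by blast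
qed

text \<open>A single \<open>Q\<close> governs the form, so sequences in A0 that approximate
  \<open>a\<close> and \<open>b\<close> in \<open>Q\<close> suffice even where tau has no countable
  base. The explicit estimate, uniform in \<open>x\<close> and \<open>y\<close>, reduces convergence
  along any filter to a comparison with a null function.\<close>

lemma ext_exists:
  "\<exists>c. \<forall>x\<in>A0. \<forall>y\<in>A0. cmod (\<phi> x y - c) \<le> Q (x - a) * Q y + Q a * Q (y - b)"
proof -
  have "\<exists>x\<in>A0. Q (x - a) < inverse (real (Suc n))" for n by (rule A0_approx) simp
  then obtain X where X: "\<And>n. X n \<in> A0" "\<And>n. Q (X n - a) < inverse (real (Suc n))" by metis
  have "\<exists>y\<in>A0. Q (y - b) < inverse (real (Suc n))" for n by (rule A0_approx) simp
  then obtain Y where Y: "\<And>n. Y n \<in> A0" "\<And>n. Q (Y n - b) < inverse (real (Suc n))" by metis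
  have limX: "(\<lambda>n. Q (X n - a)) \<longlonglongrightarrow> 0" and limY: "(\<lambda>n. Q (Y n - b)) \<longlonglongrightarrow> 0"
    using X(2) Y(2)
    by (intro tendsto_norm_le_0[OF _ LIMSEQ_inverse_real_of_nat];
        simp add: Q_nonneg less_imp_le del: of_nat_Suc)+
  have QX: "Q (X n) \<le> Q a + Q (X n - a)" and QY: "Q (Y n) \<le> Q b + Q (Y n - b)" for n
    using Q_add[of a "X n - a"] Q_add[of b "Y n - b"] by simp_all
  have inv: "inverse (real (Suc n)) \<le> 1" for n by (simp add: field_simps)
  have "Cauchy (\<lambda>n. \<phi> (X n) (Y n))"
  proof (rule CauchyI)
    fix e :: real
    assume "0 < e"
    \<comment> \<open>Beyond \<open>N\<close>, differences of approximants have \<open>Q\<close> at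
      most \<open>2 * d\<close>, and the approximants themselves at most \<open>Q a + 1\<close> and
      \<open>Q b + 1\<close>; \<open>form_diff\<close> then yields \<open>d * B\<close>.\<close>
    define B where "B = 2 * (Q a + Q b + 2)"
    have "0 < B" using Q_nonneg[of a] Q_nonneg[of b] by (simp add: B_def)
    then obtain N where N: "inverse (real (Suc N)) < e / B"
      using reals_Archimedean[of "e / B"] \<open>0 < e\<close> by auto
    define d where "d = inverse (real (Suc N))"
    have "0 \<le> d" by (simp add: d_def)
    have "norm (\<phi> (X m) (Y m) - \<phi> (X n) (Y n)) < e" if mn: "m \<ge> N" "n \<ge> N" for m n
    proof -
      have small: "Q (X k - a) \<le> d" "Q (Y k - b) \<le> d" if "k \<ge> N" for k
      proof -
        have "inverse (real (Suc k)) \<le> d"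
          unfolding d_def using that by (intro le_imp_inverse_le) auto
        then show "Q (X k - a) \<le> d" "Q (Y k - b) \<le> d"
          using X(2)[of k] Y(2)[of k] by linarith+
      qed
      have "Q (X m - X n) \<le> 2 * d" "Q (Y m - Y n) \<le> 2 * d"
        using Q_triangle[where b = a and a = "X m" and c = "X n"]
          Q_triangle[where b = b and a = "Y m" and c = "Y n"] Q_minus_commute[of a "X n"]
          Q_minus_commute[of b "Y n"] small[of m] small[of n] mn by simp_all
      moreover have "Q (Y m) \<le> Q b + 1" "Q (X n) \<le> Q a + 1"
        using QY[of m] QX[of n] X(2)[of n] Y(2)[of m] inv[of n] inv[of m] by linarith+
      ultimately have "Q (X m - X n) * Q (Y m) + Q (X n) * Q (Y m - Y n)
          \<le> 2 * d * (Q b + 1) + (Q a + 1) * (2 * d)"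
        using Q_nonneg \<open>0 \<le> d\<close> by (intro add_mono mult_mono) (auto intro: add_nonneg_nonneg order_trans[OF Q_nonneg])
      also have "\<dots> = d * B" by (simp add: B_def algebra_simps)
      also have "\<dots> < e" using N \<open>0 < B\<close> unfolding d_def by (simp add: pos_less_divide_eq)
      finally show ?thesis
        using form_diff[OF X(1) Y(1) X(1) Y(1), of m m n n] by linarith
    qed
    then show "\<exists>M. \<forall>m\<ge>M. \<forall>n\<ge>M. norm (\<phi> (X m) (Y m) - \<phi> (X n) (Y n)) < e" by blast
  qed
  then obtain c where c: "(\<lambda>n. \<phi> (X n) (Y n)) \<longlonglongrightarrow> c"
    using Cauchy_convergent_iff convergent_def by blast
  have "cmod (\<phi> x y - c) \<le> Q (x - a) * Q y + Q a * Q (y - b)" if x: "x \<in> A0" and y: "y \<in> A0" for x y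
  proof -
    have "(\<lambda>n. (Q (x - a) + Q (X n - a)) * Q y + (Q a + Q (X n - a)) * (Q (y - b) + Q (Y n - b)))
        \<longlonglongrightarrow> (Q (x - a) + 0) * Q y + (Q a + 0) * (Q (y - b) + 0)"
      by (intro tendsto_intros limX limY)
    moreover have "(\<lambda>n. cmod (\<phi> x y - \<phi> (X n) (Y n))) \<longlonglongrightarrow> cmod (\<phi> x y - c)"
      by (intro tendsto_intros c)
    moreover have "cmod (\<phi> x y - \<phi> (X n) (Y n))
        \<le> (Q (x - a) + Q (X n - a)) * Q y + (Q a + Q (X n - a)) * (Q (y - b) + Q (Y n - b))" for n
    proof -
      have "Q (x - X n) * Q y + Q (X n) * Q (y - Y n)
        \<le> (Q (x - a) + Q (X n - a)) * Q y + (Q a + Q (X n - a)) * (Q (y - b) + Q (Y n - b))"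
        using Q_triangle[of x "X n" a] Q_minus_commute[of a "X n"] QX[of n]
          Q_triangle[of y "Y n" b] Q_minus_commute[of b "Y n"] Q_nonneg
        by (intro add_mono mult_mono) (auto intro: add_nonneg_nonneg)
      then show ?thesis
        using form_diff[OF x y X(1) Y(1), of n n] by linarith
    qed
    ultimately show ?thesis
      using LIMSEQ_le by fastforce
  qed
  then show ?thesis by blast
qed

lemma ext_tendsto:
  assumes f: "filterlim f (A0_at a) F" and g: "filterlim g (A0_at b) F"
  shows "((\<lambda>n. \<phi> (f n) (g n)) \<longlongrightarrow> ext a b) F"
proof -
  obtain c where c: "\<forall>x\<in>A0. \<forall>y\<in>A0. cmod (\<phi> x y - c) \<le> Q (x - a) * Q y + Q a * Q (y - b)"
    using ext_exists by blast
  \<comment> \<open>The index type of the filter is left free: this is used along the product filter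
    that defines \<open>ext\<close> and again along the given \<open>F\<close>.\<close>
  have lim: "((\<lambda>n. \<phi> (f n) (g n)) \<longlongrightarrow> c) F"
    if f: "filterlim f (A0_at a) F" and g: "filterlim g (A0_at b) F"
    for F :: "'z filter" and f g
  proof -
    have "((\<lambda>n. \<phi> (f n) (g n) - c) \<longlongrightarrow> 0) F"
    proof (rule tendsto_norm_le_0)
      show "\<forall>\<^sub>F n in F. norm (\<phi> (f n) (g n) - c) \<le> Q (f n - a) * Q (g n) + Q a * Q (g n - b)"
        using A0_at_in[OF f] A0_at_in[OF g] by eventually_elim (use c in blast)
      have "((\<lambda>n. Q (f n - a) * Q (g n) + Q a * Q (g n - b)) \<longlongrightarrow> 0 * Q b + Q a * 0) F"
        by (intro tendsto_intros Q_lim Q_tendsto A0_at_lim f g)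
      then show "((\<lambda>n. Q (f n - a) * Q (g n) + Q a * Q (g n - b)) \<longlongrightarrow> 0) F" by simp
    qed
    then show ?thesis by (simp add: LIM_zero_iff)
  qed
  have "ext a b = c"
    using lim[OF filterlim_fst filterlim_snd] by (intro form_ext_eqI) (simp add: case_prod_unfold)
  then show ?thesis using lim[OF f g] by simp
qed

lemma ext_add_left: "ext (a + b) c = ext a c + ext b c"
proof -
  \<comment> \<open>A triple product filter approximates \<open>a\<close>, \<open>b\<close> and
    \<open>c\<close> independently while the common factor near \<open>c\<close> stays the same in
    both summands.\<close>
  let ?F = "A0_at a \<times>\<^sub>F (A0_at b \<times>\<^sub>F A0_at c)"
  have nb: "?F \<noteq> bot" by (simp add: prod_filter_eq_bot A0_at_nonbot)
  have f: "filterlim fst (A0_at a) ?F" "filterlim (\<lambda>n. fst (snd n)) (A0_at b) ?F"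
    "filterlim (\<lambda>n. snd (snd n)) (A0_at c) ?F"
    by (auto intro: filterlim_fst filterlim_compose[OF filterlim_fst filterlim_snd]
        filterlim_compose[OF filterlim_snd filterlim_snd])
  have "((\<lambda>n. \<phi> (fst n) (snd (snd n)) + \<phi> (fst (snd n)) (snd (snd n))) \<longlongrightarrow> ext a c + ext b c) ?F"
    by (intro tendsto_add ext_tendsto f)
  moreover have "((\<lambda>n. \<phi> (fst n + fst (snd n)) (snd (snd n))) \<longlongrightarrow> ext (a + b) c) ?F"
    by (intro ext_tendsto A0_at_add f)
  then have "((\<lambda>n. \<phi> (fst n) (snd (snd n)) + \<phi> (fst (snd n)) (snd (snd n))) \<longlongrightarrow> ext (a + b) c) ?F"
  proof (rule Lim_transform_eventually)
    show "\<forall>\<^sub>F n in ?F. \<phi> (fst n + fst (snd n)) (snd (snd n))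
        = \<phi> (fst n) (snd (snd n)) + \<phi> (fst (snd n)) (snd (snd n))"
      using A0_at_in[OF f(1)] A0_at_in[OF f(2)] A0_at_in[OF f(3)]
      by eventually_elim (rule form_add_left)
  qed
  ultimately show ?thesis
    using tendsto_unique[OF nb] by blast
qed

lemma ext_sc_left: "ext (sc c a) b = c * ext a b"
proof -
  let ?F = "A0_at a \<times>\<^sub>F A0_at b"
  have nb: "?F \<noteq> bot" by (simp add: prod_filter_eq_bot A0_at_nonbot)
  have f: "filterlim fst (A0_at a) ?F" "filterlim snd (A0_at b) ?F"
    by (rule filterlim_fst filterlim_snd)+
  have "((\<lambda>n. c * \<phi> (fst n) (snd n)) \<longlongrightarrow> c * ext a b) ?F"
    by (intro tendsto_mult tendsto_const ext_tendsto f)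
  moreover have "((\<lambda>n. \<phi> (sc c (fst n)) (snd n)) \<longlongrightarrow> ext (sc c a) b) ?F"
    by (intro ext_tendsto A0_at_sc f)
  then have "((\<lambda>n. c * \<phi> (fst n) (snd n)) \<longlongrightarrow> ext (sc c a) b) ?F"
  proof (rule Lim_transform_eventually)
    show "\<forall>\<^sub>F n in ?F. \<phi> (sc c (fst n)) (snd n) = c * \<phi> (fst n) (snd n)"
      using A0_at_in[OF f(1)] A0_at_in[OF f(2)] by eventually_elim (rule form_sc_left)
  qed
  ultimately show ?thesis
    using tendsto_unique[OF nb] by blast
qed

lemma ext_cnj: "ext b a = cnj (ext a b)"
proof -
  let ?F = "A0_at a \<times>\<^sub>F A0_at b"
  have nb: "?F \<noteq> bot" by (simp add: prod_filter_eq_bot A0_at_nonbot)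
  have f: "filterlim fst (A0_at a) ?F" "filterlim snd (A0_at b) ?F"
    by (rule filterlim_fst filterlim_snd)+
  have "((\<lambda>n. cnj (\<phi> (fst n) (snd n))) \<longlongrightarrow> cnj (ext a b)) ?F"
    by (intro tendsto_cnj ext_tendsto f)
  moreover have "((\<lambda>n. \<phi> (snd n) (fst n)) \<longlongrightarrow> ext b a) ?F"
    by (intro ext_tendsto f)
  then have "((\<lambda>n. cnj (\<phi> (fst n) (snd n))) \<longlongrightarrow> ext b a) ?F"
  proof (rule Lim_transform_eventually)
    show "\<forall>\<^sub>F n in ?F. \<phi> (snd n) (fst n) = cnj (\<phi> (fst n) (snd n))"
      using A0_at_in[OF f(1)] A0_at_in[OF f(2)] by eventually_elim (rule form_cnj)
  qed
  ultimately show ?thesis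
    using tendsto_unique[OF nb] by blast
qed

text \<open>The upper bound makes the extended quadratic form continuous at 0, which is how
  \<open>ext_tendsto_0\<close> uses it.\<close>

lemma ext_self:
  "0 \<le> Re (ext a a)" "Re (ext a a) \<le> (Q a)\<^sup>2"
proof -
  have f: "filterlim (\<lambda>x. x) (A0_at a) (A0_at a)" by (rule filterlim_ident)
  have lim: "((\<lambda>x. Re (\<phi> x x)) \<longlongrightarrow> Re (ext a a)) (A0_at a)"
    by (intro tendsto_Re ext_tendsto f)
  show "0 \<le> Re (ext a a)"
    by (rule tendsto_lowerbound[OF lim _ A0_at_nonbot])
      (use A0_at_in[OF f] form_nonneg in \<open>auto elim: eventually_mono\<close>)
  have "((\<lambda>x. (Q x)\<^sup>2) \<longlongrightarrow> (Q a)\<^sup>2) (A0_at a)"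
    by (intro tendsto_power Q_tendsto A0_at_lim f)
  then show "Re (ext a a) \<le> (Q a)\<^sup>2"
  proof (rule tendsto_le[OF A0_at_nonbot _ lim])
    show "\<forall>\<^sub>F x in A0_at a. Re (\<phi> x x) \<le> (Q x)\<^sup>2"
      using A0_at_in[OF f]
    proof eventually_elim
      case (elim x)
      then show ?case
        using form_le[OF elim elim] complex_Re_le_cmod[of "\<phi> x x"] by (simp add: power2_eq_square)
    qed
  qed
qed

sublocale ext: semi_inner_space UNIV sc ext
  by unfold_locales (simp_all add: ext_add_left ext_sc_left ext_self(1) scale_right_distrib ext_cnj[symmetric])

end

section \<open>Invariant forms on the quasi *-algebra\<close>

context tau_space
begin

lemma p_tendsto:
  assumes "filterlim f (tau_nhds p a) F"
  shows "((\<lambda>n. p l (f n)) \<longlongrightarrow> p l a) F"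
proof -
  have lim: "((\<lambda>n. p l (f n - a)) \<longlongrightarrow> 0) F"
    using assms by (simp add: tau_lim_iff)
  have "((\<lambda>n. p l (f n) - p l a) \<longlongrightarrow> 0) F"
  proof (rule tendsto_norm_le_0[OF _ lim])
    have "norm (p l (f n) - p l a) \<le> p l (f n - a)" for n
      using p_add[of l "f n - a" a] p_add[of l "a - f n" "f n"] p_minus[of l "f n - a"] by auto
    then show "\<forall>\<^sub>F n in F. norm (p l (f n) - p l a) \<le> p l (f n - a)" by simp
  qed
  then show ?thesis by (simp add: LIM_zero_iff)
qed

lemma tau_lim_eq:
  assumes "F \<noteq> bot" "filterlim f (tau_nhds p a) F" "filterlim g (tau_nhds p b) F"
    and "eventually (\<lambda>n. f n = g n) F"
  shows "a = b"
  using tau_lim_unique[OF assms(1,2)] filterlim_cong[OF refl refl assms(4)] assms(3) by blast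

text \<open>The open condition on \<open>a\<close> passes to nearby \<open>y\<close> in A0, where
  continuity of \<open>h\<close> applies, and the resulting bound passes back to \<open>h a\<close>
  in the limit. Strictness is lost on the way back, hence \<open>e / 2\<close>.\<close>

lemma extend_cont_at_0:
  assumes lim: "\<And>a. filterlim h (tau_nhds p (h a)) (A0_at a)"
    and cont: "tau_cont_on p p A0 h" and h0: "h 0 = 0"
  shows "filterlim h (tau_nhds p 0) (tau_nhds p 0)"
  unfolding tau_lim_iff
proof (intro allI tendstoI)
  fix l and e :: real
  assume "0 < e"
  then have "0 < e / 2" by simp
  then obtain L d where L: "finite L" "0 < d"
    and le: "\<And>y. y \<in> A0 \<Longrightarrow> \<forall>k\<in>L. p k y < d \<Longrightarrow> p l (h y) < e / 2"
    using cont[unfolded tau_cont_on_def, rule_format, OF A0_zero, of "e / 2" l] h0 by auto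
  have "p l (h a) < e" if a: "\<forall>k\<in>L. p k (a - 0) < d" for a
  proof -
    have id: "filterlim (\<lambda>y. y) (A0_at a) (A0_at a)" by (rule filterlim_ident)
    have "eventually (\<lambda>y. \<forall>k\<in>L. p k y < d) (A0_at a)"
      using L(1) a p_tendsto[OF A0_at_lim[OF id]]
      by (intro eventually_ball_finite ballI order_tendstoD(2)) auto
    with A0_at_in[OF id] have "eventually (\<lambda>y. p l (h y) \<le> e / 2) (A0_at a)"
      by eventually_elim (use le in \<open>force intro: less_imp_le\<close>)
    then have "p l (h a) \<le> e / 2"
      using tendsto_upperbound[OF p_tendsto[OF lim] _ A0_at_nonbot] by blast
    then show ?thesis using \<open>0 < e\<close> by simp
  qed
  then have "eventually (\<lambda>a. p l (h a) < e) (tau_nhds p 0)"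
    unfolding eventually_tau_nhds using L by blast
  then show "eventually (\<lambda>a. dist (p l (h a - 0)) 0 < e) (tau_nhds p 0)"
    by (simp add: p_nonneg)
qed

lemma S_forms_cont_form:
  assumes "\<phi> \<in> S_forms A0 sc mul star p"
  shows "\<exists>Q. cont_form A0 sc p \<phi> Q"
proof -
  obtain q where "tau_cont_seminorm A0 sc p q" and q: "\<forall>x\<in>A0. \<forall>y\<in>A0. cmod (\<phi> x y) \<le> q x * q y"
    using assms by (auto simp: S_forms_def)
  then obtain L C where sn: "seminorm_on sc A0 q" and L: "finite L" "\<forall>x\<in>A0. q x \<le> C * (\<Sum>l\<in>L. p l x)"
    by (auto simp: tau_cont_seminorm_def)
  \<comment> \<open>This majorant of \<open>q\<close> makes sense on the whole completion; the
    absolute value keeps it nonnegative for negative \<open>C\<close>.\<close>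
  define Q where "Q x = \<bar>C\<bar> * (\<Sum>l\<in>L. p l x)" for x
  have qQ: "0 \<le> q x" "q x \<le> Q x" if x: "x \<in> A0" for x
  proof -
    have "q (sc 0 x) = cmod 0 * q x" "q (sc (-1) x) = cmod (-1) * q x"
      using sn x unfolding seminorm_on_def by blast+
    moreover have "q (x + - x) \<le> q x + q (- x)"
      using sn x A0_minus[OF x] unfolding seminorm_on_def by blast
    ultimately show "0 \<le> q x" by simp
    have "C * (\<Sum>l\<in>L. p l x) \<le> Q x"
      unfolding Q_def by (intro mult_right_mono sum_nonneg p_nonneg) simp
    then show "q x \<le> Q x" using L(2) x by force
  qed
  have "cont_form A0 sc p \<phi> Q"
  proof
    show "0 \<le> Q a" for a by (simp add: Q_def sum_nonneg p_nonneg)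
    show "Q (- a) = Q a" for a by (simp add: Q_def p_minus)
    show "Q (a + b) \<le> Q a + Q b" for a b
      unfolding Q_def by (simp flip: distrib_left sum.distrib) (intro mult_left_mono sum_mono p_add, simp)
    have "filterlim (\<lambda>x. x) (tau_nhds p 0) (tau_nhds p 0)" by (rule filterlim_ident)
    then have "((\<lambda>x. \<bar>C\<bar> * (\<Sum>l\<in>L. p l x)) \<longlongrightarrow> \<bar>C\<bar> * (\<Sum>l\<in>L. p l 0)) (tau_nhds p 0)"
      by (intro tendsto_intros p_tendsto)
    then show "(Q \<longlongrightarrow> 0) (tau_nhds p 0)" unfolding Q_def[abs_def] by (simp add: p_zero)
    show "cmod (\<phi> x y) \<le> Q x * Q y" if "x \<in> A0" "y \<in> A0" for x y
      using q that qQ by (meson mult_mono order_trans)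
  qed (use assms in \<open>auto simp: S_forms_def\<close>)
  then show ?thesis by blast
qed

end

section \<open>Multiplication and involution on the completion\<close>

locale quasi_star_algebra = tau_space A0 sc p
  for A0 :: "'a::ab_group_add set" and sc and p :: "'i \<Rightarrow> 'a \<Rightarrow> real" +
  fixes mul :: "'a \<Rightarrow> 'a \<Rightarrow> 'a" and star :: "'a \<Rightarrow> 'a" and one :: 'a
  assumes extension: "quasi_star_extension A0 p mul star"
    and separately_cont: "cond_T1 A0 p mul star"
    and A0_one: "one \<in> A0"
    and A0_mul: "x \<in> A0 \<Longrightarrow> y \<in> A0 \<Longrightarrow> mul x y \<in> A0"
    and A0_star: "x \<in> A0 \<Longrightarrow> star x \<in> A0"
    and A0_assoc: "x \<in> A0 \<Longrightarrow> y \<in> A0 \<Longrightarrow> z \<in> A0 \<Longrightarrow> mul (mul x y) z = mul x (mul y z)"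
    and A0_distrib_right: "x \<in> A0 \<Longrightarrow> y \<in> A0 \<Longrightarrow> z \<in> A0 \<Longrightarrow> mul (x + y) z = mul x z + mul y z"
    and A0_distrib_left: "x \<in> A0 \<Longrightarrow> y \<in> A0 \<Longrightarrow> z \<in> A0 \<Longrightarrow> mul x (y + z) = mul x y + mul x z"
    and A0_sc_left: "x \<in> A0 \<Longrightarrow> y \<in> A0 \<Longrightarrow> mul (sc c x) y = sc c (mul x y)"
    and A0_sc_right: "x \<in> A0 \<Longrightarrow> y \<in> A0 \<Longrightarrow> mul x (sc c y) = sc c (mul x y)"
    and A0_one_right: "x \<in> A0 \<Longrightarrow> mul x one = x"
    and A0_star_star: "x \<in> A0 \<Longrightarrow> star (star x) = x"
    and A0_star_add: "x \<in> A0 \<Longrightarrow> y \<in> A0 \<Longrightarrow> star (x + y) = star x + star y"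
begin

abbreviation S :: "('a \<Rightarrow> 'a \<Rightarrow> complex) set" where
  "S \<equiv> S_forms A0 sc mul star p"

lemma A0_at_ident: "filterlim (\<lambda>x. x) (A0_at a) (A0_at a)"
  by (rule filterlim_ident)

text \<open>The limits are stated in \<open>A0_at\<close> and not only in the tau neighbourhoods, so
  they can be chained for iterated products.\<close>

lemma extension_lims:
  assumes f: "filterlim f (A0_at a) F"
  shows "x \<in> A0 \<Longrightarrow> filterlim (\<lambda>n. mul (f n) x) (A0_at (mul a x)) F" (is "_ \<Longrightarrow> ?l")
    and "x \<in> A0 \<Longrightarrow> filterlim (\<lambda>n. mul x (f n)) (A0_at (mul x a)) F" (is "_ \<Longrightarrow> ?r")
    and "filterlim (\<lambda>n. star (f n)) (A0_at (star a)) F" (is ?s)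
proof -
  have lims: "(\<forall>x\<in>A0. filterlim (\<lambda>y. mul y x) (tau_nhds p (mul a x)) (A0_at a) \<and>
      filterlim (\<lambda>y. mul x y) (tau_nhds p (mul x a)) (A0_at a)) \<and>
      filterlim star (tau_nhds p (star a)) (A0_at a)"
    using extension A0_at_nonbot unfolding quasi_star_extension_def A0_at_def by simp
  note ev = A0_at_in[OF f]
  show ?l if x: "x \<in> A0"
    unfolding A0_at_iff
  proof
    show "filterlim (\<lambda>n. mul (f n) x) (tau_nhds p (mul a x)) F"
      using lims x filterlim_compose[OF _ f] by blast
    show "eventually (\<lambda>n. mul (f n) x \<in> A0) F" using ev by eventually_elim (simp add: A0_mul x)
  qed
  show ?r if x: "x \<in> A0"
    unfolding A0_at_iff
  proof
    show "filterlim (\<lambda>n. mul x (f n)) (tau_nhds p (mul x a)) F"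
      using lims x filterlim_compose[OF _ f] by blast
    show "eventually (\<lambda>n. mul x (f n) \<in> A0) F" using ev by eventually_elim (simp add: A0_mul x)
  qed
  show ?s
    unfolding A0_at_iff
  proof
    show "filterlim (\<lambda>n. star (f n)) (tau_nhds p (star a)) F"
      using lims filterlim_compose[OF _ f] by blast
    show "eventually (\<lambda>n. star (f n) \<in> A0) F" using ev by eventually_elim (simp add: A0_star)
  qed
qed

lemmas mul_lim_left = extension_lims(1)
  and mul_lim_right = extension_lims(2)
  and star_lim = extension_lims(3)

text \<open>The principle of extension of identities: a law valid on A0 holds in the completion once
  both sides are limits along \<open>A0_at\<close>. \<open>A0_at2_eqI\<close> is the version for two
  free elements.\<close>

lemma A0_at_eqI:
  assumes "filterlim f (A0_at u) (A0_at a)" "filterlim g (A0_at v) (A0_at a)"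
    and "\<And>y. y \<in> A0 \<Longrightarrow> f y = g y"
  shows "u = v"
  by (rule tau_lim_eq[OF A0_at_nonbot A0_at_lim[OF assms(1)] A0_at_lim[OF assms(2)]])
    (rule eventually_mono[OF A0_at_in[OF A0_at_ident]], rule assms(3))

lemma A0_at2_eqI:
  assumes "filterlim f (A0_at u) (A0_at a \<times>\<^sub>F A0_at b)" "filterlim g (A0_at v) (A0_at a \<times>\<^sub>F A0_at b)"
    and "\<And>y z. y \<in> A0 \<Longrightarrow> z \<in> A0 \<Longrightarrow> f (y, z) = g (y, z)"
  shows "u = v"
proof (rule tau_lim_eq[OF _ A0_at_lim[OF assms(1)] A0_at_lim[OF assms(2)]])
  show "A0_at a \<times>\<^sub>F A0_at b \<noteq> bot" by (simp add: prod_filter_eq_bot A0_at_nonbot)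
  show "\<forall>\<^sub>F n in A0_at a \<times>\<^sub>F A0_at b. f n = g n"
    using A0_at_in[OF filterlim_fst] A0_at_in[OF filterlim_snd]
  proof eventually_elim
    case (elim n)
    then show ?case using assms(3)[of "fst n" "snd n"] by simp
  qed
qed

lemma mul_add_left: "x \<in> A0 \<Longrightarrow> mul (a + b) x = mul a x + mul b x"
  by (rule A0_at2_eqI[of "\<lambda>n. mul (fst n + snd n) x" _ a b "\<lambda>n. mul (fst n) x + mul (snd n) x"])
    (intro mul_lim_left A0_at_add filterlim_fst filterlim_snd | simp add: A0_distrib_right)+

lemma mul_sc_left: "x \<in> A0 \<Longrightarrow> mul (sc c a) x = sc c (mul a x)"
  by (rule A0_at_eqI[of "\<lambda>n. mul (sc c n) x" _ a "\<lambda>n. sc c (mul n x)"])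
    (intro mul_lim_left A0_at_sc A0_at_ident | simp add: A0_sc_left)+

lemma mul_add_right: "x \<in> A0 \<Longrightarrow> y \<in> A0 \<Longrightarrow> mul a (x + y) = mul a x + mul a y"
  by (rule A0_at_eqI[of "\<lambda>n. mul n (x + y)" _ a "\<lambda>n. mul n x + mul n y"])
    (intro mul_lim_left A0_at_add A0_at_ident | simp add: A0_distrib_left A0_add)+

lemma mul_sc_right: "x \<in> A0 \<Longrightarrow> mul a (sc c x) = sc c (mul a x)"
  by (rule A0_at_eqI[of "\<lambda>n. mul n (sc c x)" _ a "\<lambda>n. sc c (mul n x)"])
    (intro mul_lim_left A0_at_sc A0_at_ident | simp add: A0_sc_right A0_sc)+

lemma mul_zero_left: "x \<in> A0 \<Longrightarrow> mul 0 x = 0"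
  using mul_sc_left[of x 0 0] by simp

lemma mul_zero_right: "mul a 0 = 0"
  using mul_sc_right[OF A0_zero, of a 0] by simp

lemma mul_one_right: "mul a one = a"
  by (rule A0_at_eqI[of "\<lambda>n. mul n one" _ a "\<lambda>n. n"])
    (intro mul_lim_left A0_at_ident | simp add: A0_one A0_one_right)+

lemma mul_assoc_left: "x \<in> A0 \<Longrightarrow> y \<in> A0 \<Longrightarrow> mul (mul a x) y = mul a (mul x y)"
  by (rule A0_at_eqI[of "\<lambda>n. mul (mul n x) y" _ a "\<lambda>n. mul n (mul x y)"])
    (intro mul_lim_left A0_at_ident | simp add: A0_mul A0_assoc)+

lemma mul_assoc_mid: "x \<in> A0 \<Longrightarrow> y \<in> A0 \<Longrightarrow> mul (mul x a) y = mul x (mul a y)"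
  by (rule A0_at_eqI[of "\<lambda>n. mul (mul x n) y" _ a "\<lambda>n. mul x (mul n y)"])
    (intro mul_lim_left mul_lim_right A0_at_ident | simp add: A0_assoc)+

lemma star_add: "star (a + b) = star a + star b"
  by (rule A0_at2_eqI[of "\<lambda>n. star (fst n + snd n)" _ a b "\<lambda>n. star (fst n) + star (snd n)"])
    (intro star_lim A0_at_add filterlim_fst filterlim_snd | simp add: A0_star_add)+

lemma mul_diff_left: "x \<in> A0 \<Longrightarrow> mul (a - b) x = mul a x - mul b x"
  using mul_add_left[of x "a - b" b] by simp

lemma star_diff: "star (a - b) = star a - star b"
  using star_add[of "a - b" b] by simp

lemma mul_cont_at_0: "x \<in> A0 \<Longrightarrow> filterlim (\<lambda>a. mul a x) (tau_nhds p 0) (tau_nhds p 0)"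
  using separately_cont
  by (intro extend_cont_at_0 A0_at_lim mul_lim_left A0_at_ident) (auto simp: cond_T1_def mul_zero_left)

lemma star_cont_at_0: "filterlim star (tau_nhds p 0) (tau_nhds p 0)"
  using separately_cont star_add[of 0 0]
  by (intro extend_cont_at_0 A0_at_lim star_lim A0_at_ident) (auto simp: cond_T1_def)

section \<open>Invariance of the extended forms\<close>

lemma S_invariant: "\<phi> \<in> S \<Longrightarrow> x \<in> A0 \<Longrightarrow> y \<in> A0 \<Longrightarrow> z \<in> A0 \<Longrightarrow> \<phi> (mul z x) y = \<phi> x (mul (star z) y)"
  by (simp add: S_forms_def)

text \<open>The multiplier is approximated by elements of A0 while both vectors stay fixed in A0.
  This identity carries both the well-definedness and the adjoint of the operator of
  \<open>a\<close>.\<close>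

lemma ext_invariant:
  assumes \<phi>: "\<phi> \<in> S" and x: "x \<in> A0" and y: "y \<in> A0"
  shows "form_ext A0 p \<phi> (mul a x) y = form_ext A0 p \<phi> x (mul (star a) y)"
proof -
  obtain Q where "cont_form A0 sc p \<phi> Q" using S_forms_cont_form[OF \<phi>] by blast
  then interpret cont_form A0 sc p \<phi> Q .
  have "((\<lambda>z. \<phi> (mul z x) y) \<longlongrightarrow> ext (mul a x) y) (A0_at a)"
    using x y by (intro ext_tendsto mul_lim_left A0_at_ident A0_at_const)
  then have "((\<lambda>z. \<phi> x (mul (star z) y)) \<longlongrightarrow> ext (mul a x) y) (A0_at a)"
    by (rule Lim_transform_eventually)
      (rule eventually_mono[OF A0_at_in[OF A0_at_ident]], rule S_invariant[OF \<phi> x y])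
  moreover have "((\<lambda>z. \<phi> x (mul (star z) y)) \<longlongrightarrow> ext x (mul (star a) y)) (A0_at a)"
    using x y by (intro ext_tendsto mul_lim_left star_lim A0_at_ident A0_at_const)
  ultimately show ?thesis
    using tendsto_unique[OF A0_at_nonbot] by blast
qed

text \<open>Here the multiplier stays in A0 and the vectors are approximated. This covers vectors
  outside the domain, such as the images under a general \<open>a\<close>.\<close>

lemma ext_invariant_A0:
  assumes \<phi>: "\<phi> \<in> S" and z: "z \<in> A0"
  shows "form_ext A0 p \<phi> (mul z a) b = form_ext A0 p \<phi> a (mul (star z) b)"
proof -
  obtain Q where "cont_form A0 sc p \<phi> Q" using S_forms_cont_form[OF \<phi>] by blast
  then interpret cont_form A0 sc p \<phi> Q .
  let ?F = "A0_at a \<times>\<^sub>F A0_at b"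
  have nb: "?F \<noteq> bot" by (simp add: prod_filter_eq_bot A0_at_nonbot)
  have f: "filterlim fst (A0_at a) ?F" "filterlim snd (A0_at b) ?F"
    by (rule filterlim_fst filterlim_snd)+
  have "((\<lambda>n. \<phi> (mul z (fst n)) (snd n)) \<longlongrightarrow> ext (mul z a) b) ?F"
    by (intro ext_tendsto mul_lim_right f z)
  then have "((\<lambda>n. \<phi> (fst n) (mul (star z) (snd n))) \<longlongrightarrow> ext (mul z a) b) ?F"
  proof (rule Lim_transform_eventually)
    show "\<forall>\<^sub>F n in ?F. \<phi> (mul z (fst n)) (snd n) = \<phi> (fst n) (mul (star z) (snd n))"
      using A0_at_in[OF f(1)] A0_at_in[OF f(2)] by eventually_elim (rule S_invariant[OF \<phi> _ _ z])
  qed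
  moreover have "((\<lambda>n. \<phi> (fst n) (mul (star z) (snd n))) \<longlongrightarrow> ext a (mul (star z) b)) ?F"
    by (intro ext_tendsto mul_lim_right f A0_star z)
  ultimately show ?thesis
    using tendsto_unique[OF nb] by blast
qed

lemma S_semi_inner:
  assumes "\<phi> \<in> S"
  shows "semi_inner_space UNIV sc (form_ext A0 p \<phi>)"
proof -
  obtain Q where "cont_form A0 sc p \<phi> Q" using S_forms_cont_form[OF assms] by blast
  then interpret cont_form A0 sc p \<phi> Q .
  show ?thesis by (rule ext.semi_inner_space_axioms)
qed

lemma ext_tendsto_0:
  assumes "\<phi> \<in> S" "filterlim f (tau_nhds p 0) F"
  shows "((\<lambda>n. Re (form_ext A0 p \<phi> (f n) (f n))) \<longlongrightarrow> 0) F"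
proof -
  obtain Q where "cont_form A0 sc p \<phi> Q" using S_forms_cont_form[OF assms(1)] by blast
  then interpret cont_form A0 sc p \<phi> Q .
  have "((\<lambda>n. (Q (f n))\<^sup>2) \<longlongrightarrow> 0\<^sup>2) F"
    using Q_lim[OF assms(2)] by (intro tendsto_power) simp
  then have lim: "((\<lambda>n. (Q (f n))\<^sup>2) \<longlongrightarrow> 0) F" by simp
  show ?thesis
    by (rule tendsto_norm_le_0[OF _ lim]) (simp add: ext_self)
qed

end

section \<open>The direct sum of the GNS representations\<close>

text \<open>The difference of the two vectors is orthogonal to \<open>D\<close>; subtracting a
  nearby element of \<open>D\<close> from its first slot bounds its squared norm by an arbitrarily
  small multiple of its norm.\<close>

lemma dense_separates:
  assumes H: "hilbert_space H sch ip" and D: "dense_subspace H sch ip D"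
    and x: "x \<in> H" "y \<in> H" and eq: "\<And>z. z \<in> D \<Longrightarrow> ip z x = ip z y"
  shows "x = y"
proof -
  interpret semi_inner_space H sch ip by (rule hilbert_space_imp_semi_inner[OF H])
  let ?d = "x - y"
  have d: "?d \<in> H" using x by (rule diff_in)
  have orth: "ip z ?d = 0" if "z \<in> D" for z
    using that D x eq[OF that] s_diff_right[of z x y] by (auto simp: dense_subspace_def)
  have "(hnorm ip ?d)\<^sup>2 \<le> e * hnorm ip ?d" if e: "0 < e" for e
  proof -
    obtain z where z: "z \<in> D" "hnorm ip (?d - z) < e"
      using D d e unfolding dense_subspace_def by blast
    have zH: "z \<in> H" using z D by (auto simp: dense_subspace_def)
    have "ip ?d ?d = ip (?d - z) ?d"
      using s_diff_left[OF d zH d] orth[OF z(1)] by simp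
    then have "cmod (ip ?d ?d) \<le> hnorm ip (?d - z) * hnorm ip ?d"
      using cauchy_schwarz[OF diff_in[OF d zH] d] by simp
    also have "\<dots> \<le> e * hnorm ip ?d"
      using z(2) hnorm_nonneg[OF d] by (intro mult_right_mono) auto
    finally show ?thesis using s_self[OF d] by (simp add: norm_power)
  qed
  \<comment> \<open>A nonzero norm could be halved to serve as \<open>e\<close>, which would bound
    its square by half of that square.\<close>
  from this[of "hnorm ip ?d / 2"] have "hnorm ip ?d = 0"
    using hnorm_nonneg[OF d] by (cases "hnorm ip ?d = 0") (auto simp: power2_eq_square)
  then have "ip ?d ?d = 0" using s_self[OF d] by simp
  then have "?d = 0" using H d unfolding hilbert_space_def by blast
  then show ?thesis by simp
qed

text \<open>Density makes the description in \<open>adj\<close> unique, so any vector with the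
  adjoint property is its value.\<close>

lemma adj_eqI:
  assumes "hilbert_space H sch ip" "dense_subspace H sch ip D"
    and "\<zeta> \<in> H" "\<And>\<xi>. \<xi> \<in> D \<Longrightarrow> ip (X \<xi>) \<eta> = ip \<xi> \<zeta>"
  shows "adj H ip D X \<eta> = \<zeta>"
  unfolding adj_def
proof (rule the_equality)
  show "\<zeta> \<in> H \<and> (\<forall>\<xi>\<in>D. ip (X \<xi>) \<eta> = ip \<xi> \<zeta>)" using assms by blast
  fix \<zeta>' assume \<zeta>': "\<zeta>' \<in> H \<and> (\<forall>\<xi>\<in>D. ip (X \<xi>) \<eta> = ip \<xi> \<zeta>')"
  show "\<zeta>' = \<zeta>"
  proof (rule dense_separates[OF assms(1,2) _ assms(3)])
    show "\<zeta>' \<in> H" using \<zeta>' by blast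
    show "ip \<xi> \<zeta>' = ip \<xi> \<zeta>" if "\<xi> \<in> D" for \<xi>
      using \<zeta>' assms(4)[OF that] that by (metis (no_types))
  qed
qed

lemma adj_ip:
  assumes "hilbert_space H sch ip" "dense_subspace H sch ip D"
    and "\<eta> \<in> adj_dom H ip D X" "\<xi> \<in> D"
  shows "ip (X \<xi>) \<eta> = ip \<xi> (adj H ip D X \<eta>)"
proof -
  obtain \<zeta> where \<zeta>: "\<zeta> \<in> H" "\<And>\<xi>. \<xi> \<in> D \<Longrightarrow> ip (X \<xi>) \<eta> = ip \<xi> \<zeta>"
    using assms(3) by (auto simp: adj_dom_def)
  have "adj H ip D X \<eta> = \<zeta>" using assms(1,2) \<zeta> by (rule adj_eqI[where X = X])
  then show ?thesis using \<zeta>(2)[OF assms(4)] by simp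
qed

section \<open>The semi-inner product on finitely supported families\<close>

context quasi_star_algebra
begin

definition supp :: "(('a \<Rightarrow> 'a \<Rightarrow> complex) \<Rightarrow> 'a) \<Rightarrow> ('a \<Rightarrow> 'a \<Rightarrow> complex) set" where
  "supp v = {\<phi>. v \<phi> \<noteq> 0}"

definition sum_space :: "(('a \<Rightarrow> 'a \<Rightarrow> complex) \<Rightarrow> 'a) set" where
  "sum_space = {v. finite (supp v) \<and> supp v \<subseteq> S}"

definition sum_core :: "(('a \<Rightarrow> 'a \<Rightarrow> complex) \<Rightarrow> 'a) set" where
  "sum_core = {v \<in> sum_space. range v \<subseteq> A0}"

definition sum_scale :: "complex \<Rightarrow> (('a \<Rightarrow> 'a \<Rightarrow> complex) \<Rightarrow> 'a) \<Rightarrow> ('a \<Rightarrow> 'a \<Rightarrow> complex) \<Rightarrow> 'a" where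
  "sum_scale c v = (\<lambda>\<phi>. sc c (v \<phi>))"

definition sum_ip ::
  "(('a \<Rightarrow> 'a \<Rightarrow> complex) \<Rightarrow> 'a) \<Rightarrow> (('a \<Rightarrow> 'a \<Rightarrow> complex) \<Rightarrow> 'a) \<Rightarrow> complex" where
  "sum_ip v w = (\<Sum>\<phi>\<in>supp v. form_ext A0 p \<phi> (v \<phi>) (w \<phi>))"

text \<open>Every pair in the index type of \<open>rep_space\<close> has to name a vector, so pairs
  with a form outside \<open>S\<close> or an element outside A0 name the zero family.\<close>

definition basic :: "('a \<Rightarrow> 'a \<Rightarrow> complex) \<times> 'a \<Rightarrow> ('a \<Rightarrow> 'a \<Rightarrow> complex) \<Rightarrow> 'a" where
  "basic k = (\<lambda>\<psi>. if \<psi> = fst k \<and> fst k \<in> S \<and> snd k \<in> A0 then snd k else 0)"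

definition act :: "'a \<Rightarrow> (('a \<Rightarrow> 'a \<Rightarrow> complex) \<Rightarrow> 'a) \<Rightarrow> ('a \<Rightarrow> 'a \<Rightarrow> complex) \<Rightarrow> 'a" where
  "act a v = (\<lambda>\<phi>. mul a (v \<phi>))"

lemma sum_spaceI: "supp v \<subseteq> I \<Longrightarrow> finite I \<Longrightarrow> I \<subseteq> S \<Longrightarrow> v \<in> sum_space"
  by (auto simp: sum_space_def intro: finite_subset)

lemma sum_space_supp: "v \<in> sum_space \<Longrightarrow> finite (supp v)" "v \<in> sum_space \<Longrightarrow> supp v \<subseteq> S"
  by (auto simp: sum_space_def)

lemma sum_core_space: "v \<in> sum_core \<Longrightarrow> v \<in> sum_space"
  by (simp add: sum_core_def)

lemma sum_core_A0: "v \<in> sum_core \<Longrightarrow> v \<phi> \<in> A0"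
  by (auto simp: sum_core_def)

text \<open>Terms with \<open>v \<phi> = 0\<close> vanish for forms in \<open>S\<close>, so sums
  over different supports can be compared over a common index set.\<close>

lemma sum_ip_eq:
  assumes "finite I" "supp v \<subseteq> I" "I \<subseteq> S"
  shows "sum_ip v w = (\<Sum>\<phi>\<in>I. form_ext A0 p \<phi> (v \<phi>) (w \<phi>))"
  unfolding sum_ip_def
proof (rule sum.mono_neutral_left[OF assms(1,2)], rule ballI)
  fix \<phi> assume "\<phi> \<in> I - supp v"
  then show "form_ext A0 p \<phi> (v \<phi>) (w \<phi>) = 0"
    using semi_inner_space.s_zero_left[OF S_semi_inner] assms(3) by (auto simp: supp_def)
qed

lemma act_in: "v \<in> sum_space \<Longrightarrow> act a v \<in> sum_space"
  by (rule sum_spaceI[of _ "supp v"]) (auto simp: supp_def act_def mul_zero_right sum_space_def)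

lemma act_core: "x \<in> A0 \<Longrightarrow> v \<in> sum_core \<Longrightarrow> act x v \<in> sum_core"
  using act_in sum_core_A0[of v] by (auto simp: sum_core_def act_def A0_mul)

lemma basic_core: "basic k \<in> sum_core"
proof -
  have "basic k \<in> sum_space"
    by (rule sum_spaceI[of _ "{fst k} \<inter> S"]) (auto simp: supp_def basic_def split: if_splits)
  then show ?thesis by (auto simp: sum_core_def basic_def A0_zero)
qed

lemma sum_semi_inner: "semi_inner_space sum_space sum_scale sum_ip"
proof
  show "0 \<in> sum_space" by (simp add: sum_space_def supp_def)
next
  fix v w assume v: "v \<in> sum_space" and w: "w \<in> sum_space"
  show "v + w \<in> sum_space"
    by (rule sum_spaceI[of _ "supp v \<union> supp w"]) (use v w in \<open>auto simp: supp_def sum_space_def\<close>)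
next
  fix v c assume v: "v \<in> sum_space"
  show "sum_scale c v \<in> sum_space"
    by (rule sum_spaceI[of _ "supp v"]) (use v in \<open>auto simp: supp_def sum_scale_def sum_space_def\<close>)
  show "sum_scale (-1) v = - v"
    by (simp add: sum_scale_def fun_eq_iff)
next
  fix v w c show "sum_scale c (v + w) = sum_scale c v + sum_scale c w"
    by (simp add: sum_scale_def fun_eq_iff scale_right_distrib)
next
  fix u v w assume u: "u \<in> sum_space" and v: "v \<in> sum_space" and w: "w \<in> sum_space"
  let ?I = "supp u \<union> supp v"
  have I: "finite ?I" "?I \<subseteq> S" using sum_space_supp[OF u] sum_space_supp[OF v] by auto
  have "supp (u + v) \<subseteq> ?I" by (auto simp: supp_def)
  then have "sum_ip (u + v) w = (\<Sum>\<phi>\<in>?I. form_ext A0 p \<phi> (u \<phi> + v \<phi>) (w \<phi>))"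
    using sum_ip_eq[OF I(1) _ I(2)] by simp
  also have "\<dots> = (\<Sum>\<phi>\<in>?I. form_ext A0 p \<phi> (u \<phi>) (w \<phi>) + form_ext A0 p \<phi> (v \<phi>) (w \<phi>))"
    using I(2) semi_inner_space.s_add_left[OF S_semi_inner] by (intro sum.cong) auto
  also have "\<dots> = sum_ip u w + sum_ip v w"
    using sum_ip_eq[OF I(1) _ I(2)] by (simp add: sum.distrib)
  finally show "sum_ip (u + v) w = sum_ip u w + sum_ip v w" .
next
  fix v w c assume v: "v \<in> sum_space" and w: "w \<in> sum_space"
  note I = sum_space_supp[OF v]
  have "supp (sum_scale c v) \<subseteq> supp v" by (auto simp: supp_def sum_scale_def)
  then have "sum_ip (sum_scale c v) w = (\<Sum>\<phi>\<in>supp v. form_ext A0 p \<phi> (sc c (v \<phi>)) (w \<phi>))"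
    using sum_ip_eq[OF I(1) _ I(2)] by (simp add: sum_scale_def)
  also have "\<dots> = (\<Sum>\<phi>\<in>supp v. c * form_ext A0 p \<phi> (v \<phi>) (w \<phi>))"
    using I(2) semi_inner_space.s_sm_left[OF S_semi_inner] by (intro sum.cong) auto
  finally show "sum_ip (sum_scale c v) w = c * sum_ip v w"
    by (simp add: sum_ip_def sum_distrib_left)
next
  fix v w assume v: "v \<in> sum_space" and w: "w \<in> sum_space"
  let ?I = "supp v \<union> supp w"
  have I: "finite ?I" "?I \<subseteq> S" using sum_space_supp[OF v] sum_space_supp[OF w] by auto
  have "sum_ip w v = (\<Sum>\<phi>\<in>?I. form_ext A0 p \<phi> (w \<phi>) (v \<phi>))"
    by (rule sum_ip_eq) (use I in auto)
  also have "\<dots> = (\<Sum>\<phi>\<in>?I. cnj (form_ext A0 p \<phi> (v \<phi>) (w \<phi>)))"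
    using I(2) by (intro sum.cong refl semi_inner_space.s_cnj[OF S_semi_inner]) auto
  also have "\<dots> = cnj (\<Sum>\<phi>\<in>?I. form_ext A0 p \<phi> (v \<phi>) (w \<phi>))"
    by simp
  also have "(\<Sum>\<phi>\<in>?I. form_ext A0 p \<phi> (v \<phi>) (w \<phi>)) = sum_ip v w"
    by (rule sum_ip_eq[symmetric]) (use I in auto)
  finally show "sum_ip w v = cnj (sum_ip v w)" .
next
  fix v assume v: "v \<in> sum_space"
  then show "0 \<le> Re (sum_ip v v)"
    using semi_inner_space.s_nonneg[OF S_semi_inner] sum_space_supp[OF v]
    by (auto simp: sum_ip_def intro!: sum_nonneg)
qed

interpretation ds: semi_inner_space sum_space sum_scale sum_ip
  by (rule sum_semi_inner)

lemma sum_ip_basic: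
  assumes "\<phi> \<in> S" "y \<in> A0" "v \<in> sum_space"
  shows "sum_ip v (basic (\<phi>, y)) = form_ext A0 p \<phi> (v \<phi>) y"
proof -
  let ?I = "insert \<phi> (supp v)"
  have I: "finite ?I" "supp v \<subseteq> ?I" "?I \<subseteq> S" using sum_space_supp[OF assms(3)] assms(1) by auto
  have "sum_ip v (basic (\<phi>, y)) = (\<Sum>\<psi>\<in>?I. form_ext A0 p \<psi> (v \<psi>) (basic (\<phi>, y) \<psi>))"
    by (rule sum_ip_eq[OF I])
  also have "\<dots> = (\<Sum>\<psi>\<in>?I. if \<psi> = \<phi> then form_ext A0 p \<phi> (v \<phi>) y else 0)"
    using I(3) assms semi_inner_space.s_zero_right[OF S_semi_inner]
    by (intro sum.cong) (auto simp: basic_def)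
  finally show ?thesis using I(1) by simp
qed

lemma sum_ip_act:
  assumes v: "v \<in> sum_core" and w: "w \<in> sum_core"
  shows "sum_ip (act a v) w = sum_ip v (act (star a) w)"
proof -
  note I = sum_space_supp[OF sum_core_space[OF v]]
  have "supp (act a v) \<subseteq> supp v" by (auto simp: supp_def act_def mul_zero_right)
  then have "sum_ip (act a v) w = (\<Sum>\<phi>\<in>supp v. form_ext A0 p \<phi> (mul a (v \<phi>)) (w \<phi>))"
    using sum_ip_eq[OF I(1) _ I(2)] by (simp add: act_def)
  also have "\<dots> = (\<Sum>\<phi>\<in>supp v. form_ext A0 p \<phi> (v \<phi>) (mul (star a) (w \<phi>)))"
    using I(2) by (intro sum.cong refl ext_invariant sum_core_A0[OF v] sum_core_A0[OF w]) auto
  finally show ?thesis by (simp add: sum_ip_def act_def)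
qed

lemma sum_ip_act_A0:
  assumes x: "x \<in> A0" and v: "v \<in> sum_space"
  shows "sum_ip (act x v) w = sum_ip v (act (star x) w)"
proof -
  note I = sum_space_supp[OF v]
  have "supp (act x v) \<subseteq> supp v" by (auto simp: supp_def act_def mul_zero_right)
  then have "sum_ip (act x v) w = (\<Sum>\<phi>\<in>supp v. form_ext A0 p \<phi> (mul x (v \<phi>)) (w \<phi>))"
    using sum_ip_eq[OF I(1) _ I(2)] by (simp add: act_def)
  also have "\<dots> = (\<Sum>\<phi>\<in>supp v. form_ext A0 p \<phi> (v \<phi>) (mul (star x) (w \<phi>)))"
    using I(2) by (intro sum.cong refl ext_invariant_A0 x) auto
  finally show ?thesis by (simp add: sum_ip_def act_def)
qed

text \<open>Conjugating \<open>sum_ip_act\<close> with \<open>v\<close> and \<open>w\<close>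
  exchanged gives this form of the adjoint relation, from which double adjoints are computed without
  an appeal to \<open>star (star a) = a\<close> in the completion.\<close>

lemma sum_ip_act_star:
  assumes v: "v \<in> sum_core" and w: "w \<in> sum_core"
  shows "sum_ip (act (star a) v) w = sum_ip v (act a w)"
  using sum_ip_act[OF w v, of a] ds.s_cnj[of "act a w" v] ds.s_cnj[of w "act (star a) v"]
  by (simp add: act_in sum_core_space v w)

lemma sum_core_dense:
  assumes w: "w \<in> sum_space" and e: "0 < e"
  shows "\<exists>v\<in>sum_core. hnorm sum_ip (w - v) < e"
proof -
  note I = sum_space_supp[OF w]
  \<comment> \<open>Each component in the support contributes less than \<open>d\<close> to the
    squared norm; the summand 1 covers the empty support and makes the total strictly less than the
    square of \<open>e\<close>.\<close>
  define d where "d = e\<^sup>2 / (real (card (supp w)) + 1)"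
  have d: "0 < d" using e by (simp add: d_def add_nonneg_pos)
  have "\<exists>x\<in>A0. Re (form_ext A0 p \<phi> (x - w \<phi>) (x - w \<phi>)) < d" if \<phi>: "\<phi> \<in> supp w" for \<phi>
  proof -
    have "((\<lambda>x. Re (form_ext A0 p \<phi> (x - w \<phi>) (x - w \<phi>))) \<longlongrightarrow> 0) (A0_at (w \<phi>))"
      using \<phi> I(2) by (intro ext_tendsto_0 tau_lim_diff_const A0_at_lim A0_at_ident) auto
    from eventually_conj[OF A0_at_in[OF A0_at_ident] order_tendstoD(2)[OF this d]]
    show ?thesis using eventually_happens'[OF A0_at_nonbot] by blast
  qed
  then obtain x where x: "\<And>\<phi>. \<phi> \<in> supp w \<Longrightarrow> x \<phi> \<in> A0"
    "\<And>\<phi>. \<phi> \<in> supp w \<Longrightarrow> Re (form_ext A0 p \<phi> (x \<phi> - w \<phi>) (x \<phi> - w \<phi>)) < d"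
    by metis
  define v where "v \<phi> = (if \<phi> \<in> supp w then x \<phi> else 0)" for \<phi>
  have sv: "supp v \<subseteq> supp w" by (auto simp: v_def supp_def)
  have v: "v \<in> sum_core"
    using sum_spaceI[OF sv I] x(1) by (auto simp: sum_core_def v_def A0_zero)
  have "supp (v - w) \<subseteq> supp w" using sv by (auto simp: supp_def)
  then have "Re (sum_ip (v - w) (v - w))
      = (\<Sum>\<phi>\<in>supp w. Re (form_ext A0 p \<phi> (x \<phi> - w \<phi>) (x \<phi> - w \<phi>)))"
    using sum_ip_eq[OF I(1) _ I(2)] by (simp add: v_def)
  also have "\<dots> \<le> (\<Sum>\<phi>\<in>supp w. d)"
    using x(2) by (intro sum_mono) (auto intro: less_imp_le)
  also have "\<dots> < e\<^sup>2"
    using e by (simp add: d_def field_simps add_nonneg_pos)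
  finally have "hnorm sum_ip (v - w) < e"
    using e by (simp add: hnorm_def real_less_lsqrt less_imp_le)
  then show ?thesis
    using v ds.hnorm_minus_commute[OF w sum_core_space[OF v]] by (intro bexI[of _ v]) simp_all
qed

sublocale ds: kernel_space sum_space sum_scale sum_ip sum_core basic
proof
  show "sum_core \<subseteq> sum_space" by (auto simp: sum_core_def)
  show "0 \<in> sum_core" by (auto simp: sum_core_def ds.zero_in A0_zero)
  show "v + w \<in> sum_core" if "v \<in> sum_core" "w \<in> sum_core" for v w
    using that ds.add_in sum_core_A0[OF that(1)] sum_core_A0[OF that(2)] by (auto simp: sum_core_def A0_add)
  show "sum_scale c v \<in> sum_core" if "v \<in> sum_core" for v c
    using that ds.sm_in sum_core_A0[OF that] by (auto simp: sum_core_def sum_scale_def A0_sc)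
  show "\<exists>v\<in>sum_core. hnorm sum_ip (w - v) < e" if "w \<in> sum_space" "0 < e" for w e
    using that by (rule sum_core_dense)
  show "basic k \<in> sum_space" for k by (rule sum_core_space[OF basic_core])
  show "\<exists>I. finite I \<and> (\<forall>w\<in>sum_space. sum_ip w v = (\<Sum>k\<in>I. sum_ip w (basic k)))"
    if v: "v \<in> sum_core" for v
  proof (intro exI conjI ballI)
    note I = sum_space_supp[OF sum_core_space[OF v]]
    \<comment> \<open>The family \<open>v\<close> is the sum of its one-component families. No
      coefficients occur, because the second entry of an index runs through all of A0.\<close>
    show "finite ((\<lambda>\<phi>. (\<phi>, v \<phi>)) ` supp v)" using I by simp
    fix w assume w: "w \<in> sum_space"
    have "sum_ip w v = cnj (sum_ip v w)" by (rule ds.s_cnj[OF sum_core_space[OF v] w])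
    also have "\<dots> = (\<Sum>\<phi>\<in>supp v. cnj (form_ext A0 p \<phi> (v \<phi>) (w \<phi>)))"
      by (simp add: sum_ip_def)
    also have "\<dots> = (\<Sum>\<phi>\<in>supp v. sum_ip w (basic (\<phi>, v \<phi>)))"
    proof (rule sum.cong[OF refl])
      fix \<phi> assume "\<phi> \<in> supp v"
      then have \<phi>: "\<phi> \<in> S" using I(2) by blast
      show "cnj (form_ext A0 p \<phi> (v \<phi>) (w \<phi>)) = sum_ip w (basic (\<phi>, v \<phi>))"
        unfolding sum_ip_basic[OF \<phi> sum_core_A0[OF v] w]
        by (rule semi_inner_space.s_cnj[OF S_semi_inner[OF \<phi>], symmetric]) simp_all
    qed
    also have "\<dots> = (\<Sum>k\<in>(\<lambda>\<phi>. (\<phi>, v \<phi>)) ` supp v. sum_ip w (basic k))"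
      by (simp add: sum.reindex inj_on_def)
    finally show "sum_ip w v = (\<Sum>k\<in>(\<lambda>\<phi>. (\<phi>, v \<phi>)) ` supp v. sum_ip w (basic k))" .
  qed
qed

section \<open>The GNS operators on the Hilbert space of functions\<close>

definition gns_dom :: "'a rep_space set" where
  "gns_dom = ds.embed ` sum_core"

definition gns_rep :: "'a \<Rightarrow> 'a rep_space \<Rightarrow> 'a rep_space" where
  "gns_rep a d = ds.embed (act a (SOME v. v \<in> sum_core \<and> ds.embed v = d))"

text \<open>Independence of the chosen preimage needs no norm bound: a pairing of
  \<open>act a v\<close> with \<open>basic k\<close> equals the pairing of \<open>v\<close> with
  \<open>act (star a) (basic k)\<close>, which depends on \<open>ds.embed v\<close> only.\<close>

lemma gns_rep_embed:
  assumes v: "v \<in> sum_core"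
  shows "gns_rep a (ds.embed v) = ds.embed (act a v)"
proof -
  define v' where "v' = (SOME v'. v' \<in> sum_core \<and> ds.embed v' = ds.embed v)"
  have v': "v' \<in> sum_core" "ds.embed v' = ds.embed v"
    unfolding v'_def using someI[of "\<lambda>v'. v' \<in> sum_core \<and> ds.embed v' = ds.embed v" v] v by auto
  have "sum_ip (act a v') (basic k) = sum_ip (act a v) (basic k)" for k
  proof -
    have k: "act (star a) (basic k) \<in> sum_space" by (intro act_in sum_core_space basic_core)
    have "sum_ip v' (act (star a) (basic k)) = sum_ip v (act (star a) (basic k))"
      using ds.embed_ip[OF sum_core_space[OF v'(1)] k] ds.embed_ip[OF sum_core_space[OF v] k] v'(2) by simp
    then show ?thesis using sum_ip_act[OF v'(1) basic_core] sum_ip_act[OF v basic_core] by simp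
  qed
  then show ?thesis
    unfolding gns_rep_def v'_def[symmetric] by (simp add: ds.embed_def)
qed

abbreviation "gns_adj \<equiv> adj ds.completion ds.comp_ip gns_dom"

lemma gns_dense: "dense_subspace ds.completion ds.comp_scale ds.comp_ip gns_dom"
  unfolding gns_dom_def by (rule ds.embed_dense_subspace)

lemma gns_cases:
  assumes "\<xi> \<in> gns_dom"
  obtains v where "v \<in> sum_core" "\<xi> = ds.embed v"
  using assms by (auto simp: gns_dom_def)

text \<open>Transfers a formal adjoint between families to the adjoint in the Hilbert space. The
  family \<open>w\<close> need not be A0-valued, so adjoint domains can be tested on vectors outside
  \<open>gns_dom\<close>.\<close>

lemma gns_adjI:
  assumes w: "w \<in> sum_space" "w' \<in> sum_space"
    and X: "\<And>v. v \<in> sum_core \<Longrightarrow> X (ds.embed v) = ds.embed (Y v)"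
    and Y: "\<And>v. v \<in> sum_core \<Longrightarrow> Y v \<in> sum_space"
    and eq: "\<And>v. v \<in> sum_core \<Longrightarrow> sum_ip (Y v) w = sum_ip v w'"
  shows "ds.embed w \<in> adj_dom ds.completion ds.comp_ip gns_dom X"
    and "gns_adj X (ds.embed w) = ds.embed w'"
proof -
  have *: "ds.comp_ip (X \<xi>) (ds.embed w) = ds.comp_ip \<xi> (ds.embed w')" if "\<xi> \<in> gns_dom" for \<xi>
    using that
  proof (rule gns_cases)
    fix v assume v: "v \<in> sum_core" "\<xi> = ds.embed v"
    then show ?thesis
      using X[OF v(1)] Y[OF v(1)] eq[OF v(1)] w by (simp add: ds.embed_ip sum_core_space)
  qed
  then show "ds.embed w \<in> adj_dom ds.completion ds.comp_ip gns_dom X"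
    using w ds.embed_in unfolding adj_dom_def by blast
  show "gns_adj X (ds.embed w) = ds.embed w'"
    using ds.comp_hilbert gns_dense ds.embed_in[OF w(2)] * by (rule adj_eqI[where X = X])
qed

lemma gns_adj_rep:
  assumes w: "w \<in> sum_core"
  shows "ds.embed w \<in> adj_dom ds.completion ds.comp_ip gns_dom (gns_rep a)"
    and "gns_adj (gns_rep a) (ds.embed w) = ds.embed (act (star a) w)"
proof -
  note * = gns_adjI[OF sum_core_space[OF w] act_in[OF sum_core_space[OF w]], of "gns_rep a" "act a",
      OF gns_rep_embed act_in[OF sum_core_space] sum_ip_act[OF _ w]]
  show "ds.embed w \<in> adj_dom ds.completion ds.comp_ip gns_dom (gns_rep a)"
    and "gns_adj (gns_rep a) (ds.embed w) = ds.embed (act (star a) w)"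
    by (rule *; assumption)+
qed

text \<open>\<open>weak_mult\<close> applies this double adjoint; on A0-valued families it restores
  the action of \<open>a\<close>.\<close>

lemma gns_adj_adj_rep:
  assumes w: "w \<in> sum_core"
  shows "ds.embed w \<in> adj_dom ds.completion ds.comp_ip gns_dom (gns_adj (gns_rep a))"
    and "gns_adj (gns_adj (gns_rep a)) (ds.embed w) = ds.embed (act a w)"
proof -
  note * = gns_adjI[OF sum_core_space[OF w] act_in[OF sum_core_space[OF w]],
      of "gns_adj (gns_rep a)" "act (star a)",
      OF gns_adj_rep(2) act_in[OF sum_core_space] sum_ip_act_star[OF _ w]]
  show "ds.embed w \<in> adj_dom ds.completion ds.comp_ip gns_dom (gns_adj (gns_rep a))"
    and "gns_adj (gns_adj (gns_rep a)) (ds.embed w) = ds.embed (act a w)"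
    by (rule *; assumption)+
qed

text \<open>For \<open>x\<close> in A0 the adjoint domains contain the image of every family. The
  weak products require this, since \<open>gns_rep a\<close> and its adjoint map the domain to such
  images.\<close>

lemma gns_adj_rep_A0:
  assumes x: "x \<in> A0" and w: "w \<in> sum_space"
  shows "ds.embed w \<in> adj_dom ds.completion ds.comp_ip gns_dom (gns_rep x)"
    and "ds.embed w \<in> adj_dom ds.completion ds.comp_ip gns_dom (gns_adj (gns_rep x))"
    and "gns_adj (gns_adj (gns_rep x)) (ds.embed w) = ds.embed (act x w)"
proof -
  have eq: "sum_ip (act (star x) v) w = sum_ip v (act x w)" if "v \<in> sum_core" for v
    using sum_ip_act_A0[OF A0_star[OF x] sum_core_space[OF that], of w] by (simp add: A0_star_star x)
  note * = gns_adjI[OF w act_in[OF w], of "gns_adj (gns_rep x)" "act (star x)",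
      OF gns_adj_rep(2) act_in[OF sum_core_space] eq]
  show "ds.embed w \<in> adj_dom ds.completion ds.comp_ip gns_dom (gns_adj (gns_rep x))"
    and "gns_adj (gns_adj (gns_rep x)) (ds.embed w) = ds.embed (act x w)"
    by (rule *; assumption)+
  show "ds.embed w \<in> adj_dom ds.completion ds.comp_ip gns_dom (gns_rep x)"
    by (rule gns_adjI(1)[OF w act_in[OF w], of "gns_rep x" "act x",
        OF gns_rep_embed act_in[OF sum_core_space] sum_ip_act_A0[OF x sum_core_space]])
qed

lemma act_add_left: "v \<in> sum_core \<Longrightarrow> act (a + b) v = act a v + act b v"
  by (simp add: act_def fun_eq_iff mul_add_left sum_core_A0)

lemma act_diff_left: "v \<in> sum_core \<Longrightarrow> act (a - b) v = act a v - act b v"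
  by (simp add: act_def fun_eq_iff mul_diff_left sum_core_A0)

lemma act_sc_left: "v \<in> sum_core \<Longrightarrow> act (sc c a) v = sum_scale c (act a v)"
  by (simp add: act_def sum_scale_def fun_eq_iff mul_sc_left sum_core_A0)

lemma act_add_right: "v \<in> sum_core \<Longrightarrow> w \<in> sum_core \<Longrightarrow> act a (v + w) = act a v + act a w"
  by (simp add: act_def fun_eq_iff mul_add_right sum_core_A0)

lemma act_sc_right: "v \<in> sum_core \<Longrightarrow> act a (sum_scale c v) = sum_scale c (act a v)"
  by (simp add: act_def sum_scale_def fun_eq_iff mul_sc_right sum_core_A0)

lemma act_assoc_left: "x \<in> A0 \<Longrightarrow> v \<in> sum_core \<Longrightarrow> act (mul a x) v = act a (act x v)"
  by (simp add: act_def fun_eq_iff mul_assoc_left sum_core_A0)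

lemma act_assoc_mid: "x \<in> A0 \<Longrightarrow> v \<in> sum_core \<Longrightarrow> act (mul x a) v = act x (act a v)"
  by (simp add: act_def fun_eq_iff mul_assoc_mid sum_core_A0)

lemma gns_Ldagger: "Ldagger ds.completion ds.comp_scale ds.comp_ip gns_dom (gns_rep a)"
  unfolding Ldagger_def
proof (intro conjI ballI allI subsetI)
  fix \<xi> \<eta> c assume "\<xi> \<in> gns_dom"
  then obtain v where v: "v \<in> sum_core" "\<xi> = ds.embed v" by (rule gns_cases)
  note vs = sum_core_space[OF v(1)]
  show "gns_rep a \<xi> \<in> ds.completion"
    using v vs by (simp add: gns_rep_embed ds.embed_in act_in)
  show "gns_rep a (ds.comp_scale c \<xi>) = ds.comp_scale c (gns_rep a \<xi>)"
    using v vs ds.V_sm[OF v(1)]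
    by (simp add: gns_rep_embed act_sc_right act_in flip: ds.embed_sm)
  show "\<xi> \<in> adj_dom ds.completion ds.comp_ip gns_dom (gns_rep a)"
    using gns_adj_rep(1) v by simp
  assume "\<eta> \<in> gns_dom"
  then obtain w where w: "w \<in> sum_core" "\<eta> = ds.embed w" by (rule gns_cases)
  show "gns_rep a (\<xi> + \<eta>) = gns_rep a \<xi> + gns_rep a \<eta>"
    using v w vs sum_core_space[OF w(1)] ds.V_add[OF v(1) w(1)]
    by (simp add: gns_rep_embed act_add_right act_in flip: ds.embed_add)
qed

lemma gns_star_rep: "star_rep A0 sc mul star A ds.completion ds.comp_scale ds.comp_ip gns_dom gns_rep"
  unfolding star_rep_def
proof (intro conjI ballI allI ds.comp_hilbert gns_dense gns_Ldagger)
  fix a \<xi> assume "\<xi> \<in> gns_dom"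
  then obtain v where v: "v \<in> sum_core" "\<xi> = ds.embed v" by (rule gns_cases)
  note vs = sum_core_space[OF v(1)]
  show "gns_rep (a + b) \<xi> = gns_rep a \<xi> + gns_rep b \<xi>" for b
    using v vs by (simp add: gns_rep_embed act_add_left act_in ds.embed_add)
  show "gns_rep (sc c a) \<xi> = ds.comp_scale c (gns_rep a \<xi>)" for c
    using v vs by (simp add: gns_rep_embed act_sc_left act_in ds.embed_sm)
  show "gns_adj (gns_rep a) \<xi> = gns_rep (star a) \<xi>"
    using v by (simp add: gns_rep_embed gns_adj_rep)
  fix x assume x: "x \<in> A0"
  show "gns_rep (mul a x) \<xi> = weak_mult ds.completion ds.comp_ip gns_dom (gns_rep a) (gns_rep x) \<xi>"
    using v x by (simp add: weak_mult_def gns_rep_embed act_assoc_left gns_adj_adj_rep act_core)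
  show "gns_rep (mul x a) \<xi> = weak_mult ds.completion ds.comp_ip gns_dom (gns_rep x) (gns_rep a) \<xi>"
    using v x by (simp add: weak_mult_def gns_rep_embed act_assoc_mid gns_adj_rep_A0 act_in vs)
next
  fix x assume x: "x \<in> A0"
  have "gns_rep x ` gns_dom \<subseteq> gns_dom" "gns_adj (gns_rep x) ` gns_dom \<subseteq> gns_dom"
    unfolding gns_dom_def[of] using x
    by (auto simp: gns_rep_embed act_core A0_star gns_adj_rep(2)[unfolded gns_dom_def])
  then show "Ldagger_alg ds.completion ds.comp_scale ds.comp_ip gns_dom (gns_rep x)"
    unfolding Ldagger_alg_def using gns_Ldagger by blast
  show "gns_rep (mul x y) \<xi> = gns_rep x (gns_rep y \<xi>)" if "y \<in> A0" "\<xi> \<in> gns_dom" for y \<xi>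
    using that(2)
  proof (rule gns_cases)
    fix v assume v: "v \<in> sum_core" "\<xi> = ds.embed v"
    then show ?thesis using that(1) by (simp add: gns_rep_embed act_assoc_left act_core)
  qed
  fix a
  show "weak_mult_defined ds.completion ds.comp_ip gns_dom (gns_rep a) (gns_rep x)"
    unfolding weak_mult_defined_def
    by (auto elim!: gns_cases simp: gns_rep_embed x act_core gns_adj_adj_rep gns_adj_rep gns_adj_rep_A0
        act_in sum_core_space)
  show "weak_mult_defined ds.completion ds.comp_ip gns_dom (gns_rep x) (gns_rep a)"
    unfolding weak_mult_defined_def
    by (auto elim!: gns_cases simp: gns_rep_embed x act_core A0_star gns_adj_rep gns_adj_rep_A0
        act_in sum_core_space)
qed

text \<open>The squared norm is the finite sum of phi~(a v, a v) over the support. Right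
  multiplication by a fixed element of A0 is continuous at 0, and each extended quadratic form tends
  to 0 there.\<close>

lemma gns_cont_at_0:
  assumes "\<xi> \<in> gns_dom"
  shows "((\<lambda>a. hnorm ds.comp_ip (gns_rep a \<xi>)) \<longlongrightarrow> 0) (tau_nhds p 0)"
proof -
  obtain v where v: "v \<in> sum_core" "\<xi> = ds.embed v" using assms by (rule gns_cases)
  note I = sum_space_supp[OF sum_core_space[OF v(1)]]
  have "((\<lambda>a. \<Sum>\<phi>\<in>supp v. Re (form_ext A0 p \<phi> (mul a (v \<phi>)) (mul a (v \<phi>)))) \<longlongrightarrow> (\<Sum>\<phi>\<in>supp v. 0))
      (tau_nhds p 0)"
    using I(2) by (intro tendsto_sum ext_tendsto_0 mul_cont_at_0 sum_core_A0[OF v(1)]) auto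
  then have "((\<lambda>a. sqrt (\<Sum>\<phi>\<in>supp v. Re (form_ext A0 p \<phi> (mul a (v \<phi>)) (mul a (v \<phi>))))) \<longlongrightarrow> sqrt 0)
      (tau_nhds p 0)"
    by (intro tendsto_real_sqrt) simp
  moreover have "hnorm ds.comp_ip (gns_rep a \<xi>)
      = sqrt (\<Sum>\<phi>\<in>supp v. Re (form_ext A0 p \<phi> (mul a (v \<phi>)) (mul a (v \<phi>))))" for a
  proof -
    have "supp (act a v) \<subseteq> supp v" by (auto simp: supp_def act_def mul_zero_right)
    then have "Re (sum_ip (act a v) (act a v))
        = (\<Sum>\<phi>\<in>supp v. Re (form_ext A0 p \<phi> (mul a (v \<phi>)) (mul a (v \<phi>))))"
      using sum_ip_eq[OF I(1) _ I(2)] by (simp add: act_def)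
    then show ?thesis
      using v by (simp add: hnorm_def gns_rep_embed ds.embed_ip act_in sum_core_space)
  qed
  ultimately show ?thesis by simp
qed

lemma gns_rep_diff:
  assumes "\<xi> \<in> gns_dom"
  shows "gns_rep (a - b) \<xi> = gns_rep a \<xi> - gns_rep b \<xi>"
proof -
  obtain v where v: "v \<in> sum_core" "\<xi> = ds.embed v" using assms by (rule gns_cases)
  then show ?thesis by (simp add: gns_rep_embed act_diff_left ds.embed_diff act_in sum_core_space)
qed

lemma gns_adj_eq: "\<xi> \<in> gns_dom \<Longrightarrow> gns_adj (gns_rep a) \<xi> = gns_rep (star a) \<xi>"
  by (elim gns_cases) (simp add: gns_rep_embed gns_adj_rep)

text \<open>Linearity reduces continuity at \<open>a\<close> to continuity at 0; the adjoint half of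
  the seminorm is the same estimate composed with the involution.\<close>

lemma gns_continuous: "rep_continuous p A ds.completion ds.comp_ip gns_dom gns_rep"
  unfolding rep_continuous_def
proof (intro ballI allI impI)
  fix a and X :: "'a rep_space set" and e :: real
  assume X: "finite X \<and> X \<subseteq> gns_dom" and e: "0 < e"
  have "((\<lambda>c. \<Sum>\<xi>\<in>X. hnorm ds.comp_ip (gns_rep c \<xi>) + hnorm ds.comp_ip (gns_rep (star c) \<xi>))
      \<longlongrightarrow> (\<Sum>\<xi>\<in>X. 0 + 0)) (tau_nhds p 0)"
    using X by (intro tendsto_sum tendsto_add gns_cont_at_0
        filterlim_compose[OF gns_cont_at_0 star_cont_at_0]) auto
  then have "eventually (\<lambda>c. (\<Sum>\<xi>\<in>X. hnorm ds.comp_ip (gns_rep c \<xi>)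
      + hnorm ds.comp_ip (gns_rep (star c) \<xi>)) < e) (tau_nhds p 0)"
    using e by (intro order_tendstoD(2)) auto
  then obtain L d where L: "finite L" "0 < d"
    and less: "\<And>c. \<forall>l\<in>L. p l c < d \<Longrightarrow> (\<Sum>\<xi>\<in>X. hnorm ds.comp_ip (gns_rep c \<xi>)
      + hnorm ds.comp_ip (gns_rep (star c) \<xi>)) < e"
    unfolding eventually_tau_nhds by auto
  have "(\<Sum>\<xi>\<in>X. hnorm ds.comp_ip (gns_rep b \<xi> - gns_rep a \<xi>)
      + hnorm ds.comp_ip (gns_adj (gns_rep b) \<xi> - gns_adj (gns_rep a) \<xi>)) < e"
    if "\<forall>l\<in>L. p l (b - a) < d" for b
  proof -
    have "(\<Sum>\<xi>\<in>X. hnorm ds.comp_ip (gns_rep b \<xi> - gns_rep a \<xi>)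
        + hnorm ds.comp_ip (gns_adj (gns_rep b) \<xi> - gns_adj (gns_rep a) \<xi>))
      = (\<Sum>\<xi>\<in>X. hnorm ds.comp_ip (gns_rep (b - a) \<xi>) + hnorm ds.comp_ip (gns_rep (star (b - a)) \<xi>))"
      using X by (intro sum.cong) (auto simp: gns_adj_eq gns_rep_diff star_diff subset_iff)
    then show ?thesis using less[OF that] by simp
  qed
  then show "\<exists>L d. finite L \<and> 0 < d \<and> (\<forall>b\<in>A. (\<forall>l\<in>L. p l (b - a) < d) \<longrightarrow>
      (\<Sum>\<xi>\<in>X. hnorm ds.comp_ip (gns_rep b \<xi> - gns_rep a \<xi>)
        + hnorm ds.comp_ip (gns_adj (gns_rep b) \<xi> - gns_adj (gns_rep a) \<xi>)) < e)"
    using L by blast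
qed

lemma gns_zero_imp_ext_zero:
  assumes zero: "\<And>\<xi>. \<xi> \<in> gns_dom \<Longrightarrow> gns_rep a \<xi> = 0" and \<phi>: "\<phi> \<in> S"
  shows "form_ext A0 p \<phi> a a = 0"
proof -
  let ?b = "basic (\<phi>, one)"
  have b: "?b \<in> sum_core" by (rule basic_core)
  then have act: "act a ?b \<in> sum_space" by (intro act_in sum_core_space)
  have "ds.embed (act a ?b) = 0"
    using zero[of "ds.embed ?b"] b by (auto simp: gns_dom_def gns_rep_embed)
  then have "sum_ip (act a ?b) (act a ?b) = 0"
    using ds.embed_ip[OF act act] ds.embed_ip[OF ds.zero_in act]
    by (simp add: ds.embed_zero ds.s_zero_left act)
  moreover have "supp (act a ?b) \<subseteq> {\<phi>}"
    by (auto simp: supp_def act_def basic_def mul_zero_right split: if_splits)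
  then have "sum_ip (act a ?b) (act a ?b) = form_ext A0 p \<phi> a a"
    using sum_ip_eq[of "{\<phi>}" "act a ?b"] \<phi> by (simp add: act_def basic_def A0_one mul_one_right)
  ultimately show ?thesis by simp
qed

lemma gns_faithful_cont_star_rep:
  assumes suff: "S_sufficient A0 sc mul star p A"
    and A_add: "\<And>a b. a \<in> A \<Longrightarrow> b \<in> A \<Longrightarrow> a + b \<in> A" and A_sc: "\<And>c a. a \<in> A \<Longrightarrow> sc c a \<in> A"
  shows "faithful_cont_star_rep A0 sc mul star p A ds.completion ds.comp_scale ds.comp_ip gns_dom gns_rep"
  unfolding faithful_cont_star_rep_def
proof (intro conjI gns_star_rep gns_continuous)
  show "rep_faithful A gns_dom gns_rep"
    unfolding rep_faithful_def
  proof (intro ballI impI)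
    fix a b assume a: "a \<in> A" and b: "b \<in> A" and eq: "\<forall>\<xi>\<in>gns_dom. gns_rep a \<xi> = gns_rep b \<xi>"
    have "a - b \<in> A" using A_add[OF a A_sc[OF b, of "-1"]] by simp
    moreover have "form_ext A0 p \<phi> (a - b) (a - b) = 0" if "\<phi> \<in> S" for \<phi>
      using eq by (intro gns_zero_imp_ext_zero that) (simp add: gns_rep_diff)
    ultimately have "a - b = 0"
      using suff unfolding S_sufficient_def by blast
    then show "a = b" by simp
  qed
qed

section \<open>Vector forms of a given continuous representation\<close>

context
  fixes A :: "'a set" and H :: "'h::ab_group_add set" and sch ip D \<pi>
  assumes A0_sub: "A0 \<subseteq> A" and A_star: "\<And>a. a \<in> A \<Longrightarrow> star a \<in> A"
    and rep: "star_rep A0 sc mul star A H sch ip D \<pi>"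
    and rep_cont: "rep_continuous p A H ip D \<pi>"
begin

lemma rep_hilbert: "hilbert_space H sch ip" and rep_dense: "dense_subspace H sch ip D"
  using rep by (simp_all add: star_rep_def)

interpretation H: semi_inner_space H sch ip
  by (rule hilbert_space_imp_semi_inner[OF rep_hilbert])

lemma rep_add: "a \<in> A \<Longrightarrow> b \<in> A \<Longrightarrow> \<xi> \<in> D \<Longrightarrow> \<pi> (a + b) \<xi> = \<pi> a \<xi> + \<pi> b \<xi>"
  using rep by (simp add: star_rep_def)

lemma rep_sc: "a \<in> A \<Longrightarrow> \<xi> \<in> D \<Longrightarrow> \<pi> (sc c a) \<xi> = sch c (\<pi> a \<xi>)"
  using rep by (simp add: star_rep_def)

lemma rep_mul: "x \<in> A0 \<Longrightarrow> y \<in> A0 \<Longrightarrow> \<xi> \<in> D \<Longrightarrow> \<pi> (mul x y) \<xi> = \<pi> x (\<pi> y \<xi>)"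
  using rep by (simp add: star_rep_def)

lemma rep_adj: "a \<in> A \<Longrightarrow> \<xi> \<in> D \<Longrightarrow> adj H ip D (\<pi> a) \<xi> = \<pi> (star a) \<xi>"
  using rep by (simp add: star_rep_def)

lemma rep_Ldagger: "a \<in> A \<Longrightarrow> Ldagger H sch ip D (\<pi> a)"
  using rep by (simp add: star_rep_def)

lemma rep_in: "a \<in> A \<Longrightarrow> \<xi> \<in> D \<Longrightarrow> \<pi> a \<xi> \<in> H"
  using rep_Ldagger by (simp add: Ldagger_def)

lemma rep_dom: "\<pi> x \<xi> \<in> D" if "x \<in> A0" "\<xi> \<in> D"
proof -
  have "\<pi> x ` D \<subseteq> D" using rep that(1) by (simp add: star_rep_def Ldagger_alg_def)
  then show ?thesis using that(2) by blast
qed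

lemma rep_zero: "\<xi> \<in> D \<Longrightarrow> \<pi> 0 \<xi> = 0"
  using rep_add[of 0 0 \<xi>] A0_zero A0_sub by auto

lemma rep_ip:
  assumes "a \<in> A" "\<xi> \<in> D" "\<eta> \<in> D"
  shows "ip (\<pi> a \<xi>) \<eta> = ip \<xi> (\<pi> (star a) \<eta>)"
proof -
  have "\<eta> \<in> adj_dom H ip D (\<pi> a)"
    using rep_Ldagger[OF assms(1)] assms(3) by (auto simp: Ldagger_def)
  from adj_ip[OF rep_hilbert rep_dense this assms(2)] show ?thesis
    using rep_adj[OF assms(1,3)] by simp
qed

lemma rep_cont_vector:
  assumes a: "a \<in> A" and \<xi>: "\<xi> \<in> D" and e: "0 < e"
  shows "\<exists>L d. finite L \<and> 0 < d \<and> (\<forall>b\<in>A. (\<forall>l\<in>L. p l (b - a) < d) \<longrightarrow> hnorm ip (\<pi> b \<xi> - \<pi> a \<xi>) < e)"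
proof -
  \<comment> \<open>The seminorm of a singleton is used; its adjoint summand is nonnegative and can
    then be dropped.\<close>
  have "\<exists>L d. finite L \<and> 0 < d \<and> (\<forall>b\<in>A. (\<forall>l\<in>L. p l (b - a) < d) \<longrightarrow>
      (\<Sum>\<eta>\<in>{\<xi>}. hnorm ip (\<pi> b \<eta> - \<pi> a \<eta>) + hnorm ip (adj H ip D (\<pi> b) \<eta> - adj H ip D (\<pi> a) \<eta>)) < e)"
    by (rule rep_cont[unfolded rep_continuous_def, rule_format, OF a _ e]) (use \<xi> in simp)
  then obtain L d where L: "finite L" "0 < d" and
    less: "\<And>b. b \<in> A \<Longrightarrow> \<forall>l\<in>L. p l (b - a) < d \<Longrightarrow>
      hnorm ip (\<pi> b \<xi> - \<pi> a \<xi>) + hnorm ip (\<pi> (star b) \<xi> - \<pi> (star a) \<xi>) < e"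
    using \<xi> a by (auto simp: rep_adj)
  have "hnorm ip (\<pi> b \<xi> - \<pi> a \<xi>) < e" if "b \<in> A" "\<forall>l\<in>L. p l (b - a) < d" for b
  proof -
    have "0 \<le> hnorm ip (\<pi> (star b) \<xi> - \<pi> (star a) \<xi>)"
      by (intro H.hnorm_nonneg H.diff_in rep_in A_star a \<xi> that)
    then show ?thesis using less[OF that] by linarith
  qed
  then show ?thesis using L by blast
qed

lemma rep_vector_lim:
  assumes a: "a \<in> A" and \<xi>: "\<xi> \<in> D" and f: "filterlim f (A0_at a) F"
  shows "((\<lambda>n. hnorm ip (\<pi> (f n) \<xi> - \<pi> a \<xi>)) \<longlongrightarrow> 0) F"
proof (rule tendstoI)
  fix e :: real assume e: "0 < e"
  obtain L d where L: "finite L" "0 < d"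
    and less: "\<And>b. b \<in> A \<Longrightarrow> \<forall>l\<in>L. p l (b - a) < d \<Longrightarrow> hnorm ip (\<pi> b \<xi> - \<pi> a \<xi>) < e"
    using rep_cont_vector[OF a \<xi> e] by blast
  have "eventually (\<lambda>b. \<forall>l\<in>L. p l (b - a) < d) (tau_nhds p a)"
    unfolding eventually_tau_nhds using L by blast
  from eventually_compose_filterlim[OF this A0_at_lim[OF f]] A0_at_in[OF f]
  show "\<forall>\<^sub>F n in F. dist (hnorm ip (\<pi> (f n) \<xi> - \<pi> a \<xi>)) 0 < e"
  proof eventually_elim
    case (elim n)
    then have "f n \<in> A" using A0_sub by blast
    then show ?case
      using less[of "f n"] elim H.hnorm_nonneg[OF H.diff_in[OF rep_in rep_in], of "f n" \<xi> a \<xi>] a \<xi> by simp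
  qed
qed

text \<open>Continuity at 0 bounds the norm by 1 on a basic neighbourhood of radius
  \<open>d\<close>; homogeneity turns this into the constant \<open>1 / d\<close> in front of the
  sum of seminorms.\<close>

lemma vector_seminorm:
  assumes \<xi>: "\<xi> \<in> D"
  shows "tau_cont_seminorm A0 sc p (\<lambda>x. hnorm ip (\<pi> x \<xi>))"
  unfolding tau_cont_seminorm_def seminorm_on_def
proof (intro conjI ballI allI)
  note inA = subsetD[OF A0_sub]
  show "hnorm ip (\<pi> (x + y) \<xi>) \<le> hnorm ip (\<pi> x \<xi>) + hnorm ip (\<pi> y \<xi>)" if "x \<in> A0" "y \<in> A0" for x y
    using that \<xi> by (simp add: rep_add inA H.hnorm_triangle rep_in)
  show sc: "hnorm ip (\<pi> (sc c x) \<xi>) = cmod c * hnorm ip (\<pi> x \<xi>)" if "x \<in> A0" for c x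
    using that \<xi> by (simp add: rep_sc inA H.hnorm_sm rep_in)
  have "\<exists>L d. finite L \<and> 0 < d \<and>
      (\<forall>b\<in>A. (\<forall>l\<in>L. p l (b - 0) < d) \<longrightarrow> hnorm ip (\<pi> b \<xi> - \<pi> 0 \<xi>) < 1)"
    by (rule rep_cont_vector) (use \<xi> inA[OF A0_zero] in auto)
  then obtain L d where L: "finite L" "0 < d"
    and less: "\<And>b. b \<in> A0 \<Longrightarrow> \<forall>l\<in>L. p l b < d \<Longrightarrow> hnorm ip (\<pi> b \<xi>) < 1"
    using inA by (auto simp: rep_zero[OF \<xi>])
  have "hnorm ip (\<pi> x \<xi>) \<le> 1 / d * (\<Sum>l\<in>L. p l x)" if x: "x \<in> A0" for x
  proof (rule field_le_epsilon)
    fix e :: real assume e: "0 < e"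
    define s where "s = (\<Sum>l\<in>L. p l x)"
    have s: "0 \<le> s" "\<And>l. l \<in> L \<Longrightarrow> p l x \<le> s"
      unfolding s_def by (auto intro!: sum_nonneg p_nonneg member_le_sum L(1))
    \<comment> \<open>\<open>t\<close> scales \<open>x\<close> into the neighbourhood. The term
      \<open>d * e\<close> keeps the denominator positive when all seminorms vanish at
      \<open>x\<close>, and it returns as the slack \<open>e\<close>.\<close>
    define t where "t = d / (s + d * e)"
    have pos: "0 < s + d * e" using s(1) L(2) e by (simp add: add_nonneg_pos)
    then have t: "0 < t" using L(2) by (simp add: t_def)
    have "t * s < d" using pos L(2) e by (simp add: t_def field_simps)
    then have "p l (sc (of_real t) x) < d" if "l \<in> L" for l
      using s(2)[OF that] t by (simp add: p_sc) (meson le_less_trans mult_left_mono less_imp_le)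
    then have "t * hnorm ip (\<pi> x \<xi>) < 1"
      using less[OF A0_sc[OF x, of "of_real t"]] sc[OF x, of "of_real t"] t by simp
    then have "hnorm ip (\<pi> x \<xi>) < (s + d * e) / d"
      using pos L(2) by (simp add: t_def field_simps)
    then show "hnorm ip (\<pi> x \<xi>) \<le> 1 / d * (\<Sum>l\<in>L. p l x) + e"
      using L(2) by (simp add: s_def[symmetric] field_simps)
  qed
  then show "\<exists>L C. finite L \<and> (\<forall>x\<in>A0. hnorm ip (\<pi> x \<xi>) \<le> C * (\<Sum>l\<in>L. p l x))"
    using L(1) by blast
qed

lemma vector_form_in_S:
  assumes \<xi>: "\<xi> \<in> D"
  shows "(\<lambda>x y. ip (\<pi> x \<xi>) (\<pi> y \<xi>)) \<in> S"
  unfolding S_forms_def mem_Collect_eq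
proof (intro conjI ballI allI)
  note inA = subsetD[OF A0_sub]
  note inH = rep_in[OF inA \<xi>]
  fix x assume x: "x \<in> A0"
  show "Im (ip (\<pi> x \<xi>) (\<pi> x \<xi>)) = 0" "0 \<le> Re (ip (\<pi> x \<xi>) (\<pi> x \<xi>))"
    using H.s_self[OF inH[OF x]] by simp_all
  fix y assume y: "y \<in> A0"
  show "ip (\<pi> (sc c x) \<xi>) (\<pi> y \<xi>) = c * ip (\<pi> x \<xi>) (\<pi> y \<xi>)"
    "ip (\<pi> x \<xi>) (\<pi> (sc c y) \<xi>) = cnj c * ip (\<pi> x \<xi>) (\<pi> y \<xi>)" for c
    using x y \<xi> by (simp_all add: rep_sc inA inH H.s_sm_left H.s_sm_right)
  fix z assume z: "z \<in> A0"
  show "ip (\<pi> (x + y) \<xi>) (\<pi> z \<xi>) = ip (\<pi> x \<xi>) (\<pi> z \<xi>) + ip (\<pi> y \<xi>) (\<pi> z \<xi>)"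
    "ip (\<pi> z \<xi>) (\<pi> (x + y) \<xi>) = ip (\<pi> z \<xi>) (\<pi> x \<xi>) + ip (\<pi> z \<xi>) (\<pi> y \<xi>)"
    using x y z \<xi> by (simp_all add: rep_add inA inH H.s_add_left H.s_add_right)
  \<comment> \<open>For \<open>x\<close> and \<open>y\<close> in A0 the images of
    \<open>\<xi>\<close> stay in \<open>D\<close>, so the adjoint relation \<open>rep_ip\<close> for
    \<open>z\<close> applies to them.\<close>
  show "ip (\<pi> (mul z x) \<xi>) (\<pi> y \<xi>) = ip (\<pi> x \<xi>) (\<pi> (mul (star z) y) \<xi>)"
    using x y z \<xi> by (simp add: rep_mul A0_star rep_ip inA rep_dom)
next
  have "\<forall>x\<in>A0. \<forall>y\<in>A0. cmod (ip (\<pi> x \<xi>) (\<pi> y \<xi>)) \<le> hnorm ip (\<pi> x \<xi>) * hnorm ip (\<pi> y \<xi>)"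
    using A0_sub \<xi> by (auto intro!: H.cauchy_schwarz rep_in)
  then show "\<exists>q. tau_cont_seminorm A0 sc p q \<and>
      (\<forall>x\<in>A0. \<forall>y\<in>A0. cmod (ip (\<pi> x \<xi>) (\<pi> y \<xi>)) \<le> q x * q y)"
    using vector_seminorm[OF \<xi>] by (intro exI[of _ "\<lambda>x. hnorm ip (\<pi> x \<xi>)"]) simp
qed

text \<open>Along the product filter both vectors converge in norm, by continuity of the
  representation, and the inner product is jointly continuous.\<close>

lemma vector_form_ext:
  assumes a: "a \<in> A" and \<xi>: "\<xi> \<in> D"
  shows "form_ext A0 p (\<lambda>x y. ip (\<pi> x \<xi>) (\<pi> y \<xi>)) a a = ip (\<pi> a \<xi>) (\<pi> a \<xi>)"
proof (rule form_ext_eqI)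
  let ?F = "A0_at a \<times>\<^sub>F A0_at a"
  have f: "filterlim fst (A0_at a) ?F" "filterlim snd (A0_at a) ?F"
    by (rule filterlim_fst filterlim_snd)+
  have ev: "eventually (\<lambda>n. \<pi> (g n) \<xi> \<in> H) ?F" if "filterlim g (A0_at a) ?F" for g
    using A0_at_in[OF that] by eventually_elim (use A0_sub rep_in \<xi> in blast)
  have "((\<lambda>n. ip (\<pi> (fst n) \<xi>) (\<pi> (snd n) \<xi>)) \<longlongrightarrow> ip (\<pi> a \<xi>) (\<pi> a \<xi>)) ?F"
    by (intro H.s_tendsto ev f rep_vector_lim rep_in a \<xi>)
  then show "((\<lambda>(x, y). ip (\<pi> x \<xi>) (\<pi> y \<xi>)) \<longlongrightarrow> ip (\<pi> a \<xi>) (\<pi> a \<xi>)) ?F"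
    by (simp add: case_prod_unfold)
qed

lemma faithful_imp_sufficient:
  assumes faithful: "rep_faithful A D \<pi>"
  shows "S_sufficient A0 sc mul star p A"
  unfolding S_sufficient_def
proof (intro ballI impI)
  fix a assume a: "a \<in> A" and zero: "\<forall>\<phi>\<in>S. form_ext A0 p \<phi> a a = 0"
  have "\<pi> a \<xi> = \<pi> 0 \<xi>" if \<xi>: "\<xi> \<in> D" for \<xi>
  proof -
    have "ip (\<pi> a \<xi>) (\<pi> a \<xi>) = 0"
      using zero vector_form_in_S[OF \<xi>] vector_form_ext[OF a \<xi>] by auto
    then have "\<pi> a \<xi> = 0"
      using rep_hilbert rep_in[OF a \<xi>] unfolding hilbert_space_def by blast
    then show ?thesis by (simp add: rep_zero[OF \<xi>])
  qed
  then show "a = 0"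
    using faithful a A0_zero A0_sub unfolding rep_faithful_def by blast
qed

end

end

theorem theorem7p3:
  fixes A0 A :: "'a::ab_group_add set"
    and sc :: "complex \<Rightarrow> 'a \<Rightarrow> 'a"
    and mul :: "'a \<Rightarrow> 'a \<Rightarrow> 'a"
    and star :: "'a \<Rightarrow> 'a"
    and n0 :: "'a \<Rightarrow> real"
    and one :: 'a
    and p :: "'i \<Rightarrow> 'a \<Rightarrow> real"
  assumes "lc_quasi_cstar_algebra A0 sc mul star n0 one p A"
  shows "((\<exists>(H :: 'h::ab_group_add set) sch ip D \<pi>.
             faithful_cont_star_rep A0 sc mul star p A H sch ip D \<pi>)
            \<longrightarrow> S_sufficient A0 sc mul star p A)
       \<and> (S_sufficient A0 sc mul star p A
            \<longrightarrow> (\<exists>(H :: 'a rep_space set) sch ip D \<pi>.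
                   faithful_cont_star_rep A0 sc mul star p A H sch ip D \<pi>))"
proof -
  have cstar: "unital_cstar_algebra A0 sc mul star n0 one"
    and compl: "tau_completion A0 sc p" and ext: "quasi_star_extension A0 p mul star"
    and T1: "cond_T1 A0 p mul star" and sub: "A0 \<subseteq> A"
    and A: "\<forall>a\<in>A. \<forall>b\<in>A. a + b \<in> A" "\<forall>c. \<forall>a\<in>A. sc c a \<in> A" "\<forall>a\<in>A. star a \<in> A"
    using assms unfolding lc_quasi_cstar_algebra_def by - (elim conjE, assumption)+
  interpret quasi_star_algebra A0 sc p mul star one
    using cstar compl ext T1 unfolding unital_cstar_algebra_def by unfold_locales simp_all
  show ?thesis
  proof (intro conjI impI)
    assume "\<exists>(H :: 'h set) sch ip D \<pi>. faithful_cont_star_rep A0 sc mul star p A H sch ip D \<pi>"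
    then show "S_sufficient A0 sc mul star p A"
      using faithful_imp_sufficient[OF sub] A(3) unfolding faithful_cont_star_rep_def by blast
  next
    assume "S_sufficient A0 sc mul star p A"
    then have "faithful_cont_star_rep A0 sc mul star p A ds.completion ds.comp_scale ds.comp_ip gns_dom gns_rep"
      using A by (intro gns_faithful_cont_star_rep) blast+
    then show "\<exists>(H :: 'a rep_space set) sch ip D \<pi>.
        faithful_cont_star_rep A0 sc mul star p A H sch ip D \<pi>"
      by blast
  qed
qed

end
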